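(* For $a>0$, $b>0$ consider the planar differential system $$\dot x=(a-x)(1+x^2)-4xy,\qquad \dot y=b x\,(1+x^2-y),\qquad (x,y)\in\mathbb{R}^2,$$ with unique equilibrium point $P_a=\left(\tfrac a5,\,1+\tfrac{a^2}{25}\right)$. Let $$b_H(a)=\frac{3a^2-125}{5a},\qquad a_B=\frac{5\sqrt{27+\sqrt{769}}}{2},$$ $$H_-=\left\{(a,b_H(a)): 5\sqrt{\tfrac53}<a\le a_B\right\},\qquad H_+=\left\{(a,b_H(a)): a>a_B\right\},\qquad B_a=(a_B,b_H(a_B)).$$ Then: (i) $P_a$ is asymptotically stable for $(a,b)\in H_-$ and unstable for $(a,b)\in H_+$. (ii) For every $(a_0,b_0)\in H_-\setminus\{B_a\}$ there is a neighborhood $U$ of $(a_0,b_0)$ such that for all $(a,b)\in U$ with $b<b_H(a)$ the equilibrium $P_a$ is unstable and the system has a stable limit cycle surrounding $P_a$. (iii) For every $(a_0,b_0)\in H_+$ there is a neighborhood $U$ of $(a_0,b_0)$ such that for all $(a,b)\in U$ with $b>b_H(a)$ the equilibrium $P_a$ is (asymptotically) stable and the system has an unstable limit cycle surrounding $P_a$.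
   Context: A limit cycle is an isolated closed (nonconstant periodic) orbit; it is stable if nearby orbits on both sides converge to it as $t\to\infty$, and unstable if nearby orbits on both sides converge to it as $t\to-\infty$. A closed orbit surrounds a point if the point lies in the bounded component of its complement in $\mathbb{R}^2$. *)

theory Defs
  imports "HOL-Analysis.Analysis"
begin

definition solves :: "('a::real_normed_vector \<Rightarrow> 'a) \<Rightarrow> (real \<Rightarrow> 'a) \<Rightarrow> real set \<Rightarrow> bool" where
  "solves f \<phi> I \<longleftrightarrow> (\<forall>t\<in>I. (\<phi> has_vector_derivative f (\<phi> t)) (at t within I))"

definition equilibrium :: "('a::real_normed_vector \<Rightarrow> 'a) \<Rightarrow> 'a \<Rightarrow> bool" where
  "equilibrium f p \<longleftrightarrow> f p = 0"

text \<open>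
  Stability is formulated with solutions on compact intervals \<^term>\<open>{0..T}\<close>, so that its negation
  yields a genuine solution leaving a fixed ball around the equilibrium, also if solutions
  may blow up in finite time.
\<close>
definition lyapunov_stable :: "('a::real_normed_vector \<Rightarrow> 'a) \<Rightarrow> 'a \<Rightarrow> bool" where
  "lyapunov_stable f p \<longleftrightarrow> equilibrium f p \<and>
     (\<forall>\<epsilon>>0. \<exists>\<delta>>0. \<forall>\<phi> T. 0 \<le> T \<longrightarrow> solves f \<phi> {0..T} \<longrightarrow> dist (\<phi> 0) p < \<delta> \<longrightarrow>
        (\<forall>t\<in>{0..T}. dist (\<phi> t) p < \<epsilon>))"

definition asymptotically_stable :: "('a::real_normed_vector \<Rightarrow> 'a) \<Rightarrow> 'a \<Rightarrow> bool" where
  "asymptotically_stable f p \<longleftrightarrow> lyapunov_stable f p \<and>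
     (\<exists>\<eta>>0. \<forall>x0. dist x0 p < \<eta> \<longrightarrow>
        (\<exists>\<phi>. solves f \<phi> {0..} \<and> \<phi> 0 = x0) \<and>
        (\<forall>\<phi>. solves f \<phi> {0..} \<longrightarrow> \<phi> 0 = x0 \<longrightarrow> (\<phi> \<longlongrightarrow> p) at_top))"

definition unstable :: "('a::real_normed_vector \<Rightarrow> 'a) \<Rightarrow> 'a \<Rightarrow> bool" where
  "unstable f p \<longleftrightarrow> equilibrium f p \<and> \<not> lyapunov_stable f p"

definition closed_orbit :: "('a::real_normed_vector \<Rightarrow> 'a) \<Rightarrow> 'a set \<Rightarrow> bool" where
  "closed_orbit f \<Gamma> \<longleftrightarrow>
     (\<exists>\<phi> T. T > 0 \<and> solves f \<phi> UNIV \<and> (\<forall>t. \<phi> (t + T) = \<phi> t) \<and> (\<exists>t. \<phi> t \<noteq> \<phi> 0) \<and> \<Gamma> = range \<phi>)"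

definition limit_cycle :: "('a::real_normed_vector \<Rightarrow> 'a) \<Rightarrow> 'a set \<Rightarrow> bool" where
  "limit_cycle f \<Gamma> \<longleftrightarrow> closed_orbit f \<Gamma> \<and>
     (\<exists>V. open V \<and> \<Gamma> \<subseteq> V \<and> (\<forall>\<Gamma>'. closed_orbit f \<Gamma>' \<longrightarrow> \<Gamma>' \<inter> V \<noteq> {} \<longrightarrow> \<Gamma>' = \<Gamma>))"

text \<open>
  An open set containing a closed orbit in the plane contains points on both of its sides.
\<close>
definition stable_limit_cycle :: "('a::real_normed_vector \<Rightarrow> 'a) \<Rightarrow> 'a set \<Rightarrow> bool" where
  "stable_limit_cycle f \<Gamma> \<longleftrightarrow> limit_cycle f \<Gamma> \<and>
     (\<exists>V. open V \<and> \<Gamma> \<subseteq> V \<and> (\<forall>x0\<in>V.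
        (\<exists>\<phi>. solves f \<phi> {0..} \<and> \<phi> 0 = x0) \<and>
        (\<forall>\<phi>. solves f \<phi> {0..} \<longrightarrow> \<phi> 0 = x0 \<longrightarrow> ((\<lambda>t. infdist (\<phi> t) \<Gamma>) \<longlongrightarrow> 0) at_top)))"

definition unstable_limit_cycle :: "('a::real_normed_vector \<Rightarrow> 'a) \<Rightarrow> 'a set \<Rightarrow> bool" where
  "unstable_limit_cycle f \<Gamma> \<longleftrightarrow> limit_cycle f \<Gamma> \<and>
     (\<exists>V. open V \<and> \<Gamma> \<subseteq> V \<and> (\<forall>x0\<in>V.
        (\<exists>\<phi>. solves f \<phi> {..0} \<and> \<phi> 0 = x0) \<and>
        (\<forall>\<phi>. solves f \<phi> {..0} \<longrightarrow> \<phi> 0 = x0 \<longrightarrow> ((\<lambda>t. infdist (\<phi> t) \<Gamma>) \<longlongrightarrow> 0) at_bot)))"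

text \<open>
  The library set \<^term>\<open>inside \<Gamma>\<close> is the union of the bounded components of the complement.
\<close>
definition surrounds :: "'a::real_normed_vector set \<Rightarrow> 'a \<Rightarrow> bool" where
  "surrounds \<Gamma> p \<longleftrightarrow> p \<in> inside \<Gamma>"

definition vf :: "real \<Rightarrow> real \<Rightarrow> real \<times> real \<Rightarrow> real \<times> real" where
  "vf a b = (\<lambda>(x, y). ((a - x) * (1 + x\<^sup>2) - 4 * x * y, b * x * (1 + x\<^sup>2 - y)))"

definition P_eq :: "real \<Rightarrow> real \<times> real" where
  "P_eq a = (a / 5, 1 + a\<^sup>2 / 25)"

definition b_H :: "real \<Rightarrow> real" where
  "b_H a = (3 * a\<^sup>2 - 125) / (5 * a)"

definition a_B :: real where
  "a_B = 5 * sqrt (27 + sqrt 769) / 2"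

definition H_minus :: "(real \<times> real) set" where
  "H_minus = {(a, b_H a) | a. 5 * sqrt (5 / 3) < a \<and> a \<le> a_B}"

definition H_plus :: "(real \<times> real) set" where
  "H_plus = {(a, b_H a) | a. a > a_B}"

definition B_point :: "real \<times> real" where
  "B_point = (a_B, b_H a_B)"

end

(*
The affine change
x = alpha + 4 alpha p, y = 1 + alpha^2 + b alpha p + omega q (with alpha = a/5 and omega^2 the
determinant at the equilibrium) turns the field into omega times
  p' = -q(1+4p) + mu p - B p^2 - D p^3,   q' = p(1 + 8mp + 16mp^2),
where mu has the sign of b_H(a) - b. Homological equations, solved degree by degree, give a
polynomial W = p^2 + q^2 + ... with W' = -k r^4 + O(r^5) at mu = 0, where k changes sign exactly
at a_B; at the Bautin point k = 0 and W' = K r^6 + O(r^7) with K < 0. Lyapunov's theorems settle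
the stability claims.

For the limit cycle put (p,q) = e(rho cos theta, rho sin theta) with mu = k e^2. Then
dW/dtheta = e^2 k (rho^2 - rho^4) + O(e^3), uniformly in the parameters and in C^1 with respect to
rho. Hence an annulus around rho = 1 is trapping and the distance in W of two orbits decays
exponentially in theta: the Poincare map is a contraction, its fixed point is the cycle, and no
smooth dependence on initial values is needed. Time reversal combined with q -> -q maps the
family to itself with mu, B, D, k negated and yields the unstable cycle.
*)
theory Submission
  imports Defs
begin

section \<open>Ordinary differential equations\<close>

text \<open>The radius is a poor coordinate for comparing two orbits: d\<rho>/d\<theta> has a term
  of order e that cancels only on average over a turn and masks the contraction of order e^2. In W
  this term is absent, so the contraction is visible at every single angle. The damping mu acts on p
  alone, and the derivative of p^2 + q^2 degenerates on the axis p = 0. Subtracting a multiple of p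
  q from the Lyapunov function spreads the damping evenly over p and q; this correction serves both
  the cycle and the equilibrium with nonzero trace. The function \<rho>^2 - \<rho>^4 decreases only
  for \<rho>^2 > 1/2, so the annulus has to stay outside the radius 1 / sqrt 2. The sets U in (ii)
  and (iii) are neighbourhoods in both parameters: while e = sqrt (mu / k) shrinks, m, B, D and k
  move as well. Hence every smallness condition on e depends only on a common bound R for |m|, |B|,
  |D| and on a positive lower bound k0 for k. Solutions are built for fields cut off to be bounded
  and globally Lipschitz; an orbit is genuine as soon as it is shown to stay where the cut-off
  changes nothing.\<close>

definition antideriv0 :: "(real \<Rightarrow> 'a::euclidean_space) \<Rightarrow> real \<Rightarrow> 'a" where
  "antideriv0 g t = integral {0..t} g - integral {t..0} g"

lemma antideriv0_0 [simp]: "antideriv0 g 0 = 0"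
  by (simp add: antideriv0_def)

text \<open>One of the two integrals in \<open>antideriv0\<close> always runs over an empty or
  one-point interval, so their difference is the signed integral from 0. A base point -n to the left
  of both 0 and t turns it into \<open>integral {-n..u} g\<close> up to a constant, whatever the
  sign of u.\<close>

lemma antideriv0_deriv:
  fixes g :: "real \<Rightarrow> 'a::euclidean_space"
  assumes "continuous_on UNIV g"
  shows "(antideriv0 g has_vector_derivative g t) (at t)"
proof -
  define n where "n = \<bar>t\<bar> + 1"
  have n: "n > 0" "-n < t" "t < n" by (auto simp: n_def)
  have cont: "continuous_on S g" for S using assms continuous_on_subset by blast
  have int: "g integrable_on {a..b}" for a b
    by (rule integrable_continuous_real[OF cont])
  have eq: "antideriv0 g u = integral {-n..u} g - integral {-n..0} g" if "u \<in> {-n<..<n}" for u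
  proof (cases "u \<ge> 0")
    case True
    have "integral {-n..0} g + integral {0..u} g = integral {-n..u} g"
      by (rule Henstock_Kurzweil_Integration.integral_combine) (use True n int in auto)
    moreover have "integral {u..0} g = 0" using True by (cases "u = 0") auto
    ultimately show ?thesis by (auto simp: antideriv0_def algebra_simps)
  next
    case False
    have "integral {-n..u} g + integral {u..0} g = integral {-n..0} g"
      by (rule Henstock_Kurzweil_Integration.integral_combine) (use False that int in auto)
    moreover have "integral {0..u} g = 0" using False by auto
    ultimately show ?thesis by (auto simp: antideriv0_def algebra_simps)
  qed
  have "((\<lambda>u. integral {-n..u} g) has_vector_derivative g t) (at t within {-n..n})"
    by (rule integral_has_vector_derivative) (use n cont in auto)
  then have "((\<lambda>u. integral {-n..u} g) has_vector_derivative g t) (at t)"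
    using n by (simp add: at_within_Icc_at)
  then have "((\<lambda>u. integral {-n..u} g - integral {-n..0} g) has_vector_derivative g t) (at t)"
    by (auto intro!: derivative_eq_intros)
  then show ?thesis
    by (rule has_vector_derivative_transform_within_open[where S="{-n<..<n}"]) (use n eq in auto)
qed

text \<open>Integration gains a factor 1 / K in the norm weighted by exp (- K |t|). This gain is
  what makes the Picard iteration contract on the whole line.\<close>

lemma antideriv0_bound:
  fixes g :: "real \<Rightarrow> 'a::euclidean_space"
  assumes cont: "continuous_on UNIV g" and K: "K > 0"
    and bd: "\<And>s. norm (g s) \<le> c * exp (K * \<bar>s\<bar>)"
  shows "norm (antideriv0 g t) \<le> c / K * exp (K * \<bar>t\<bar>)"
proof -
  have c: "c \<ge> 0" using order_trans[OF norm_ge_zero bd[of 0]] by simp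
  have int: "g integrable_on {a..b}" for a b
    by (rule integrable_continuous_real) (use cont continuous_on_subset in blast)
  show ?thesis
  proof (cases "t \<ge> 0")
    case True
    have I: "((\<lambda>s. c * exp (K * s)) has_integral (c / K * exp (K * t) - c / K * exp (K * 0))) {0..t}"
      by (rule fundamental_theorem_of_calculus)
        (use True K in \<open>auto intro!: derivative_eq_intros
            simp flip: has_real_derivative_iff_has_vector_derivative\<close>)
    have "norm (integral {0..t} g) \<le> integral {0..t} (\<lambda>s. c * exp (K * s))"
    proof (rule integral_norm_bound_integral)
      show "norm (g s) \<le> c * exp (K * s)" if "s \<in> {0..t}" for s
        using bd[of s] that by simp
    qed (use int I in \<open>force simp: has_integral_integrable\<close>)+
    then have "norm (integral {0..t} g) \<le> c / K * exp (K * t) - c / K"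
      unfolding integral_unique[OF I] by simp
    also have "\<dots> \<le> c / K * exp (K * t)" using c K by simp
    finally have "norm (integral {0..t} g) \<le> c / K * exp (K * t)" .
    moreover have "integral {t..0} g = 0" using True by (cases "t = 0") auto
    ultimately show ?thesis using True by (auto simp: antideriv0_def)
  next
    case False
    have I: "((\<lambda>s. c * exp (- K * s)) has_integral ((- c / K) * exp (- K * 0) - (- c / K) * exp (- K * t))) {t..0}"
      by (rule fundamental_theorem_of_calculus)
        (use False K in \<open>auto intro!: derivative_eq_intros
            simp flip: has_real_derivative_iff_has_vector_derivative\<close>)
    have "norm (integral {t..0} g) \<le> integral {t..0} (\<lambda>s. c * exp (- K * s))"
    proof (rule integral_norm_bound_integral)
      show "norm (g s) \<le> c * exp (- K * s)" if "s \<in> {t..0}" for s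
        using bd[of s] that by (simp add: abs_of_nonpos)
    qed (use int I in \<open>force simp: has_integral_integrable\<close>)+
    then have "norm (integral {t..0} g) \<le> c / K * exp (- K * t) - c / K"
      unfolding integral_unique[OF I] by simp
    also have "\<dots> \<le> c / K * exp (K * \<bar>t\<bar>)" using c K False by simp
    finally have "norm (integral {t..0} g) \<le> c / K * exp (K * \<bar>t\<bar>)" .
    moreover have "integral {0..t} g = 0" using False by auto
    ultimately show ?thesis by (auto simp: antideriv0_def)
  qed
qed

text \<open>The unknown is written as x0 + exp (K |t|) \<psi> t with \<psi> bounded and continuous.
  In this weighted norm the integral operator contracts on all of the real line at once, so a single
  fixed point yields the global solution without gluing local ones.\<close>

theorem picard_lindelof_global:
  fixes F :: "real \<Rightarrow> 'a \<Rightarrow> 'a::euclidean_space"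
  assumes cont: "continuous_on UNIV (\<lambda>(t, x). F t x)"
    and lip: "\<And>t x y. norm (F t x - F t y) \<le> L * norm (x - y)"
    and bd: "\<And>t x. norm (F t x) \<le> M"
  obtains \<phi> where "\<phi> 0 = x0" "\<And>t. (\<phi> has_vector_derivative F t (\<phi> t)) (at t)"
proof -
  \<comment> \<open>The contraction factor is |L| / K, and this K makes it at most 1/2; the summand
    1 keeps K positive when L = 0.\<close>
  define K where "K = 2 * \<bar>L\<bar> + 1"
  have K: "K > 0" "\<bar>L\<bar> \<le> K / 2" by (auto simp: K_def)
  have M: "M \<ge> 0" using order_trans[OF norm_ge_zero bd] .
  define \<Phi> where "\<Phi> = (\<lambda>(\<psi> :: real \<Rightarrow>\<^sub>C 'a) t. x0 + exp (K * \<bar>t\<bar>) *\<^sub>R apply_bcontfun \<psi> t)"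
  define G where "G = (\<lambda>\<psi>. antideriv0 (\<lambda>s. F s (\<Phi> \<psi> s)))"
  have contF: "continuous_on UNIV (\<lambda>s. F s (\<Phi> \<psi> s))" for \<psi>
  proof -
    have "continuous_on UNIV (\<lambda>s. (s, \<Phi> \<psi> s))"
      unfolding \<Phi>_def by (intro continuous_intros) auto
    from continuous_on_compose2[OF cont this] show ?thesis by simp
  qed
  have dG: "(G \<psi> has_vector_derivative F t (\<Phi> \<psi> t)) (at t)" for \<psi> t
    unfolding G_def by (rule antideriv0_deriv[OF contF])
  have contG: "continuous_on UNIV (G \<psi>)" for \<psi>
    using dG has_vector_derivative_continuous continuous_at_imp_continuous_on by blast
  have bG: "norm (G \<psi> t) \<le> M / K * exp (K * \<bar>t\<bar>)" for \<psi> t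
    unfolding G_def
  proof (rule antideriv0_bound[OF contF K(1)])
    fix s
    have "norm (F s (\<Phi> \<psi> s)) \<le> M * 1" using bd by simp
    also have "\<dots> \<le> M * exp (K * \<bar>s\<bar>)" using M K by (intro mult_left_mono) auto
    finally show "norm (F s (\<Phi> \<psi> s)) \<le> M * exp (K * \<bar>s\<bar>)" .
  qed
  define T where "T = (\<lambda>\<psi>. Bcontfun (\<lambda>t. exp (- K * \<bar>t\<bar>) *\<^sub>R G \<psi> t))"
  have Tb: "(\<lambda>t. exp (- K * \<bar>t\<bar>) *\<^sub>R G \<psi> t) \<in> bcontfun" for \<psi>
    unfolding bcontfun_def
  proof safe
    show "continuous_on UNIV (\<lambda>t. exp (- K * \<bar>t\<bar>) *\<^sub>R G \<psi> t)"
      by (intro continuous_intros contG)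
    have "norm (exp (- K * \<bar>t\<bar>) *\<^sub>R G \<psi> t) \<le> M / K" for t
      using mult_left_mono[OF bG[of \<psi> t], of "exp (- K * \<bar>t\<bar>)"]
      by (simp add: exp_minus field_simps)
    then show "bounded (range (\<lambda>t. exp (- K * \<bar>t\<bar>) *\<^sub>R G \<psi> t))"
      unfolding bounded_iff by blast
  qed
  have Tapp: "apply_bcontfun (T \<psi>) t = exp (- K * \<bar>t\<bar>) *\<^sub>R G \<psi> t" for \<psi> t
    unfolding T_def using Tb by (simp add: Bcontfun_inverse)
  have "dist (T \<psi>) (T \<xi>) \<le> (1/2) * dist \<psi> \<xi>" for \<psi> \<xi>
  proof (rule dist_bound)
    fix t
    define g where "g = (\<lambda>s. F s (\<Phi> \<psi> s) - F s (\<Phi> \<xi> s))"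
    have cg: "continuous_on UNIV g" unfolding g_def by (intro continuous_intros contF)
    have Gd: "G \<psi> t - G \<xi> t = antideriv0 g t"
    proof -
      have i: "(\<lambda>s. F s (\<Phi> \<psi> s)) integrable_on {a..b}" for \<psi> a b
        by (rule integrable_continuous_real) (use contF continuous_on_subset in blast)
      show ?thesis unfolding G_def g_def antideriv0_def
        by (simp add: Henstock_Kurzweil_Integration.integral_diff[OF i i])
    qed
    have "norm (antideriv0 g t) \<le> (\<bar>L\<bar> * dist \<psi> \<xi>) / K * exp (K * \<bar>t\<bar>)"
    proof (rule antideriv0_bound[OF cg K(1)])
      fix s
      have "norm (g s) \<le> L * norm (\<Phi> \<psi> s - \<Phi> \<xi> s)" unfolding g_def by (rule lip)
      also have "\<dots> \<le> \<bar>L\<bar> * norm (\<Phi> \<psi> s - \<Phi> \<xi> s)" by (intro mult_right_mono) auto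
      also have "\<dots> \<le> \<bar>L\<bar> * (exp (K * \<bar>s\<bar>) * dist \<psi> \<xi>)"
      proof (intro mult_left_mono)
        have "norm (\<Phi> \<psi> s - \<Phi> \<xi> s) = exp (K * \<bar>s\<bar>) * dist (\<psi> s) (\<xi> s)"
        unfolding \<Phi>_def dist_norm by (simp flip: scaleR_diff_right)
      also have "\<dots> \<le> exp (K * \<bar>s\<bar>) * dist \<psi> \<xi>"
        by (intro mult_left_mono dist_bounded) auto
        finally show "norm (\<Phi> \<psi> s - \<Phi> \<xi> s) \<le> exp (K * \<bar>s\<bar>) * dist \<psi> \<xi>" .
      qed simp
      finally show "norm (g s) \<le> \<bar>L\<bar> * dist \<psi> \<xi> * exp (K * \<bar>s\<bar>)"
        by (simp add: mult_ac)
    qed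
    also have "\<dots> \<le> (1/2) * dist \<psi> \<xi> * exp (K * \<bar>t\<bar>)"
    proof -
      have "(\<bar>L\<bar> * dist \<psi> \<xi>) / K = (\<bar>L\<bar> / K) * dist \<psi> \<xi>" by simp
      also have "\<dots> \<le> (1/2) * dist \<psi> \<xi>"
        using K by (intro mult_right_mono) (auto simp: field_simps)
      finally show ?thesis by (intro mult_right_mono) auto
    qed
    finally have "norm (G \<psi> t - G \<xi> t) \<le> (1/2) * dist \<psi> \<xi> * exp (K * \<bar>t\<bar>)"
      using Gd by simp
    then have "exp (- K * \<bar>t\<bar>) * norm (G \<psi> t - G \<xi> t) \<le> exp (- K * \<bar>t\<bar>) * ((1/2) * dist \<psi> \<xi> * exp (K * \<bar>t\<bar>))"
      by (intro mult_left_mono) auto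
    also have "\<dots> = (1/2) * dist \<psi> \<xi>" by (simp add: exp_minus field_simps)
    finally show "dist (T \<psi> t) (T \<xi> t) \<le> (1/2) * dist \<psi> \<xi>"
      by (simp add: Tapp dist_norm flip: scaleR_diff_right)
  qed
  then obtain \<psi> where \<psi>: "T \<psi> = \<psi>"
    using banach_fix_type[of "1/2" T] by auto
  have eq: "\<Phi> \<psi> t = x0 + G \<psi> t" for t
  proof -
    have "\<psi> t = exp (- K * \<bar>t\<bar>) *\<^sub>R G \<psi> t" using \<psi> Tapp by metis
    then show ?thesis unfolding \<Phi>_def by (simp add: exp_minus)
  qed
  have "((\<lambda>t. x0 + G \<psi> t) has_vector_derivative F t (\<Phi> \<psi> t)) (at t)" for t
    using dG by (auto intro!: derivative_eq_intros)
  moreover have "G \<psi> 0 = 0" by (simp add: G_def)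
  ultimately show ?thesis using that[of "\<lambda>t. x0 + G \<psi> t"] by (simp add: eq)
qed

section \<open>Gronwall's inequality and uniqueness\<close>

text \<open>The integrating factor exp (- c t) turns the differential inequality into monotonicity.
  The rate c may be negative, which is how \<open>contraction\<close> obtains its decay.\<close>

lemma gronwall:
  fixes v :: "real \<Rightarrow> real"
  assumes "a \<le> b"
    and der: "\<And>t. t \<in> {a..b} \<Longrightarrow> (v has_real_derivative v' t) (at t within {a..b})"
    and le: "\<And>t. t \<in> {a..b} \<Longrightarrow> v' t \<le> c * v t"
  shows "v b \<le> v a * exp (c * (b - a))"
proof -
  define w where "w = (\<lambda>t. v t * exp (- c * t))"
  have "(w has_real_derivative (v' t - c * v t) * exp (- c * t)) (at t within {a..b})" if "t \<in> {a..b}" for t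
    unfolding w_def by (auto intro!: derivative_eq_intros der that simp: algebra_simps)
  then have "\<exists>t\<in>{a..b}. w b - w a = (\<lambda>x. (v' t - c * v t) * exp (- c * t) * x) (b - a)"
    by (intro mvt_very_simple assms) (auto simp: has_field_derivative_def)
  then obtain t where t: "t \<in> {a..b}" "w b - w a = (v' t - c * v t) * exp (- c * t) * (b - a)" by blast
  have "(v' t - c * v t) * exp (- c * t) * (b - a) \<le> 0"
    using le[OF t(1)] assms(1) by (intro mult_nonpos_nonneg) auto
  then have "w b \<le> w a" using t by simp
  then have "w b * exp (c * b) \<le> w a * exp (c * b)" by simp
  moreover have "w b * exp (c * b) = v b" "w a * exp (c * b) = v a * exp (c * (b - a))"
    by (simp_all add: w_def right_diff_distrib exp_diff exp_minus field_simps)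
  ultimately show ?thesis by simp
qed

text \<open>The squared distance is differentiable even where the two curves meet, so Gronwall
  applies to it. The Lipschitz bound is asked for along the two curves only, which suits fields that
  are merely locally Lipschitz.\<close>

lemma ode_unique:
  fixes \<phi> \<psi> :: "real \<Rightarrow> 'a::euclidean_space"
  assumes "a \<le> b"
    and 1: "\<And>t. t \<in> {a..b} \<Longrightarrow> (\<phi> has_vector_derivative F t (\<phi> t)) (at t within {a..b})"
    and 2: "\<And>t. t \<in> {a..b} \<Longrightarrow> (\<psi> has_vector_derivative F t (\<psi> t)) (at t within {a..b})"
    and lip: "\<And>t. t \<in> {a..b} \<Longrightarrow> norm (F t (\<phi> t) - F t (\<psi> t)) \<le> L * norm (\<phi> t - \<psi> t)"
    and "\<phi> a = \<psi> a"
  shows "\<phi> b = \<psi> b"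
proof -
  define v where "v = (\<lambda>t. (\<phi> t - \<psi> t) \<bullet> (\<phi> t - \<psi> t))"
  define v' where "v' = (\<lambda>t. 2 * ((\<phi> t - \<psi> t) \<bullet> (F t (\<phi> t) - F t (\<psi> t))))"
  have "v b \<le> v a * exp ((2 * L) * (b - a))"
  proof (rule gronwall[OF \<open>a \<le> b\<close>])
    fix t assume t: "t \<in> {a..b}"
    have "((\<lambda>t. \<phi> t - \<psi> t) has_vector_derivative F t (\<phi> t) - F t (\<psi> t)) (at t within {a..b})"
      by (intro derivative_intros 1 2 t)
    from has_derivative_inner[OF this[unfolded has_vector_derivative_def] this[unfolded has_vector_derivative_def]]
    show "(v has_real_derivative v' t) (at t within {a..b})"
      unfolding v_def v'_def has_field_derivative_def
      by (rule has_derivative_eq_rhs) (auto simp: fun_eq_iff inner_commute)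
    have "(\<phi> t - \<psi> t) \<bullet> (F t (\<phi> t) - F t (\<psi> t)) \<le> norm (\<phi> t - \<psi> t) * norm (F t (\<phi> t) - F t (\<psi> t))"
      by (rule norm_cauchy_schwarz)
    also have "\<dots> \<le> norm (\<phi> t - \<psi> t) * (L * norm (\<phi> t - \<psi> t))"
      by (intro mult_left_mono lip t) auto
    also have "\<dots> = L * v t" by (simp add: v_def dot_square_norm power2_eq_square)
    finally show "v' t \<le> 2 * L * v t" by (simp add: v'_def)
  qed
  also have "v a = 0" using assms by (simp add: v_def)
  finally have "v b \<le> 0" by simp
  then have "norm (\<phi> b - \<psi> b) ^ 2 \<le> 0" by (simp add: v_def dot_square_norm)
  then show ?thesis by simp
qed

lemma solves_subset: "solves f \<phi> I \<Longrightarrow> J \<subseteq> I \<Longrightarrow> solves f \<phi> J"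
  unfolding solves_def by (meson has_vector_derivative_within_subset subsetD)

lemma solves_continuous_on: "solves f \<phi> I \<Longrightarrow> continuous_on I \<phi>"
  unfolding solves_def by (meson continuous_on_eq_continuous_within has_vector_derivative_continuous)

definition lipschitz_on_balls :: "('a::euclidean_space \<Rightarrow> 'a) \<Rightarrow> bool" where
  "lipschitz_on_balls f \<longleftrightarrow> (\<forall>R. \<exists>L. L-lipschitz_on (cball 0 R) f)"

lemma lipschitz_on_balls_bounded:
  fixes f :: "'a::euclidean_space \<Rightarrow> 'a"
  assumes "lipschitz_on_balls f" "bounded S"
  obtains L where "L-lipschitz_on S f"
proof -
  obtain R where R: "S \<subseteq> cball 0 R" using bounded_subset_ballD[OF assms(2), of 0] ball_subset_cball by (metis subset_trans)
  obtain L where "L-lipschitz_on (cball 0 R) f"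
    using assms(1) unfolding lipschitz_on_balls_def by metis
  from that[OF lipschitz_on_subset[OF this R]] show ?thesis .
qed

lemma lipschitz_on_balls_continuous:
  assumes "lipschitz_on_balls f"
  shows "continuous_on S f"
proof -
  have "isCont f x" for x
  proof -
    obtain L where "L-lipschitz_on (ball x 1) f"
      using lipschitz_on_balls_bounded[OF assms bounded_ball] by blast
    then have "continuous_on (ball x 1) f" by (rule lipschitz_on_continuous_on)
    then show ?thesis by (simp add: continuous_on_interior)
  qed
  then show ?thesis by (simp add: continuous_at_imp_continuous_on)
qed

lemma solves_unique:
  assumes lip: "lipschitz_on_balls f"
    and 1: "solves f \<phi> {a..b}" and 2: "solves f \<psi> {a..b}" and eq: "\<phi> a = \<psi> a"
    and t: "t \<in> {a..b}"
  shows "\<phi> t = \<psi> t"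
proof -
  have sub: "{a..t} \<subseteq> {a..b}" using t by auto
  have 1: "solves f \<phi> {a..t}" and 2: "solves f \<psi> {a..t}"
    using 1 2 solves_subset sub by blast+
  have "bounded (\<phi> ` {a..t})" "bounded (\<psi> ` {a..t})"
    using solves_continuous_on[OF 1] solves_continuous_on[OF 2]
    by (auto intro: compact_imp_bounded compact_continuous_image)
  then have "bounded (\<phi> ` {a..t} \<union> \<psi> ` {a..t})" by simp
  then obtain L where L: "L-lipschitz_on (\<phi> ` {a..t} \<union> \<psi> ` {a..t}) f"
    using lipschitz_on_balls_bounded[OF lip] by blast
  show ?thesis
  proof (rule ode_unique[where F="\<lambda>_. f" and a=a and L=L])
    show "norm (f (\<phi> s) - f (\<psi> s)) \<le> L * norm (\<phi> s - \<psi> s)" if "s \<in> {a..t}" for s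
      using lipschitz_onD[OF L, of "\<phi> s" "\<psi> s"] that by (auto simp: dist_norm)
  qed (use 1 2 t eq in \<open>auto simp: solves_def\<close>)
qed

lemma solves_unique_forward:
  assumes "lipschitz_on_balls f" "solves f \<phi> {0..}" "solves f \<psi> {0..}" "\<phi> 0 = \<psi> 0" "t \<ge> 0"
  shows "\<phi> t = \<psi> t"
  by (rule solves_unique[OF assms(1), of _ 0 t])
    (use assms(4,5) solves_subset[OF assms(2), of "{0..t}"] solves_subset[OF assms(3), of "{0..t}"] in auto)

section \<open>Time reversal\<close>

lemma solves_reverse:
  assumes "solves f \<phi> I"
  shows "solves (\<lambda>z. - f z) (\<lambda>t. \<phi> (- t)) (uminus ` I)"
  unfolding solves_def
proof
  fix t assume "t \<in> uminus ` I"
  then have "- t \<in> I" by auto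
  then have "(\<phi> has_vector_derivative f (\<phi> (- t))) (at (- t) within I)"
    using assms by (auto simp: solves_def)
  moreover have "uminus ` uminus ` I = I" by (force simp: image_iff)
  ultimately have "(\<phi> has_vector_derivative f (\<phi> (- t))) (at (- t) within (uminus ` uminus ` I))"
    by simp
  moreover have "(uminus has_vector_derivative -1) (at t within uminus ` I)"
    by (auto intro!: derivative_eq_intros)
  ultimately show "((\<lambda>t. \<phi> (- t)) has_vector_derivative - f (\<phi> (- t))) (at t within uminus ` I)"
    using vector_diff_chain_within[of uminus "-1" t "uminus ` I" \<phi> "f (\<phi> (- t))"] by (simp add: o_def)
qed

lemma solves_reverse_atMost:
  "solves (\<lambda>z. - f z) \<phi> {0..} \<longleftrightarrow> solves f (\<lambda>t. \<phi> (- t)) {..0}"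
  using solves_reverse[of "\<lambda>z. - f z" \<phi> "{0..}"] solves_reverse[of f "\<lambda>t. \<phi> (- t)" "{..0}"] by auto

lemma solves_reverse_UNIV:
  "solves (\<lambda>z. - f z) \<phi> UNIV \<Longrightarrow> solves f (\<lambda>t. \<phi> (- t)) UNIV"
  using solves_reverse[of "\<lambda>z. - f z" \<phi> UNIV] by (simp add: surj_uminus)

lemma closed_orbit_reverse_imp:
  assumes "closed_orbit (\<lambda>z. - f z) \<Gamma>"
  shows "closed_orbit f \<Gamma>"
proof -
  obtain \<phi> T where \<phi>: "T > 0" "solves (\<lambda>z. - f z) \<phi> UNIV" "\<forall>t. \<phi> (t + T) = \<phi> t" "\<exists>t. \<phi> t \<noteq> \<phi> 0" "\<Gamma> = range \<phi>"
    using assms unfolding closed_orbit_def by blast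
  have "\<phi> (- (t + T)) = \<phi> (- t)" for t
    using spec[OF \<phi>(3), of "- t - T"] by simp
  moreover have "\<exists>t. \<phi> (- t) \<noteq> \<phi> (- 0)" using \<phi>(4) by (metis minus_minus neg_equal_0_iff_equal)
  moreover have "range \<phi> = range (\<lambda>t. \<phi> (- t))" by (metis image_image surj_uminus)
  ultimately show ?thesis unfolding closed_orbit_def
    using \<phi>(1,5) solves_reverse_UNIV[OF \<phi>(2)] by blast
qed

lemma closed_orbit_reverse: "closed_orbit (\<lambda>z. - f z) \<Gamma> \<longleftrightarrow> closed_orbit f \<Gamma>"
  using closed_orbit_reverse_imp[of f \<Gamma>] closed_orbit_reverse_imp[of "\<lambda>z. - f z" \<Gamma>] by auto

lemma unstable_limit_cycle_reverse:
  assumes "stable_limit_cycle (\<lambda>z. - f z) \<Gamma>"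
  shows "unstable_limit_cycle f \<Gamma>"
proof -
  have "limit_cycle f \<Gamma>"
    using assms unfolding stable_limit_cycle_def limit_cycle_def closed_orbit_reverse by blast
  moreover obtain V where V: "open V" "\<Gamma> \<subseteq> V"
    "\<And>x0. x0 \<in> V \<Longrightarrow> \<exists>\<phi>. solves (\<lambda>z. - f z) \<phi> {0..} \<and> \<phi> 0 = x0"
    "\<And>x0 \<phi>. x0 \<in> V \<Longrightarrow> solves (\<lambda>z. - f z) \<phi> {0..} \<Longrightarrow> \<phi> 0 = x0 \<Longrightarrow>
       ((\<lambda>t. infdist (\<phi> t) \<Gamma>) \<longlongrightarrow> 0) at_top"
    using assms unfolding stable_limit_cycle_def by blast
  have "\<exists>\<phi>. solves f \<phi> {..0} \<and> \<phi> 0 = x0" if "x0 \<in> V" for x0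
    using V(3)[OF that] solves_reverse_atMost[of f] by fastforce
  moreover have "((\<lambda>t. infdist (\<phi> t) \<Gamma>) \<longlongrightarrow> 0) at_bot"
    if "x0 \<in> V" "solves f \<phi> {..0}" "\<phi> 0 = x0" for x0 \<phi>
  proof -
    have "solves (\<lambda>z. - f z) (\<lambda>t. \<phi> (- t)) {0..}" using that solves_reverse_atMost[of f "\<lambda>t. \<phi> (- t)"] by simp
    from V(4)[OF that(1) this] that(3) show ?thesis by (simp add: filterlim_at_bot_mirror)
  qed
  ultimately show ?thesis unfolding unstable_limit_cycle_def using V(1,2) by blast
qed

text \<open>Restricting \<^term>\<open>f\<close> to a ball by nearest-point projection makes it globally Lipschitz
  and bounded, hence complete.\<close>
lemma solution_until_exit:
  fixes f :: "'a::euclidean_space \<Rightarrow> 'a"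
  assumes "lipschitz_on_balls f" "r > 0"
  obtains \<phi> where "\<phi> 0 = x0" "continuous_on UNIV \<phi>"
    "\<And>I. (\<And>t. t \<in> I \<Longrightarrow> \<phi> t \<in> cball p r) \<Longrightarrow> solves f \<phi> I"
proof -
  define c where "c = closest_point (cball p r)"
  obtain L where L: "L-lipschitz_on (cball p r) f"
    using lipschitz_on_balls_bounded[OF assms(1) bounded_cball] by blast
  have ne: "cball p r \<noteq> {}" using assms(2) by auto
  have c: "c x \<in> cball p r" for x unfolding c_def by (rule closest_point_in_set) (use ne in auto)
  have cc: "dist (c x) (c y) \<le> dist x y" for x y
    unfolding c_def by (rule closest_point_lipschitz) (use ne in auto)
  have ci: "c x = x" if "x \<in> cball p r" for x unfolding c_def using that by (rule closest_point_self)
  have L0: "L \<ge> 0" using L lipschitz_on_nonneg by blast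
  have lip: "norm (f (c x) - f (c y)) \<le> L * norm (x - y)" for x y
  proof -
    have "norm (f (c x) - f (c y)) \<le> L * dist (c x) (c y)"
      using lipschitz_onD[OF L c c] by (simp add: dist_norm)
    also have "\<dots> \<le> L * dist x y" using cc L0 by (intro mult_left_mono) auto
    finally show ?thesis by (simp add: dist_norm)
  qed
  have "bounded (f ` cball p r)"
    by (intro compact_imp_bounded compact_continuous_image lipschitz_on_balls_continuous assms(1)) simp
  then obtain M where M: "\<And>x. x \<in> cball p r \<Longrightarrow> norm (f x) \<le> M" unfolding bounded_iff by blast
  have "continuous_on UNIV c" unfolding c_def by (rule continuous_on_closest_point) (use ne in auto)
  then have "continuous_on UNIV (\<lambda>z::real\<times>'a. f (c (snd z)))"
    by (rule continuous_on_compose2[OF lipschitz_on_balls_continuous[OF assms(1), of UNIV]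
          continuous_on_compose2[OF _ continuous_on_snd[OF continuous_on_id]]]) auto
  then have "continuous_on UNIV (\<lambda>(t::real, x). f (c x))" by (simp add: case_prod_unfold)
  from picard_lindelof_global[OF this lip M[OF c]] obtain \<phi> where \<phi>: "\<phi> 0 = x0"
    "\<And>t. (\<phi> has_vector_derivative f (c (\<phi> t))) (at t)" by blast
  have "continuous_on UNIV \<phi>"
    using \<phi>(2) has_vector_derivative_continuous continuous_at_imp_continuous_on by blast
  moreover have "solves f \<phi> I" if "\<And>t. t \<in> I \<Longrightarrow> \<phi> t \<in> cball p r" for I
    unfolding solves_def
  proof
    fix t assume "t \<in> I"
    with ci[OF that] \<phi>(2)[of t] show "(\<phi> has_vector_derivative f (\<phi> t)) (at t within I)"
      by (simp add: has_vector_derivative_at_within)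
  qed
  ultimately show ?thesis using that \<phi>(1) by blast
qed

section \<open>Solutions in a ball and first exit times\<close>

text \<open>The earliest time in the closed set where d is at least r works: d is below r before it,
  and a value above r there would, by the intermediate value theorem, force an earlier hit.\<close>

lemma first_hit:
  fixes d :: "real \<Rightarrow> real"
  assumes "continuous_on {0..t} d" "d 0 < r" "r \<le> d t" "0 \<le> t"
  obtains s where "0 < s" "s \<le> t" "d s = r" "\<And>u. u \<in> {0..s} \<Longrightarrow> d u \<le> r"
proof -
  define A where "A = {u \<in> {0..t}. r \<le> d u}"
  have "closed A"
    using continuous_closed_preimage[OF assms(1) closed_atLeastAtMost closed_atLeast[of r]]
    unfolding A_def by (simp add: vimage_def Int_def)
  moreover have ne: "t \<in> A" using assms by (auto simp: A_def)
  moreover have bb: "bdd_below A" by (rule bdd_belowI[of _ 0]) (auto simp: A_def)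
  ultimately have s: "Inf A \<in> A" using closed_contains_Inf by blast
  define s where "s = Inf A"
  have s1: "0 \<le> s" "s \<le> t" "r \<le> d s" using s by (auto simp: s_def A_def)
  have lt: "d u < r" if "u \<in> {0..<s}" for u
    using cInf_lower[OF _ bb, of u] that s1 by (force simp: s_def A_def)
  have s0: "s > 0" using s1 assms(2) by (cases "s = 0") auto
  have "d s \<le> r"
  proof (rule ccontr)
    assume "\<not> d s \<le> r"
    then have "\<exists>x\<ge>0. x \<le> s \<and> d x = r"
      by (intro IVT') (use assms s1 in \<open>auto intro: continuous_on_subset\<close>)
    then obtain x where "0 \<le> x" "x \<le> s" "d x = r" by blast
    then show False using lt[of x] \<open>\<not> d s \<le> r\<close> by (cases "x = s") auto
  qed
  then show ?thesis using that[of s] s0 s1 lt by (metis atLeastAtMost_iff atLeastLessThan_iff less_eq_real_def order_antisym)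
qed

lemma first_exit:
  fixes \<phi> :: "real \<Rightarrow> 'a::metric_space"
  assumes "continuous_on {0..t} \<phi>" "dist (\<phi> 0) p < r" "r \<le> dist (\<phi> t) p" "0 \<le> t"
  obtains s where "0 < s" "s \<le> t" "dist (\<phi> s) p = r" "\<And>u. u \<in> {0..s} \<Longrightarrow> \<phi> u \<in> cball p r"
proof -
  have "continuous_on {0..t} (\<lambda>u. dist (\<phi> u) p)" by (intro continuous_intros assms)
  from first_hit[OF this assms(2-4)] obtain s where
    "0 < s" "s \<le> t" "dist (\<phi> s) p = r" "\<And>u. u \<in> {0..s} \<Longrightarrow> dist (\<phi> u) p \<le> r" by blast
  with that[of s] show ?thesis by (simp add: dist_commute)
qed

lemma within_derivative_nonpos_imp_le:
  fixes w :: "real \<Rightarrow> real"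
  assumes "a \<le> b" "\<And>t. t \<in> {a..b} \<Longrightarrow> (w has_real_derivative w' t) (at t within {a..b})"
    "\<And>t. t \<in> {a..b} \<Longrightarrow> w' t \<le> c"
  shows "w b \<le> w a + c * (b - a)"
proof -
  have "\<exists>t\<in>{a..b}. w b - w a = (\<lambda>x. w' t * x) (b - a)"
    by (intro mvt_very_simple assms) (use assms(2) in \<open>auto simp: has_field_derivative_def\<close>)
  then obtain t where "t \<in> {a..b}" "w b - w a = w' t * (b - a)" by blast
  moreover have "w' t * (b - a) \<le> c * (b - a)" using calculation assms by (intro mult_right_mono) auto
  ultimately show ?thesis by simp
qed

section \<open>Lyapunov functions\<close>

text \<open>The chain rule is assumed along curves and relative to an arbitrary set I, so that it
  also covers the one-sided derivatives at the ends of {0..T}. The sign of \<open>Wd\<close> is left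
  open: one set of assumptions serves stability and instability.\<close>

locale lyapunov_function =
  fixes f :: "'a::euclidean_space \<Rightarrow> 'a" and p :: 'a and W Wd :: "'a \<Rightarrow> real" and r :: real
  assumes equil: "f p = 0"
    and lip: "lipschitz_on_balls f"
    and r: "r > 0"
    and W_cont: "continuous_on UNIV W" and Wd_cont: "continuous_on UNIV Wd"
    and W_p: "W p = 0"
    and W_pos: "\<And>z. z \<in> cball p r \<Longrightarrow> z \<noteq> p \<Longrightarrow> W z > 0"
    and W_deriv: "\<And>\<phi> t I. (\<phi> has_vector_derivative f (\<phi> t)) (at t within I) \<Longrightarrow>
       ((\<lambda>t. W (\<phi> t)) has_real_derivative Wd (\<phi> t)) (at t within I)"
begin

lemma W_along:
  assumes "solves f \<phi> {a..b}" "a \<le> b" "\<And>t. t \<in> {a..b} \<Longrightarrow> Wd (\<phi> t) \<le> c"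
  shows "W (\<phi> b) \<le> W (\<phi> a) + c * (b - a)"
  by (rule within_derivative_nonpos_imp_le[OF assms(2), of "\<lambda>t. W (\<phi> t)" "\<lambda>t. Wd (\<phi> t)"])
    (use assms(1,3) W_deriv in \<open>auto simp: solves_def\<close>)

lemma W_along_ge:
  assumes "solves f \<phi> {a..b}" "a \<le> b" "\<And>t. t \<in> {a..b} \<Longrightarrow> Wd (\<phi> t) \<ge> c"
  shows "W (\<phi> b) \<ge> W (\<phi> a) + c * (b - a)"
proof -
  have "- W (\<phi> b) \<le> - W (\<phi> a) + (- c) * (b - a)"
    by (rule within_derivative_nonpos_imp_le[OF assms(2), of "\<lambda>t. - W (\<phi> t)" "\<lambda>t. - Wd (\<phi> t)"])
      (use assms W_deriv in \<open>auto simp: solves_def intro!: derivative_eq_intros\<close>)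
  then show ?thesis by simp
qed

text \<open>The minimum of W over a small sphere around p is positive. A solution starting where W
  is smaller cannot reach the sphere, because W does not increase along it.\<close>

lemma stable:
  assumes neg: "\<And>z. z \<in> cball p r \<Longrightarrow> z \<noteq> p \<Longrightarrow> Wd z < 0"
  shows "lyapunov_stable f p"
    and "\<And>z. z \<in> cball p r \<Longrightarrow> Wd z \<le> 0"
proof -
  \<comment> \<open>The constant curve at p is a solution, so the chain rule computes
    \<open>Wd p\<close> as the derivative of a constant.\<close>
  have Wdp: "Wd p = 0"
  proof -
    have "((\<lambda>t::real. p) has_vector_derivative f p) (at 0 within UNIV)" by (simp add: equil)
    from W_deriv[of "\<lambda>_. p" 0 UNIV, OF this] show ?thesis
      by (metis DERIV_const DERIV_unique)
  qed
  show le: "Wd z \<le> 0" if "z \<in> cball p r" for z using neg[OF that] Wdp by (cases "z = p") auto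
  show "lyapunov_stable f p"
    unfolding lyapunov_stable_def
  proof (intro conjI allI impI)
    show "equilibrium f p" using equil by (simp add: equilibrium_def)
    fix \<epsilon> :: real assume "\<epsilon> > 0"
    define e where "e = min \<epsilon> r"
    have e: "e > 0" "e \<le> r" "e \<le> \<epsilon>" using \<open>\<epsilon> > 0\<close> r by (auto simp: e_def)
    have ne: "sphere p e \<noteq> {}" using e(1) by simp
    obtain z0 where z0: "z0 \<in> sphere p e" "\<And>z. z \<in> sphere p e \<Longrightarrow> W z0 \<le> W z"
      using continuous_attains_inf[OF compact_sphere ne, of W] W_cont continuous_on_subset by blast
    have pos: "W z0 > 0" using z0(1) e by (intro W_pos) auto
    have "isCont W p" using W_cont by (simp add: continuous_on_eq_continuous_at)
    then obtain \<delta> where \<delta>: "\<delta> > 0" "\<And>z. dist z p < \<delta> \<Longrightarrow> \<bar>W z\<bar> < W z0"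
      using pos unfolding continuous_at_eps_delta W_p by (metis dist_real_def diff_zero)
    show "\<exists>\<delta>>0. \<forall>\<phi> T. 0 \<le> T \<longrightarrow> solves f \<phi> {0..T} \<longrightarrow> dist (\<phi> 0) p < \<delta> \<longrightarrow> (\<forall>t\<in>{0..T}. dist (\<phi> t) p < \<epsilon>)"
    proof (intro exI[of _ "min \<delta> e"] conjI allI impI ballI)
      show "min \<delta> e > 0" using \<delta> e by simp
      fix \<phi> T t assume T: "0 \<le> T" and s: "solves f \<phi> {0..T}" and d: "dist (\<phi> 0) p < min \<delta> e" and t: "t \<in> {0..T}"
      show "dist (\<phi> t) p < \<epsilon>"
      proof (rule ccontr)
        assume "\<not> dist (\<phi> t) p < \<epsilon>"
        then have "e \<le> dist (\<phi> t) p" using e by simp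
        moreover have st: "solves f \<phi> {0..t}" using s t by (auto elim: solves_subset)
        ultimately obtain u where u: "0 < u" "u \<le> t" "dist (\<phi> u) p = e" "\<And>v. v \<in> {0..u} \<Longrightarrow> \<phi> v \<in> cball p e"
          using first_exit[OF solves_continuous_on[OF st], of p e] d t by auto
        have "cball p e \<subseteq> cball p r" using e(2) by (rule subset_cball)
        then have "W (\<phi> u) \<le> W (\<phi> 0) + 0 * (u - 0)"
          using u(1,2) u(4) by (intro W_along solves_subset[OF st] le; (force | blast))
        also have "\<dots> < W z0" using \<delta>(2)[of "\<phi> 0"] d by auto
        also have "\<dots> \<le> W (\<phi> u)" using z0(2)[of "\<phi> u"] u(3) by (simp add: dist_commute)
        finally show False by simp
      qed
    qed
  qed
qed

text \<open>A solution that kept a distance \<delta> from p would stay in a compact shell, where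
  \<open>Wd\<close> is bounded above by a negative number, and W would become negative. So it comes
  \<delta>-close to p at some time, and stability of the solution restarted at that time keeps it
  close.\<close>

lemma asymptotically_stable:
  assumes neg: "\<And>z. z \<in> cball p r \<Longrightarrow> z \<noteq> p \<Longrightarrow> Wd z < 0"
  shows "asymptotically_stable f p"
proof -
  have st: "lyapunov_stable f p" by (rule stable(1)) (rule neg)
  obtain \<eta> where \<eta>: "\<eta> > 0" "\<And>\<phi> T t. 0 \<le> T \<Longrightarrow> solves f \<phi> {0..T} \<Longrightarrow> dist (\<phi> 0) p < \<eta> \<Longrightarrow>
      t \<in> {0..T} \<Longrightarrow> dist (\<phi> t) p < r"
    using st r unfolding lyapunov_stable_def by meson
  define \<eta>' where "\<eta>' = min \<eta> r"
  have \<eta>': "\<eta>' > 0" "\<eta>' \<le> \<eta>" "\<eta>' \<le> r" using \<eta> r by (auto simp: \<eta>'_def)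
  have ex: "\<exists>\<phi>. solves f \<phi> {0..} \<and> \<phi> 0 = x0" if x0: "dist x0 p < \<eta>'" for x0
  proof -
    obtain \<phi> where \<phi>: "\<phi> 0 = x0" "continuous_on UNIV \<phi>"
      "\<And>I. (\<And>t. t \<in> I \<Longrightarrow> \<phi> t \<in> cball p r) \<Longrightarrow> solves f \<phi> I"
      using solution_until_exit[OF lip r] by metis
    have "dist (\<phi> t) p < r" if t: "t \<ge> 0" for t
    proof (rule ccontr)
      assume "\<not> dist (\<phi> t) p < r"
      then obtain u where u: "0 < u" "dist (\<phi> u) p = r" "\<And>v. v \<in> {0..u} \<Longrightarrow> \<phi> v \<in> cball p r"
        using first_exit[OF continuous_on_subset[OF \<phi>(2) subset_UNIV], of p r t] t x0 \<phi>(1) \<eta>'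
        by auto
      have "solves f \<phi> {0..u}" using u(3) by (rule \<phi>(3))
      from \<eta>(2)[OF _ this, of u] u(1,2) x0 \<phi>(1) \<eta>' show False by auto
    qed
    then have "solves f \<phi> {0..}" by (intro \<phi>(3)) (auto simp: dist_commute less_imp_le)
    then show ?thesis using \<phi>(1) by blast
  qed
  have lim: "(\<phi> \<longlongrightarrow> p) at_top" if s: "solves f \<phi> {0..}" and x0: "dist (\<phi> 0) p < \<eta>'" for \<phi>
  proof (rule tendstoI)
    fix e :: real assume e: "e > 0"
    have inr: "dist (\<phi> t) p < r" if "t \<ge> 0" for t
      using \<eta>(2)[OF that, of \<phi> t] solves_subset[OF s, of "{0..t}"] x0 \<eta>' that by auto
    obtain \<delta> where \<delta>: "\<delta> > 0" "\<And>\<phi> T t. 0 \<le> T \<Longrightarrow> solves f \<phi> {0..T} \<Longrightarrow> dist (\<phi> 0) p < \<delta> \<Longrightarrow>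
      t \<in> {0..T} \<Longrightarrow> dist (\<phi> t) p < e"
      using st e unfolding lyapunov_stable_def by meson
    have "\<exists>t\<ge>0. dist (\<phi> t) p < \<delta>"
    proof (rule ccontr)
      assume "\<not> ?thesis"
      then have far: "dist (\<phi> t) p \<ge> \<delta>" if "t \<ge> 0" for t using that by force
      define K where "K = cball p r - ball p \<delta>"
      have K: "compact K" "\<phi> t \<in> K" if "t \<ge> 0" for t
        using far[OF that] inr[OF that] by (auto simp: K_def dist_commute intro!: compact_diff)
      have "K \<noteq> {}" using K(2)[of 0] by auto
      then obtain z0 where z0: "z0 \<in> K" "\<And>z. z \<in> K \<Longrightarrow> Wd z \<le> Wd z0"
        using continuous_attains_sup[of K Wd] K(1)[of 0] Wd_cont continuous_on_subset by blast
      have zn: "Wd z0 < 0" using z0(1) \<delta>(1) by (intro neg) (auto simp: K_def)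
      \<comment> \<open>At this time the linear upper bound for W equals -1, contradicting W >=
        0.\<close>
      define t where "t = (W (\<phi> 0) + 1) / (- Wd z0)"
      have W0: "W (\<phi> t) \<ge> 0" if "t \<ge> 0" for t
        using W_pos[of "\<phi> t"] W_p inr[OF that] by (cases "\<phi> t = p") (auto simp: dist_commute)
      have t: "t \<ge> 0" unfolding t_def using W0[of 0] zn by (intro divide_nonneg_pos) auto
      have "W (\<phi> t) \<le> W (\<phi> 0) + Wd z0 * (t - 0)"
        by (rule W_along[OF _ t]) (use s K(2) z0(2) in \<open>auto elim: solves_subset\<close>)
      also have "\<dots> = -1" using zn by (simp add: t_def field_simps)
      finally show False using W0[OF t] by simp
    qed
    then obtain t0 where t0: "t0 \<ge> 0" "dist (\<phi> t0) p < \<delta>" by blast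
    have shift: "solves f (\<lambda>t. \<phi> (t0 + t)) {0..T}" for T
      unfolding solves_def
    proof
      fix t assume t: "t \<in> {0..T}"
      have "(\<phi> has_vector_derivative f (\<phi> (t0 + t))) (at (t0 + t) within (+) t0 ` {0..T})"
        using s t t0 has_vector_derivative_within_subset[of \<phi> _ "t0 + t" "{0..}" "(+) t0 ` {0..T}"]
        unfolding solves_def by force
      moreover have "((+) t0 has_vector_derivative 1) (at t within {0..T})"
        by (auto intro!: derivative_eq_intros)
      ultimately show "((\<lambda>t. \<phi> (t0 + t)) has_vector_derivative f (\<phi> (t0 + t))) (at t within {0..T})"
        using vector_diff_chain_within[of "(+) t0" 1 t "{0..T}" \<phi> "f (\<phi> (t0 + t))"] by (simp add: o_def)
    qed
    have "dist (\<phi> t) p < e" if "t \<ge> t0" for t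
      using \<delta>(2)[OF _ shift[of "t - t0"], of "t - t0"] t0 that by auto
    then show "\<forall>\<^sub>F t in at_top. dist (\<phi> t) p < e"
      unfolding eventually_at_top_linorder by blast
  qed
  show ?thesis unfolding asymptotically_stable_def using st \<eta>'(1) ex lim by blast
qed

text \<open>If p were stable, a solution starting near p but not at p would stay in the ball. It
  would then remain in a compact set on which W is at least its initial positive value and
  \<open>Wd\<close> is bounded below by a positive number, so W would outgrow its maximum on that
  set.\<close>

lemma unstable:
  assumes pos: "\<And>z. z \<in> cball p r \<Longrightarrow> z \<noteq> p \<Longrightarrow> Wd z > 0"
  shows "unstable f p"
  unfolding unstable_def
proof
  show "equilibrium f p" using equil by (simp add: equilibrium_def)
  show "\<not> lyapunov_stable f p"
  proof
    assume "lyapunov_stable f p"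
    then obtain \<delta> where \<delta>: "\<delta> > 0" "\<And>\<phi> T t. 0 \<le> T \<Longrightarrow> solves f \<phi> {0..T} \<Longrightarrow> dist (\<phi> 0) p < \<delta> \<Longrightarrow>
      t \<in> {0..T} \<Longrightarrow> dist (\<phi> t) p < r"
      using r unfolding lyapunov_stable_def by meson
    have dr: "min \<delta> r / 2 > 0" using \<delta> r by auto
    then obtain x0 where x0: "dist p x0 = min \<delta> r / 2"
      using vector_choose_dist[of "min \<delta> r / 2" p] by force
    have x0': "x0 \<noteq> p" "dist x0 p < \<delta>" "dist x0 p < r" using x0 dr \<delta> r by (auto simp: dist_commute)
    obtain \<phi> where \<phi>: "\<phi> 0 = x0" "continuous_on UNIV \<phi>"
      "\<And>I. (\<And>t. t \<in> I \<Longrightarrow> \<phi> t \<in> cball p r) \<Longrightarrow> solves f \<phi> I"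
      using solution_until_exit[OF lip r] by metis
    have inr: "dist (\<phi> t) p < r" if t: "t \<ge> 0" for t
    proof (rule ccontr)
      assume "\<not> dist (\<phi> t) p < r"
      then obtain u where u: "0 < u" "dist (\<phi> u) p = r" "\<And>v. v \<in> {0..u} \<Longrightarrow> \<phi> v \<in> cball p r"
        using first_exit[OF continuous_on_subset[OF \<phi>(2) subset_UNIV], of p r t] t x0' \<phi>(1)
        by auto
      have "solves f \<phi> {0..u}" using u(3) by (rule \<phi>(3))
      from \<delta>(2)[OF _ this, of u] u(1,2) x0' \<phi>(1) show False by auto
    qed
    have sol: "solves f \<phi> {0..t}" for t
      by (rule \<phi>(3)) (use inr in \<open>force simp: dist_commute less_imp_le\<close>)
    have Wd0: "Wd z \<ge> 0" if "z \<in> cball p r" for z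
    proof (cases "z = p")
      case True
      have "((\<lambda>t::real. p) has_vector_derivative f p) (at 0 within UNIV)" by (simp add: equil)
      from W_deriv[of "\<lambda>_. p" 0 UNIV, OF this] have "Wd p = 0"
        by (metis DERIV_const DERIV_unique)
      then show ?thesis using True by simp
    next
      case False
      then show ?thesis using pos[OF that] by simp
    qed
    define K where "K = cball p r \<inter> {z. W (\<phi> 0) \<le> W z}"
    have W0: "W (\<phi> 0) > 0" using x0' \<phi>(1) by (intro W_pos) (auto simp: dist_commute)
    have "closed {z. W (\<phi> 0) \<le> W z}" by (intro closed_Collect_le W_cont continuous_intros)
    then have K: "compact K" unfolding K_def by (intro compact_Int_closed) auto
    have inK: "\<phi> t \<in> K" if "t \<ge> 0" for t
    proof -
      have "W (\<phi> t) \<ge> W (\<phi> 0) + 0 * (t - 0)"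
        by (rule W_along_ge[OF sol that]) (use inr in \<open>auto intro!: Wd0 simp: dist_commute less_imp_le\<close>)
      then show ?thesis using inr[OF that] by (auto simp: K_def dist_commute)
    qed
    have ne: "K \<noteq> {}" using inK[of 0] by auto
    obtain z0 where z0: "z0 \<in> K" "\<And>z. z \<in> K \<Longrightarrow> Wd z0 \<le> Wd z"
      using continuous_attains_inf[OF K ne] Wd_cont continuous_on_subset by (metis subset_UNIV)
    obtain z1 where z1: "z1 \<in> K" "\<And>z. z \<in> K \<Longrightarrow> W z \<le> W z1"
      using continuous_attains_sup[OF K ne] W_cont continuous_on_subset by (metis subset_UNIV)
    have zp: "Wd z0 > 0" using z0(1) W0 W_p by (intro pos) (auto simp: K_def)
    \<comment> \<open>At this time the linear lower bound for W exceeds the maximum of W on K by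
      1.\<close>
    define t where "t = (W z1 - W (\<phi> 0) + 1) / Wd z0"
    have t: "t \<ge> 0" unfolding t_def using z1(2)[OF inK[of 0]] zp by (intro divide_nonneg_pos) auto
    have "W (\<phi> t) \<ge> W (\<phi> 0) + Wd z0 * (t - 0)"
      by (rule W_along_ge[OF sol t]) (use z0 inK in auto)
    also have "W (\<phi> 0) + Wd z0 * (t - 0) = W z1 + 1" using zp by (simp add: t_def field_simps)
    finally show False using z1(2)[OF inK[OF t]] by simp
  qed
qed

end

section \<open>Closed orbits\<close>

text \<open>At the last time with w <= 0 the value is 0, and a negative derivative there pushes w
  below 0 right afterwards. Derivatives are required at zeros of w only: in
  \<open>sol_trapped\<close> the function w involves a clamped radius, whose differentiability is
  known only inside the annulus.\<close>

lemma barrier: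
  fixes w :: "real \<Rightarrow> real"
  assumes cont: "continuous_on UNIV w" and "w a \<le> 0" "a \<le> b"
    and zero: "\<And>t. a \<le> t \<Longrightarrow> w t = 0 \<Longrightarrow> \<exists>d<0. (w has_real_derivative d) (at t)"
  shows "w b \<le> 0"
proof (rule ccontr)
  assume b: "\<not> w b \<le> 0"
  define A where "A = {t \<in> {a..b}. w t \<le> 0}"
  have "closed ({a..b} \<inter> {t. w t \<le> 0})"
    by (intro closed_Int closed_Collect_le cont continuous_intros closed_atLeastAtMost)
  then have "closed A" by (simp add: A_def Int_def)
  moreover have "a \<in> A" using assms by (simp add: A_def)
  moreover have bdd: "bdd_above A" by (rule bdd_aboveI[of _ b]) (auto simp: A_def)
  ultimately have "Sup A \<in> A" using closed_contains_Sup by blast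
  then obtain s where s: "s = Sup A" "a \<le> s" "s \<le> b" "w s \<le> 0" by (auto simp: A_def)
  have "s < b" using s b by (cases "s = b") auto
  have gt: "w t > 0" if "s < t" "t \<le> b" for t
    using cSup_upper[OF _ bdd, of t] that s by (force simp: A_def)
  have "w s = 0"
  proof (rule ccontr)
    assume "w s \<noteq> 0"
    have "\<exists>x\<ge>s. x \<le> b \<and> w x = 0"
      by (rule IVT') (use s b cont in \<open>auto intro: continuous_on_subset\<close>)
    then obtain x where "s \<le> x" "x \<le> b" "w x = 0" by blast
    then show False using gt[of x] \<open>w s \<noteq> 0\<close> by (cases "x = s") auto
  qed
  from zero[OF s(2) this] obtain d where d: "d < 0" "(w has_real_derivative d) (at s)" by blast
  obtain e where e: "e > 0" "\<And>h. 0 < h \<Longrightarrow> h < e \<Longrightarrow> w (s + h) < w s"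
    using DERIV_neg_dec_right[OF d(2,1)] by blast
  define h where "h = min (e / 2) (b - s)"
  have "0 < h" "h < e" "s + h \<le> b" using e(1) \<open>s < b\<close> by (auto simp: h_def)
  then show False using e(2)[of h] gt[of "s + h"] \<open>w s = 0\<close> by auto
qed

text \<open>Separation of variables: h is the inverse of an antiderivative G of 1 / l. The bounds on
  l make G a bijection of the line and give the linear growth of h. If l has period p, then G (x +
  p) - G x is a constant T, the time of one turn.\<close>

lemma time_change:
  fixes l :: "real \<Rightarrow> real"
  assumes cont: "continuous_on UNIV l" and lm: "lm > 0" "\<And>x. lm \<le> l x" and lM: "\<And>x. l x \<le> lM"
  obtains h where "h 0 = x0" "\<And>t. (h has_real_derivative l (h t)) (at t)" "surj h"
    "\<And>t. t \<ge> 0 \<Longrightarrow> h t \<ge> x0 + lm * t"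
    "\<And>p. p > 0 \<Longrightarrow> (\<And>x. l (x + p) = l x) \<Longrightarrow> \<exists>T>0. \<forall>t. h (t + T) = h t + p"
proof -
  have lp: "l x > 0" for x using lm(1) lm(2)[of x] by linarith
  then have lMp: "lM > 0" using lM[of 0] lp[of 0] by linarith
  define k where "k = (\<lambda>x. 1 / l x)"
  have "continuous_on UNIV k" unfolding k_def
    by (intro continuous_intros cont) (use lp in \<open>auto simp: less_imp_neq[symmetric]\<close>)
  define G where "G = (\<lambda>x. antideriv0 k x - antideriv0 k x0)"
  have dG: "(G has_real_derivative k x) (at x)" for x
    unfolding G_def using antideriv0_deriv[OF \<open>continuous_on UNIV k\<close>]
    by (auto intro!: derivative_eq_intros simp: has_real_derivative_iff_has_vector_derivative)
  have kp: "k x \<ge> 1 / lM" "k x > 0" "k x \<le> 1 / lm" for x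
    using lM[of x] lp[of x] lm lMp unfolding k_def by (auto intro!: divide_left_mono)
  have mono: "G x < G y" if "x < y" for x y
    by (rule DERIV_pos_imp_increasing[OF that]) (use dG kp in blast)
  have grow: "G y - G x \<ge> (y - x) / lM" if "x \<le> y" for x y
  proof -
    have "(\<lambda>x. G x - x / lM) x \<le> (\<lambda>x. G x - x / lM) y"
    proof (rule DERIV_nonneg_imp_nondecreasing[OF that])
      fix u show "\<exists>d. ((\<lambda>x. G x - x / lM) has_real_derivative d) (at u) \<and> 0 \<le> d"
        using lMp kp(1)[of u] by (intro exI[of _ "k u - 1 / lM"]) (auto intro!: derivative_eq_intros dG)
    qed
    then show ?thesis by (simp add: diff_divide_distrib)
  qed
  have growu: "G y - G x \<le> (y - x) / lm" if "x \<le> y" for x y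
  proof -
    have "(\<lambda>x. x / lm - G x) x \<le> (\<lambda>x. x / lm - G x) y"
    proof (rule DERIV_nonneg_imp_nondecreasing[OF that])
      fix u show "\<exists>d. ((\<lambda>x. x / lm - G x) has_real_derivative d) (at u) \<and> 0 \<le> d"
        using lm kp(3)[of u] by (intro exI[of _ "1 / lm - k u"]) (auto intro!: derivative_eq_intros dG)
    qed
    then show ?thesis by (simp add: diff_divide_distrib)
  qed
  have contG: "continuous_on S G" for S
    using dG DERIV_isCont continuous_at_imp_continuous_on by blast
  have inj: "inj G" using mono by (metis injI linorder_neqE_linordered_idom less_irrefl)
  have surjG: "\<exists>x. G x = t" for t
  proof -
    define b where "b = \<bar>t\<bar> * lM"
    have b0: "b \<ge> 0" using lMp by (simp add: b_def)
    have G0: "G x0 = 0" by (simp add: G_def)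
    have "G (x0 + b) \<ge> t" "G (x0 - b) \<le> t"
      using grow[of x0 "x0 + b"] grow[of "x0 - b" x0] b0 lMp G0 by (auto simp: b_def)
    then have "\<exists>x. x0 - b \<le> x \<and> x \<le> x0 + b \<and> G x = t"
      using b0 by (intro IVT' contG) auto
    then show ?thesis by blast
  qed
  define h where "h = inv G"
  have Gh: "G (h t) = t" for t unfolding h_def using surjG by (metis f_inv_into_f rangeI)
  have hG: "h (G x) = x" for x unfolding h_def using inj by simp
  have ch: "isCont h t" for t
  proof -
    have "isCont h (G (h t))"
      by (rule isCont_inverse_function[where d=1 and f=G and x="h t"]) (use hG DERIV_isCont[OF dG] in auto)
    then show ?thesis by (simp add: Gh)
  qed
  have dh: "(h has_real_derivative l (h t)) (at t)" for t
  proof -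
    have "(h has_real_derivative inverse (k (h t))) (at t)"
      by (rule DERIV_inverse_function[where f=G and a="t - 1" and b="t + 1"]) (use dG kp(2)[of "h t"] Gh ch in auto)
    then show ?thesis using lp by (simp add: k_def)
  qed
  have h0: "h 0 = x0" using hG[of x0] by (simp add: G_def)
  show ?thesis
  proof (rule that[OF h0 dh])
    show "surj h" using hG by (metis surjI)
    show "h t \<ge> x0 + lm * t" if "t \<ge> 0" for t
    proof -
      have "h t \<ge> x0"
      proof (rule ccontr)
        assume "\<not> ?thesis"
        then have "G (h t) < G x0" by (intro mono) simp
        then show False using that by (simp add: Gh) (simp add: G_def)
      qed
      from growu[OF this] have "t \<le> (h t - x0) / lm" by (simp add: Gh) (simp add: G_def)
      then show ?thesis using lm by (simp add: field_simps)
    qed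
    show "\<exists>T>0. \<forall>t. h (t + T) = h t + p" if "p > 0" and per: "\<And>x. l (x + p) = l x" for p
    proof -
      define T where "T = G (x0 + p) - G x0"
      have "T > 0" using mono[of x0 "x0 + p"] that(1) by (simp add: T_def)
      have "((\<lambda>x. G (x + p) - G x) has_real_derivative 0) (at x)" for x
      proof -
        have "((\<lambda>x. G (x + p)) has_real_derivative k (x + p)) (at x)"
          using dG[of "x + p"] by (simp add: DERIV_shift)
        then have "((\<lambda>x. G (x + p) - G x) has_real_derivative k (x + p) - k x) (at x)"
          by (intro derivative_intros dG)
        then show ?thesis by (simp add: k_def per)
      qed
      then have "G (x + p) - G x = T" for x
        using DERIV_isconst_all[of "\<lambda>x. G (x + p) - G x" x x0] by (simp add: T_def)
      then have "G (h t + p) = t + T" for t by (metis Gh add.commute diff_add_cancel)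
      then have "h (t + T) = h t + p" for t using hG[of "h t + p"] by simp
      then show ?thesis using \<open>T > 0\<close> by blast
    qed
  qed
qed

lemma solves_shift:
  assumes "solves f \<phi> UNIV"
  shows "solves f (\<lambda>t. \<phi> (t + s)) UNIV"
  unfolding solves_def
proof
  fix t
  have "(\<phi> has_vector_derivative f (\<phi> (t + s))) (at (t + s))" using assms by (simp add: solves_def)
  moreover have "((\<lambda>t. t + s) has_vector_derivative 1) (at t)" by (auto intro!: derivative_eq_intros)
  ultimately show "((\<lambda>t. \<phi> (t + s)) has_vector_derivative f (\<phi> (t + s))) (at t)"
    using vector_diff_chain_at[of "\<lambda>t. t + s" 1 t \<phi> "f (\<phi> (t + s))"] by (simp add: o_def)
qed

lemma periodic_nat:
  fixes \<phi> :: "real \<Rightarrow> 'a"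
  assumes "\<And>t. \<phi> (t + T) = \<phi> t"
  shows "\<phi> (t + real n * T) = \<phi> t"
proof (induction n)
  case (Suc n)
  have "\<phi> (t + real (Suc n) * T) = \<phi> ((t + real n * T) + T)" by (simp add: algebra_simps)
  then show ?case using assms Suc by simp
qed simp

lemma periodic_range:
  fixes \<phi> :: "real \<Rightarrow> 'a"
  assumes "T > 0" "\<And>t. \<phi> (t + T) = \<phi> t"
  shows "range \<phi> = \<phi> ` {0..}"
proof -
  have "\<phi> t \<in> \<phi> ` {0..}" for t
  proof -
    obtain n :: nat where "- t / T \<le> real n" using real_arch_simple by blast
    then have "t + real n * T \<ge> 0" using assms(1) by (simp add: field_simps)
    then show ?thesis using periodic_nat[of \<phi> T t n] assms(2) by (metis atLeast_iff imageI)
  qed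
  then show ?thesis by blast
qed

lemma closed_orbit_through:
  assumes "closed_orbit f \<Gamma>" "x \<in> \<Gamma>"
  obtains \<phi> T where "T > 0" "solves f \<phi> UNIV" "\<And>t. \<phi> (t + T) = \<phi> t" "\<phi> 0 = x" "\<Gamma> = range \<phi>"
proof -
  obtain \<phi> T where \<phi>: "T > 0" "solves f \<phi> UNIV" "\<And>t. \<phi> (t + T) = \<phi> t" "\<Gamma> = range \<phi>"
    using assms(1) unfolding closed_orbit_def by blast
  obtain s where s: "x = \<phi> s" using assms(2) \<phi>(4) by blast
  have "range (\<lambda>t. \<phi> (t + s)) = range \<phi>"
    by (auto simp: image_iff) (metis diff_add_cancel)
  moreover have "\<phi> (t + T + s) = \<phi> (t + s)" for t using \<phi>(3)[of "t + s"] by (simp add: add_ac)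
  ultimately show ?thesis using that[of T "\<lambda>t. \<phi> (t + s)"] solves_shift[OF \<phi>(2)] \<phi> s by simp
qed

text \<open>Uniqueness is applied forward in time only; by periodicity the forward half already is
  the whole orbit.\<close>

lemma closed_orbits_meet_eq:
  assumes lip: "lipschitz_on_balls f" and "closed_orbit f \<Gamma>1" "closed_orbit f \<Gamma>2" "x \<in> \<Gamma>1" "x \<in> \<Gamma>2"
  shows "\<Gamma>1 = \<Gamma>2"
proof -
  obtain \<phi> T where \<phi>: "T > 0" "solves f \<phi> UNIV" "\<And>t. \<phi> (t + T) = \<phi> t" "\<phi> 0 = x" "\<Gamma>1 = range \<phi>"
    using closed_orbit_through[OF assms(2,4)] by metis
  obtain \<psi> T' where \<psi>: "T' > 0" "solves f \<psi> UNIV" "\<And>t. \<psi> (t + T') = \<psi> t" "\<psi> 0 = x" "\<Gamma>2 = range \<psi>"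
    using closed_orbit_through[OF assms(3,5)] by metis
  have "\<phi> t = \<psi> t" if "t \<ge> 0" for t
    by (rule solves_unique_forward[OF lip _ _ _ that])
      (use \<phi>(2,4) \<psi>(2,4) solves_subset[OF _ subset_UNIV] in auto)
  then have "\<phi> ` {0..} = \<psi> ` {0..}" by (intro image_cong) auto
  then show ?thesis using \<phi>(1,3,5) \<psi>(1,3,5) periodic_range by metis
qed

text \<open>Attraction implies isolation: a closed orbit meeting V returns to the same point x after
  every period, while its distance to \<Gamma> tends to 0, so x lies on \<Gamma>. Convergence of one
  solution from each point carries over to all of them by uniqueness.\<close>

lemma stable_limit_cycleI:
  assumes lip: "lipschitz_on_balls f" and \<Gamma>: "closed_orbit f \<Gamma>" "closed \<Gamma>"
    and V: "open V" "\<Gamma> \<subseteq> V"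
    and ex: "\<And>x0. x0 \<in> V \<Longrightarrow> \<exists>\<phi>. solves f \<phi> {0..} \<and> \<phi> 0 = x0 \<and> ((\<lambda>t. infdist (\<phi> t) \<Gamma>) \<longlongrightarrow> 0) at_top"
  shows "stable_limit_cycle f \<Gamma>"
proof -
  have lim: "((\<lambda>t. infdist (\<psi> t) \<Gamma>) \<longlongrightarrow> 0) at_top"
    if "x0 \<in> V" "solves f \<psi> {0..}" "\<psi> 0 = x0" for x0 \<psi>
  proof -
    obtain \<phi> where \<phi>: "solves f \<phi> {0..}" "\<phi> 0 = x0" "((\<lambda>t. infdist (\<phi> t) \<Gamma>) \<longlongrightarrow> 0) at_top"
      using ex[OF \<open>x0 \<in> V\<close>] by blast
    have "\<forall>\<^sub>F t in at_top. infdist (\<phi> t) \<Gamma> = infdist (\<psi> t) \<Gamma>"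
      using solves_unique_forward[OF lip \<phi>(1) that(2)] \<phi>(2) that(3)
      by (intro eventually_at_top_linorderI[of 0]) auto
    from Lim_transform_eventually[OF \<phi>(3) this] show ?thesis .
  qed
  have "\<Gamma>' = \<Gamma>" if \<Gamma>': "closed_orbit f \<Gamma>'" "\<Gamma>' \<inter> V \<noteq> {}" for \<Gamma>'
  proof -
    obtain x where x: "x \<in> \<Gamma>'" "x \<in> V" using \<Gamma>'(2) by blast
    obtain \<phi> T where \<phi>: "T > 0" "solves f \<phi> UNIV" "\<And>t. \<phi> (t + T) = \<phi> t" "\<phi> 0 = x" "\<Gamma>' = range \<phi>"
      using closed_orbit_through[OF \<Gamma>'(1) x(1)] by metis
    have l: "((\<lambda>t. infdist (\<phi> t) \<Gamma>) \<longlongrightarrow> 0) at_top"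
      by (rule lim[OF x(2)]) (use \<phi>(2,4) solves_subset[OF _ subset_UNIV] in auto)
    have "filterlim (\<lambda>n. real n * T) at_top sequentially"
      by (rule filterlim_at_top_mult_tendsto_pos[OF tendsto_const \<phi>(1) filterlim_real_sequentially])
    from filterlim_compose[OF l this] have "(\<lambda>n. infdist (\<phi> (real n * T)) \<Gamma>) \<longlonglongrightarrow> 0" .
    moreover have "\<phi> (real n * T) = x" for n using periodic_nat[of \<phi> T 0 n] \<phi>(3,4) by simp
    ultimately have "infdist x \<Gamma> = 0" by (simp add: LIMSEQ_const_iff)
    moreover have "\<Gamma> \<noteq> {}" using \<Gamma>(1) unfolding closed_orbit_def by auto
    ultimately have "x \<in> \<Gamma>" using \<Gamma>(2) in_closed_iff_infdist_zero by blast
    then show ?thesis using closed_orbits_meet_eq[OF lip \<Gamma>'(1) \<Gamma>(1) x(1)] by simp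
  qed
  then have "limit_cycle f \<Gamma>" unfolding limit_cycle_def using \<Gamma>(1) V by blast
  then show ?thesis unfolding stable_limit_cycle_def using V ex lim by blast
qed

lemma polar_exists:
  fixes z :: "real \<times> real"
  obtains \<theta> where "z = (norm z * cos \<theta>, norm z * sin \<theta>)" "0 \<le> \<theta>" "\<theta> \<le> 2 * pi"
proof (cases "z = 0")
  case True
  then show ?thesis using that[of 0] by (simp add: zero_prod_def)
next
  case False
  obtain x y where z: "z = (x, y)" by force
  have n: "norm z > 0" "norm z ^ 2 = x\<^sup>2 + y\<^sup>2" using False by (auto simp: z norm_Pair zero_prod_def sum_power2_gt_zero_iff)
  have "(x / norm z)\<^sup>2 + (y / norm z)\<^sup>2 = (norm z)\<^sup>2 / (norm z)\<^sup>2"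
    unfolding n(2) power_divide add_divide_distrib ..
  also have "\<dots> = 1" using n(1) by simp
  finally obtain \<theta> where "0 \<le> \<theta>" "\<theta> < 2 * pi" "x / norm z = cos \<theta>" "y / norm z = sin \<theta>"
    using sincos_total_2pi by metis
  then show ?thesis using that[of \<theta>] n by (simp add: z field_simps)
qed

lemma norm_polar: "norm (r * cos \<theta>, r * sin \<theta>) = \<bar>r\<bar>"
proof -
  have "(r * cos \<theta>)\<^sup>2 + (r * sin \<theta>)\<^sup>2 = r\<^sup>2" by (simp add: power_mult_distrib flip: distrib_left)
  then show ?thesis by (simp add: norm_Pair)
qed

text \<open>The maps q(t, _) scale the curve about its centre. The filled curve A (t <= 1) and a
  large outer part B (1 <= t <= M) are compact and meet only in \<Gamma>. A path from the centre
  that avoids \<Gamma> is connected and hence stays in A, so the component of the centre is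
  bounded.\<close>

lemma starlike_curve_inside:
  fixes \<rho> :: "real \<Rightarrow> real" and C :: "real \<times> real \<Rightarrow> 'a::euclidean_space"
  assumes \<rho>: "continuous_on UNIV \<rho>" "\<And>\<theta>. \<rho> \<theta> > 0" "\<And>\<theta>. \<rho> (\<theta> + 2 * pi) = \<rho> \<theta>"
    and C: "continuous_on UNIV C" and Ci: "continuous_on UNIV Ci" "\<And>z. Ci (C z) = z" "\<And>z. C (Ci z) = z"
  defines "\<Gamma> \<equiv> range (\<lambda>\<theta>. C (\<rho> \<theta> * cos \<theta>, \<rho> \<theta> * sin \<theta>))"
  shows "C 0 \<in> inside \<Gamma>" and "compact \<Gamma>"
proof -
  define q where "q = (\<lambda>(t, \<theta>). C (t * \<rho> \<theta> * cos \<theta>, t * \<rho> \<theta> * sin \<theta>))"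
  have q: "continuous_on S q" for S
    unfolding q_def case_prod_unfold
    by (intro continuous_on_compose2[OF C] continuous_on_compose2[OF \<rho>(1)] continuous_intros) auto
  have \<Gamma>q: "\<Gamma> = q ` ({1} \<times> {0..2 * pi})"
  proof -
    have "C (\<rho> \<theta> * cos \<theta>, \<rho> \<theta> * sin \<theta>) \<in> q ` ({1} \<times> {0..2 * pi})" for \<theta>
    proof -
      define \<theta>' where "\<theta>' = \<theta> - 2 * pi * of_int \<lfloor>\<theta> / (2 * pi)\<rfloor>"
      have per: "\<rho> (x + 2 * pi * of_int k) = \<rho> x" for x and k :: int
      proof -
        have n: "\<rho> (x + real n * (2 * pi)) = \<rho> x" for x n by (rule periodic_nat) (rule \<rho>(3))
        show ?thesis
        proof (cases "k \<ge> 0")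
          case True then show ?thesis using n[of x "nat k"] by (simp add: mult_ac)
        next
          case False then show ?thesis using n[of "x + 2 * pi * of_int k" "nat (- k)"] by (simp add: algebra_simps)
        qed
      qed
      have "\<rho> \<theta>' = \<rho> \<theta>" using per[of \<theta>' "\<lfloor>\<theta> / (2 * pi)\<rfloor>"] by (simp add: \<theta>'_def)
      moreover have "cos \<theta>' = cos \<theta>" "sin \<theta>' = sin \<theta>"
        unfolding \<theta>'_def by (simp_all add: cos_diff sin_diff)
      moreover have "\<theta>' \<in> {0..2 * pi}"
      proof -
        show ?thesis using floor_divide_lower[of "2 * pi" \<theta>] floor_divide_upper[of "2 * pi" \<theta>]
          by (simp add: \<theta>'_def algebra_simps)
      qed
      ultimately show ?thesis by (intro image_eqI[of _ _ "(1, \<theta>')"]) (auto simp: q_def)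
    qed
    then show ?thesis unfolding \<Gamma>_def by (auto simp: q_def)
  qed
  show cpt: "compact \<Gamma>" unfolding \<Gamma>q
    by (intro compact_continuous_image q compact_Times) auto
  have inj: "C z = C z' \<longleftrightarrow> z = z'" for z z' using Ci(2) by metis
  have Cc: "C (r * cos \<theta>, r * sin \<theta>) = q (r / \<rho> \<theta>, \<theta>)" for r \<theta>
    using \<rho>(2)[of \<theta>] by (simp add: q_def)
  define A where "A = q ` ({0..1} \<times> {0..2 * pi})"
  have A: "compact A" unfolding A_def by (intro compact_continuous_image q compact_Times) auto
  have C0: "C 0 = q (0, 0)" by (simp add: q_def zero_prod_def)
  then have 0: "C 0 \<in> A" unfolding A_def by force
  \<comment> \<open>The scaling factor is determined by the point, although the angle is not: it is
    arbitrary at the centre and ambiguous between 0 and 2 pi.\<close>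
  have radial: "t = t'" if "q (t, \<theta>) = q (t', \<theta>')" "t \<ge> 0" "t' \<ge> 0" "\<theta> \<in> {0..2*pi}" "\<theta>' \<in> {0..2*pi}" for t t' \<theta> \<theta>'
  proof -
    have e: "(t * \<rho> \<theta> * cos \<theta>, t * \<rho> \<theta> * sin \<theta>) = (t' * \<rho> \<theta>' * cos \<theta>', t' * \<rho> \<theta>' * sin \<theta>')"
      using that(1) inj by (simp add: q_def)
    then have "\<bar>t * \<rho> \<theta>\<bar> = \<bar>t' * \<rho> \<theta>'\<bar>" using norm_polar by metis
    then have n: "t * \<rho> \<theta> = t' * \<rho> \<theta>'" using that(2,3) \<rho>(2)[of \<theta>] \<rho>(2)[of \<theta>'] by (simp add: abs_mult)
    show ?thesis
    proof (cases "t * \<rho> \<theta> = 0")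
      case True
      then show ?thesis using n \<rho>(2)[of \<theta>] \<rho>(2)[of \<theta>'] by auto
    next
      case False
      with e n have cs: "cos \<theta> = cos \<theta>'" "sin \<theta> = sin \<theta>'" by auto
      then obtain k :: int where k: "\<theta> = \<theta>' + 2 * pi * of_int k"
        by (metis sin_cos_eq_iff)
      have "k \<in> {-1, 0, 1}"
      proof -
        have "2 * pi * of_int k \<le> 2 * pi * 1" "2 * pi * (- 1) \<le> 2 * pi * of_int k"
          using that(4,5) k unfolding atLeastAtMost_iff by linarith+
        then have "of_int k \<le> (1 :: real)" "- 1 \<le> real_of_int k"
          by (simp_all only: mult_le_cancel_left_pos pi_gt_zero zero_less_mult_iff zero_less_numeral simp_thms)
        then show ?thesis by auto
      qed
      then have "\<rho> \<theta> = \<rho> \<theta>'" using k \<rho>(3)[of \<theta>] \<rho>(3)[of \<theta>'] by auto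
      then show ?thesis using n \<rho>(2)[of \<theta>] by simp
    qed
  qed
  have notin: "C 0 \<notin> \<Gamma>"
    unfolding C0 \<Gamma>q using radial[of 0 0 1] by force
  have "y \<in> A" if y: "connected_component (- \<Gamma>) (C 0) y" for y
  proof (rule ccontr)
    assume "y \<notin> A"
    \<comment> \<open>A path replaces the component because its image is compact, which bounds the
      scaling factors by a finite M.\<close>
    have "path_component (- \<Gamma>) (C 0) y"
      using y open_path_connected_component[of "- \<Gamma>" "C 0"] compact_imp_closed[OF cpt] by (simp add: open_Compl)
    then obtain g where g: "path g" "path_image g \<subseteq> - \<Gamma>" "pathstart g = C 0" "pathfinish g = y"
      unfolding path_component_def by blast
    define g' where "g' = path_image g"
    have g': "compact g'" "connected g'" "g' \<subseteq> - \<Gamma>" "C 0 \<in> g'" "y \<in> g'"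
      using g pathstart_in_path_image[of g] pathfinish_in_path_image[of g]
      by (simp_all add: g'_def compact_path_image connected_path_image)
    have "compact (Ci ` g')"
      by (rule compact_continuous_image[OF continuous_on_subset[OF Ci(1) subset_UNIV] g'(1)])
    from compact_imp_bounded[OF this] obtain N where N: "\<And>z. z \<in> g' \<Longrightarrow> norm (Ci z) \<le> N"
      unfolding bounded_iff by auto
    have "{0..2 * pi} \<noteq> {}" using pi_gt_zero by simp
    from continuous_attains_inf[OF compact_Icc this continuous_on_subset[OF \<rho>(1) subset_UNIV]]
    obtain \<theta>m where \<theta>m: "\<And>\<theta>. \<theta> \<in> {0..2*pi} \<Longrightarrow> \<rho> \<theta>m \<le> \<rho> \<theta>" by blast
    \<comment> \<open>N bounds the distance from the centre on the path and the radius at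
      \<open>\<theta>m\<close> is the smallest one on the curve, so no point of the path has a
      larger scaling factor.\<close>
    define M where "M = N / \<rho> \<theta>m"
    have M: "z \<in> q ` ({0..M} \<times> {0..2*pi})" if "z \<in> g'" for z
    proof -
      obtain \<theta> where \<theta>: "Ci z = (norm (Ci z) * cos \<theta>, norm (Ci z) * sin \<theta>)" "0 \<le> \<theta>" "\<theta> \<le> 2 * pi"
        by (rule polar_exists)
      have "z = q (norm (Ci z) / \<rho> \<theta>, \<theta>)" using Cc \<theta>(1) Ci(3) by metis
      moreover have "norm (Ci z) / \<rho> \<theta> \<le> M" unfolding M_def
        using N[OF that] \<theta>m[of \<theta>] \<theta>(2,3) \<rho>(2) order_trans[OF norm_ge_zero N[OF that]]
        by (intro frac_le) auto
      moreover have "norm (Ci z) / \<rho> \<theta> \<ge> 0" using \<rho>(2)[of \<theta>] by simp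
      ultimately show ?thesis using \<theta>(2,3) by (intro image_eqI[of _ _ "(norm (Ci z) / \<rho> \<theta>, \<theta>)"]) auto
    qed
    define B where "B = q ` ({1..M} \<times> {0..2*pi})"
    have B: "compact B" unfolding B_def by (intro compact_continuous_image q compact_Times) auto
    have "g' \<subseteq> A \<union> B"
    proof
      fix z assume "z \<in> g'"
      from M[OF this] obtain t \<theta> where "z = q (t, \<theta>)" "t \<in> {0..M}" "\<theta> \<in> {0..2*pi}" by blast
      then show "z \<in> A \<union> B" unfolding A_def B_def by (cases "t \<le> 1") auto
    qed
    moreover have "A \<inter> B \<inter> g' = {}"
    proof -
      have "A \<inter> B \<subseteq> \<Gamma>"
      proof
        fix z assume "z \<in> A \<inter> B"
        then obtain t \<theta> t' \<theta>' where *: "z = q (t, \<theta>)" "z = q (t', \<theta>')" "t \<in> {0..1}" "t' \<in> {1..M}"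
          "\<theta> \<in> {0..2*pi}" "\<theta>' \<in> {0..2*pi}" unfolding A_def B_def by blast
        then have "t = t'" using radial[of t \<theta> t' \<theta>'] by auto
        then have "t = 1" using * by auto
        then show "z \<in> \<Gamma>" using * unfolding \<Gamma>q by auto
      qed
      then show ?thesis using g'(3) by blast
    qed
    moreover have "A \<inter> g' \<noteq> {}" using 0 g'(4) by blast
    moreover have "B \<inter> g' \<noteq> {}" using \<open>y \<notin> A\<close> g'(5) \<open>g' \<subseteq> A \<union> B\<close> by blast
    ultimately show False
      using g'(2) A B compact_imp_closed unfolding connected_closed by blast
  qed
  then have "connected_component_set (- \<Gamma>) (C 0) \<subseteq> A" by auto
  then have "bounded (connected_component_set (- \<Gamma>) (C 0))"
    using A compact_imp_bounded bounded_subset by blast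
  then show "C 0 \<in> inside \<Gamma>" using notin unfolding inside_def by simp
qed

section \<open>Cycles in a contracting annulus\<close>

text \<open>In the polar coordinates given by the affine chart \<open>p0 + L\<close>, \<open>\<Theta>\<close> is the angular speed,
  \<open>S = d\<rho>/d\<theta>\<close>, and \<open>T\<close> is the derivative of \<open>W\<close> with respect to \<open>\<theta>\<close>. Assuming monotonicity of \<open>T\<close>
  and \<open>W\<close> in \<open>\<rho>\<close> for the same \<open>\<theta>\<close> avoids passing to \<open>W\<close> as a coordinate.\<close>
locale polar_annulus =
  fixes f :: "real \<times> real \<Rightarrow> real \<times> real" and p0 :: "real \<times> real"
    and L Linv :: "real \<times> real \<Rightarrow> real \<times> real"
    and S \<Theta> T :: "real \<Rightarrow> real \<Rightarrow> real" and W :: "real \<times> real \<Rightarrow> real"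
    and \<rho>a \<rho>b v1 v2 \<kappa> c C K M \<Theta>m \<Theta>M :: real
  assumes lip: "lipschitz_on_balls f"
    and L: "bounded_linear L" "bounded_linear Linv" "\<And>z. L (Linv z) = z" "\<And>z. Linv (L z) = z"
    and \<rho>ab: "0 < \<rho>a" "\<rho>a < \<rho>b" and v12: "v1 < v2"
    and field: "\<And>\<rho> \<theta>. \<rho> \<in> {\<rho>a..\<rho>b} \<Longrightarrow> f (p0 + L (\<rho> * cos \<theta>, \<rho> * sin \<theta>)) =
       \<Theta> \<rho> \<theta> *\<^sub>R L (S \<rho> \<theta> *\<^sub>R (cos \<theta>, sin \<theta>) + \<rho> *\<^sub>R (- sin \<theta>, cos \<theta>))"
    and \<Theta>_bounds: "0 < \<Theta>m" "\<And>\<rho> \<theta>. \<rho> \<in> {\<rho>a..\<rho>b} \<Longrightarrow> \<Theta>m \<le> \<Theta> \<rho> \<theta> \<and> \<Theta> \<rho> \<theta> \<le> \<Theta>M"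
    and S_cont: "continuous_on ({\<rho>a..\<rho>b} \<times> UNIV) (\<lambda>(\<rho>, \<theta>). S \<rho> \<theta>)"
    and \<Theta>_cont: "continuous_on ({\<rho>a..\<rho>b} \<times> UNIV) (\<lambda>(\<rho>, \<theta>). \<Theta> \<rho> \<theta>)"
    and S_per: "\<And>\<rho> \<theta>. S \<rho> (\<theta> + 2 * pi) = S \<rho> \<theta>"
    and \<Theta>_per: "\<And>\<rho> \<theta>. \<Theta> \<rho> (\<theta> + 2 * pi) = \<Theta> \<rho> \<theta>"
    and S_lip: "\<And>\<rho> \<rho>' \<theta>. \<rho> \<in> {\<rho>a..\<rho>b} \<Longrightarrow> \<rho>' \<in> {\<rho>a..\<rho>b} \<Longrightarrow> \<bar>S \<rho> \<theta> - S \<rho>' \<theta>\<bar> \<le> K * \<bar>\<rho> - \<rho>'\<bar>"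
    and S_bd: "\<And>\<rho> \<theta>. \<rho> \<in> {\<rho>a..\<rho>b} \<Longrightarrow> \<bar>S \<rho> \<theta>\<bar> \<le> M"
    and W_cont: "continuous_on UNIV W"
    and c: "c > 0"
    and W_lower: "\<And>\<rho> \<rho>' \<theta>. \<rho>a \<le> \<rho> \<Longrightarrow> \<rho> \<le> \<rho>' \<Longrightarrow> \<rho>' \<le> \<rho>b \<Longrightarrow>
       c * (\<rho>' - \<rho>) \<le> W (\<rho>' * cos \<theta>, \<rho>' * sin \<theta>) - W (\<rho> * cos \<theta>, \<rho> * sin \<theta>)"
    and W_upper: "\<And>\<rho> \<rho>' \<theta>. \<rho>a \<le> \<rho> \<Longrightarrow> \<rho> \<le> \<rho>' \<Longrightarrow> \<rho>' \<le> \<rho>b \<Longrightarrow>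
       W (\<rho>' * cos \<theta>, \<rho>' * sin \<theta>) - W (\<rho> * cos \<theta>, \<rho> * sin \<theta>) \<le> C * (\<rho>' - \<rho>)"
    and W_deriv: "\<And>r \<theta>. (r has_real_derivative S (r \<theta>) \<theta>) (at \<theta>) \<Longrightarrow> r \<theta> \<in> {\<rho>a..\<rho>b} \<Longrightarrow>
       ((\<lambda>\<theta>. W (r \<theta> * cos \<theta>, r \<theta> * sin \<theta>)) has_real_derivative T (r \<theta>) \<theta>) (at \<theta>)"
    and \<kappa>: "\<kappa> > 0"
    and T_contract: "\<And>\<rho> \<rho>' \<theta>. \<rho>a \<le> \<rho> \<Longrightarrow> \<rho> \<le> \<rho>' \<Longrightarrow> \<rho>' \<le> \<rho>b \<Longrightarrow> T \<rho>' \<theta> - T \<rho> \<theta> \<le> - \<kappa> * (\<rho>' - \<rho>)"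
    and W_a: "\<And>\<theta>. W (\<rho>a * cos \<theta>, \<rho>a * sin \<theta>) < v1"
    and W_b: "\<And>\<theta>. W (\<rho>b * cos \<theta>, \<rho>b * sin \<theta>) > v2"
    and T_v1: "\<And>\<rho> \<theta>. \<rho> \<in> {\<rho>a..\<rho>b} \<Longrightarrow> W (\<rho> * cos \<theta>, \<rho> * sin \<theta>) = v1 \<Longrightarrow> T \<rho> \<theta> > 0"
    and T_v2: "\<And>\<rho> \<theta>. \<rho> \<in> {\<rho>a..\<rho>b} \<Longrightarrow> W (\<rho> * cos \<theta>, \<rho> * sin \<theta>) = v2 \<Longrightarrow> T \<rho> \<theta> < 0"
begin

section \<open>The radial equation with clamped radius\<close>

definition V :: "real \<Rightarrow> real \<Rightarrow> real" where "V \<rho> \<theta> = W (\<rho> * cos \<theta>, \<rho> * sin \<theta>)"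
text \<open>Freezing the radius at the ends of the annulus makes S bounded and globally Lipschitz,
  so solutions exist for all angles. Trapped solutions do not feel the clamping.\<close>

definition clamp :: "real \<Rightarrow> real" where "clamp \<rho> = max \<rho>a (min \<rho>b \<rho>)"
definition sol :: "(real \<Rightarrow> real) \<Rightarrow> bool" where
  "sol r \<longleftrightarrow> (\<forall>\<theta>. (r has_real_derivative S (clamp (r \<theta>)) \<theta>) (at \<theta>))"
text \<open>The trapping region lies between two level curves of W and not between two circles,
  because the sign of the derivative is known for W and not for the radius.\<close>

definition trapped :: "real \<Rightarrow> real \<Rightarrow> bool" where
  "trapped \<rho> \<theta> \<longleftrightarrow> \<rho>a < \<rho> \<and> \<rho> < \<rho>b \<and> v1 \<le> V \<rho> \<theta> \<and> V \<rho> \<theta> \<le> v2"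

lemma clamp_in: "clamp \<rho> \<in> {\<rho>a..\<rho>b}" and clamp_id: "\<rho> \<in> {\<rho>a..\<rho>b} \<Longrightarrow> clamp \<rho> = \<rho>"
  and clamp_lip: "\<bar>clamp \<rho> - clamp \<rho>'\<bar> \<le> \<bar>\<rho> - \<rho>'\<bar>"
  using \<rho>ab by (auto simp: clamp_def)

lemma clamp_cont [continuous_intros]: "continuous_on A g \<Longrightarrow> continuous_on A (\<lambda>x. clamp (g x))"
  unfolding clamp_def by (intro continuous_intros)

lemma V_cont:
  fixes A :: "real set"
  shows "continuous_on A g \<Longrightarrow> continuous_on A h \<Longrightarrow> continuous_on A (\<lambda>x. V (g x) (h x))"
  unfolding V_def
  by (rule continuous_on_compose2[OF W_cont])
    (auto intro!: continuous_on_Pair continuous_on_mult continuous_on_cos continuous_on_sin)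

lemma V_less: "\<rho>a \<le> \<rho> \<Longrightarrow> \<rho> < \<rho>' \<Longrightarrow> \<rho>' \<le> \<rho>b \<Longrightarrow> V \<rho> \<theta> < V \<rho>' \<theta>"
  using W_lower[of \<rho> \<rho>' \<theta>] c unfolding V_def by (smt (verit) mult_pos_pos)

lemma V_per: "V \<rho> (\<theta> + 2 * pi) = V \<rho> \<theta>"
  by (simp add: V_def)

lemma S_clamp_lip: "\<bar>S (clamp \<rho>) \<theta> - S (clamp \<rho>') \<theta>\<bar> \<le> \<bar>K\<bar> * \<bar>\<rho> - \<rho>'\<bar>"
proof -
  have "\<bar>S (clamp \<rho>) \<theta> - S (clamp \<rho>') \<theta>\<bar> \<le> K * \<bar>clamp \<rho> - clamp \<rho>'\<bar>"
    by (intro S_lip clamp_in)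
  also have "\<dots> \<le> \<bar>K\<bar> * \<bar>clamp \<rho> - clamp \<rho>'\<bar>" by (intro mult_right_mono) auto
  also have "\<dots> \<le> \<bar>K\<bar> * \<bar>\<rho> - \<rho>'\<bar>" by (intro mult_left_mono clamp_lip) auto
  finally show ?thesis .
qed

lemma sol_exists: obtains r where "sol r" "r \<theta>0 = \<rho>0"
proof -
  have "continuous_on UNIV (\<lambda>z. (\<lambda>(\<rho>, \<theta>). S \<rho> \<theta>) (clamp (snd z), fst z + \<theta>0))"
    by (rule continuous_on_compose2[OF S_cont]) (use clamp_in in \<open>auto intro!: continuous_intros\<close>)
  then have "continuous_on UNIV (\<lambda>(t, x). S (clamp x) (t + \<theta>0))" by (simp add: case_prod_unfold)
  from picard_lindelof_global[OF this, of "\<bar>K\<bar>" M \<rho>0] obtain \<phi> where \<phi>: "\<phi> 0 = \<rho>0"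
    "\<And>t. (\<phi> has_vector_derivative S (clamp (\<phi> t)) (t + \<theta>0)) (at t)"
    using S_clamp_lip S_bd[OF clamp_in] by (auto simp: real_norm_def)
  have "sol (\<lambda>\<theta>. \<phi> (\<theta> - \<theta>0))"
    unfolding sol_def
  proof
    fix \<theta>
    have "(\<phi> has_real_derivative S (clamp (\<phi> (\<theta> - \<theta>0))) \<theta>) (at (\<theta> - \<theta>0))"
      using \<phi>(2)[of "\<theta> - \<theta>0"] by (simp add: has_real_derivative_iff_has_vector_derivative)
    then show "((\<lambda>\<theta>. \<phi> (\<theta> - \<theta>0)) has_real_derivative S (clamp (\<phi> (\<theta> - \<theta>0))) \<theta>) (at \<theta>)"
      using DERIV_shift[of \<phi> _ \<theta> "- \<theta>0"] by simp
  qed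
  then show ?thesis using that \<phi>(1) by auto
qed

text \<open>The backward half, obtained by reflecting the angle, is what extends the identity r
  (\<theta> + 2 pi) = r \<theta> in \<open>periodic_sol\<close> to negative angles.\<close>

lemma sol_unique:
  assumes "sol r" "sol r'" "r \<theta>0 = r' \<theta>0"
  shows "r \<theta> = r' \<theta>"
proof (cases "\<theta> \<ge> \<theta>0")
  case True
  show ?thesis
    by (rule ode_unique[where F="\<lambda>\<theta> \<rho>. S (clamp \<rho>) \<theta>" and L="\<bar>K\<bar>" and a=\<theta>0])
      (use assms True S_clamp_lip in \<open>auto simp: sol_def real_norm_def
        simp flip: has_real_derivative_iff_has_vector_derivative intro: DERIV_subset\<close>)
next
  case False
  have rev: "((\<lambda>t. r (- t)) has_vector_derivative - S (clamp (r (- t))) (- t)) (at t within A)"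
    if "sol r" for r t A
  proof -
    have "(r has_real_derivative S (clamp (r (- t))) (- t)) (at (- t))" using that by (simp add: sol_def)
    then have "((\<lambda>t. r (- t)) has_real_derivative - S (clamp (r (- t))) (- t)) (at t)"
      by (simp add: DERIV_mirror)
    from DERIV_subset[OF this, of A] show ?thesis
      by (simp add: has_real_derivative_iff_has_vector_derivative)
  qed
  have "r (- (- \<theta>)) = r' (- (- \<theta>))"
    by (rule ode_unique[where F="\<lambda>\<theta> \<rho>. - S (clamp \<rho>) (- \<theta>)" and L="\<bar>K\<bar>" and a="- \<theta>0"])
      (use assms False S_clamp_lip[of _ "- _"] in \<open>auto simp: real_norm_def abs_minus_commute intro: rev\<close>)
  then show ?thesis by simp
qed

lemma sol_continuous: "sol r \<Longrightarrow> continuous_on A r"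
  unfolding sol_def using DERIV_isCont continuous_at_imp_continuous_on by blast

lemma sol_V_deriv:
  assumes "sol r" "r \<theta> \<in> {\<rho>a..\<rho>b}"
  shows "((\<lambda>\<theta>. V (r \<theta>) \<theta>) has_real_derivative T (r \<theta>) \<theta>) (at \<theta>)"
  unfolding V_def using assms clamp_id W_deriv unfolding sol_def by metis

lemma sol_clamp_V_deriv:
  assumes "sol r" "\<rho>a < r \<theta>" "r \<theta> < \<rho>b"
  shows "((\<lambda>\<theta>. V (clamp (r \<theta>)) \<theta>) has_real_derivative T (r \<theta>) \<theta>) (at \<theta>)"
proof -
  have "isCont r \<theta>" using assms(1) unfolding sol_def using DERIV_isCont by blast
  then have "\<forall>\<^sub>F x in nhds \<theta>. r x \<in> {\<rho>a<..<\<rho>b}"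
    using assms(2,3) by (intro topological_tendstoD[of r "r \<theta>" "nhds \<theta>"]) (auto simp: isCont_def tendsto_at_iff_tendsto_nhds)
  then obtain U where U: "open U" "\<theta> \<in> U" "\<And>x. x \<in> U \<Longrightarrow> r x \<in> {\<rho>a<..<\<rho>b}"
    unfolding eventually_nhds by blast
  have eq: "clamp (r x) = r x" if "x \<in> U" for x using U(3)[OF that] by (intro clamp_id) auto
  show ?thesis
    by (rule has_field_derivative_transform_within_open[OF sol_V_deriv[OF assms(1)] U(1,2)])
      (use assms eq in auto)
qed

text \<open>W lies below v1 on the inner circle and above v2 on the outer one, so a level between v1
  and v2 excludes both ends of the annulus and the clamping is inactive.\<close>

lemma clamp_level:
  assumes "v1 \<le> V (clamp \<rho>) \<theta>" "V (clamp \<rho>) \<theta> \<le> v2"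
  shows "\<rho>a < \<rho>" "\<rho> < \<rho>b" "clamp \<rho> = \<rho>"
proof -
  have "clamp \<rho> \<noteq> \<rho>a" using W_a[of \<theta>] assms unfolding V_def by auto
  moreover have "clamp \<rho> \<noteq> \<rho>b" using W_b[of \<theta>] assms unfolding V_def by auto
  ultimately show "\<rho>a < \<rho>" "\<rho> < \<rho>b" "clamp \<rho> = \<rho>" using \<rho>ab by (auto simp: clamp_def max_def min_def split: if_splits)
qed

text \<open>The barrier is V at the clamped radius, which is meaningful even if r should leave the
  annulus. Where the barrier is attained, \<open>clamp_level\<close> puts r strictly inside, and
  there the sign of T is known.\<close>

lemma sol_trapped:
  assumes r: "sol r" and t0: "trapped (r \<theta>0) \<theta>0" and "\<theta>0 \<le> \<theta>"
  shows "trapped (r \<theta>) \<theta>"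
proof -
  have cl0: "clamp (r \<theta>0) = r \<theta>0" using t0 by (intro clamp_id) (auto simp: trapped_def)
  have cont: "continuous_on UNIV (\<lambda>\<theta>. V (clamp (r \<theta>)) \<theta>)"
    by (intro V_cont continuous_intros sol_continuous r)
  have "V (clamp (r \<theta>)) \<theta> - v2 \<le> 0"
  proof (rule barrier[where w="\<lambda>\<theta>. V (clamp (r \<theta>)) \<theta> - v2" and a=\<theta>0])
    show "\<exists>d<0. ((\<lambda>\<theta>. V (clamp (r \<theta>)) \<theta> - v2) has_real_derivative d) (at t)"
      if "\<theta>0 \<le> t" "V (clamp (r t)) t - v2 = 0" for t
    proof -
      have "v1 \<le> V (clamp (r t)) t" "V (clamp (r t)) t \<le> v2" using that v12 by auto
      note cl = clamp_level[OF this]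
      have "T (r t) t < 0" using that cl by (intro T_v2) (auto simp: V_def)
      then show ?thesis using sol_clamp_V_deriv[OF r cl(1,2)]
        by (intro exI[of _ "T (r t) t"]) (auto intro!: derivative_eq_intros)
    qed
  qed (use cont t0 assms(3) cl0 in \<open>auto intro!: continuous_intros simp: trapped_def\<close>)
  moreover have "v1 - V (clamp (r \<theta>)) \<theta> \<le> 0"
  proof (rule barrier[where w="\<lambda>\<theta>. v1 - V (clamp (r \<theta>)) \<theta>" and a=\<theta>0])
    show "\<exists>d<0. ((\<lambda>\<theta>. v1 - V (clamp (r \<theta>)) \<theta>) has_real_derivative d) (at t)"
      if "\<theta>0 \<le> t" "v1 - V (clamp (r t)) t = 0" for t
    proof -
      have "v1 \<le> V (clamp (r t)) t" "V (clamp (r t)) t \<le> v2" using that v12 by auto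
      note cl = clamp_level[OF this]
      have "T (r t) t > 0" using that cl by (intro T_v1) (auto simp: V_def)
      then show ?thesis using sol_clamp_V_deriv[OF r cl(1,2)]
        by (intro exI[of _ "- T (r t) t"]) (auto intro!: derivative_eq_intros)
    qed
  qed (use cont t0 assms(3) cl0 in \<open>auto intro!: continuous_intros simp: trapped_def\<close>)
  ultimately have lv: "v1 \<le> V (clamp (r \<theta>)) \<theta>" "V (clamp (r \<theta>)) \<theta> \<le> v2" by auto
  then show ?thesis using clamp_level[OF lv] by (simp add: trapped_def)
qed

section \<open>Contraction in W and the periodic solution\<close>

lemma C_pos: "C > 0"
proof -
  have "\<rho>a \<le> \<rho>b" using \<rho>ab by simp
  then have "c * (\<rho>b - \<rho>a) \<le> C * (\<rho>b - \<rho>a)"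
    by (intro order_trans[OF W_lower[of \<rho>a \<rho>b 0] W_upper[of \<rho>a \<rho>b 0]]) auto
  then show ?thesis using c \<rho>ab by auto
qed

definition rate :: real where "rate = \<kappa> / C"

lemma rate_pos: "rate > 0" using C_pos \<kappa> by (simp add: rate_def)

text \<open>Dividing by the upper Lipschitz constant C of W converts decay measured in the radius
  into decay measured in V. The product form is symmetric in the two radii, so neither orbit has to
  be the outer one.\<close>

lemma T_V:
  assumes "\<rho> \<in> {\<rho>a..\<rho>b}" "\<rho>' \<in> {\<rho>a..\<rho>b}"
  shows "(V \<rho>' \<theta> - V \<rho> \<theta>) * (T \<rho>' \<theta> - T \<rho> \<theta>) \<le> - rate * (V \<rho>' \<theta> - V \<rho> \<theta>)\<^sup>2"
proof -
  have *: "(V \<rho>' \<theta> - V \<rho> \<theta>) * (T \<rho>' \<theta> - T \<rho> \<theta>) \<le> - rate * (V \<rho>' \<theta> - V \<rho> \<theta>)\<^sup>2"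
    if "\<rho>a \<le> \<rho>" "\<rho> \<le> \<rho>'" "\<rho>' \<le> \<rho>b" for \<rho> \<rho>'
  proof -
    have d: "0 \<le> c * (\<rho>' - \<rho>)" using c that by simp
    then have D: "0 \<le> V \<rho>' \<theta> - V \<rho> \<theta>" using W_lower[OF that, of \<theta>] by (simp add: V_def)
    have "\<rho>' - \<rho> \<ge> (V \<rho>' \<theta> - V \<rho> \<theta>) / C"
      using W_upper[OF that, of \<theta>] C_pos by (simp add: V_def field_simps)
    then have "\<kappa> * (\<rho>' - \<rho>) \<ge> rate * (V \<rho>' \<theta> - V \<rho> \<theta>)"
      using mult_left_mono[of _ _ \<kappa>] \<kappa> by (fastforce simp: rate_def)
    then have "T \<rho>' \<theta> - T \<rho> \<theta> \<le> - rate * (V \<rho>' \<theta> - V \<rho> \<theta>)" using T_contract[OF that, of \<theta>] by simp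
    from mult_left_mono[OF this D] show ?thesis by (simp add: power2_eq_square mult_ac)
  qed
  show ?thesis
  proof (cases "\<rho> \<le> \<rho>'")
    case False
    then have "(V \<rho> \<theta> - V \<rho>' \<theta>) * (T \<rho> \<theta> - T \<rho>' \<theta>) \<le> - rate * (V \<rho> \<theta> - V \<rho>' \<theta>)\<^sup>2"
      using assms by (intro *) auto
    then show ?thesis by (simp add: algebra_simps power2_eq_square)
  qed (use assms *[of \<rho> \<rho>'] in simp)
qed

text \<open>Gronwall is applied to the square of the difference, which is differentiable without
  regard to its sign.\<close>

lemma contraction:
  assumes r: "sol r" "trapped (r \<theta>0) \<theta>0" and r': "sol r'" "trapped (r' \<theta>0) \<theta>0" and "\<theta>0 \<le> \<theta>"
  shows "\<bar>V (r' \<theta>) \<theta> - V (r \<theta>) \<theta>\<bar> \<le> \<bar>V (r' \<theta>0) \<theta>0 - V (r \<theta>0) \<theta>0\<bar> * exp (- rate * (\<theta> - \<theta>0))"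
proof -
  define D where "D = (\<lambda>\<theta>. V (r' \<theta>) \<theta> - V (r \<theta>) \<theta>)"
  have "(D \<theta>)\<^sup>2 \<le> (D \<theta>0)\<^sup>2 * exp ((- 2 * rate) * (\<theta> - \<theta>0))"
  proof (rule gronwall[where v="\<lambda>\<theta>. (D \<theta>)\<^sup>2"])
    fix t assume t: "t \<in> {\<theta>0..\<theta>}"
    then have tr: "trapped (r t) t" "trapped (r' t) t" using sol_trapped r r' by auto
    then have in': "r t \<in> {\<rho>a..\<rho>b}" "r' t \<in> {\<rho>a..\<rho>b}" by (auto simp: trapped_def)
    have "(D has_real_derivative T (r' t) t - T (r t) t) (at t)"
      unfolding D_def by (intro derivative_intros sol_V_deriv r r' in')
    then have "(D has_real_derivative T (r' t) t - T (r t) t) (at t within {\<theta>0..\<theta>})"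
      by (rule DERIV_subset) simp
    then show "((\<lambda>\<theta>. (D \<theta>)\<^sup>2) has_real_derivative 2 * (D t * (T (r' t) t - T (r t) t))) (at t within {\<theta>0..\<theta>})"
      by (auto intro!: derivative_eq_intros)
    show "2 * (D t * (T (r' t) t - T (r t) t)) \<le> - 2 * rate * (D t)\<^sup>2"
      using T_V[OF in', of t] by (simp add: D_def mult_ac)
  qed (use assms in auto)
  also have "exp ((- 2 * rate) * (\<theta> - \<theta>0)) = (exp (- rate * (\<theta> - \<theta>0)))\<^sup>2"
    by (simp flip: exp_double add: algebra_simps)
  finally have "(D \<theta>)\<^sup>2 \<le> (D \<theta>0 * exp (- rate * (\<theta> - \<theta>0)))\<^sup>2" by (simp add: power_mult_distrib)
  then have "\<bar>D \<theta>\<bar> \<le> \<bar>D \<theta>0 * exp (- rate * (\<theta> - \<theta>0))\<bar>" by (simp only: abs_le_square_iff)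
  then show ?thesis by (simp add: D_def abs_mult)
qed

lemma V_section: "v \<in> {v1..v2} \<Longrightarrow> \<exists>\<rho>. \<rho>a < \<rho> \<and> \<rho> < \<rho>b \<and> V \<rho> \<theta> = v"
proof -
  assume v: "v \<in> {v1..v2}"
  have "continuous_on {\<rho>a..\<rho>b} (\<lambda>\<rho>. V \<rho> \<theta>)" by (intro V_cont continuous_intros)
  then have "\<exists>\<rho>. \<rho>a \<le> \<rho> \<and> \<rho> \<le> \<rho>b \<and> V \<rho> \<theta> = v"
    by (intro IVT') (use v W_a[of \<theta>] W_b[of \<theta>] \<rho>ab in \<open>auto simp: V_def\<close>)
  then obtain \<rho> where "\<rho>a \<le> \<rho>" "\<rho> \<le> \<rho>b" "V \<rho> \<theta> = v" by blast
  moreover have "\<rho> \<noteq> \<rho>a" "\<rho> \<noteq> \<rho>b" using W_a[of \<theta>] W_b[of \<theta>] v calculation by (auto simp: V_def)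
  ultimately show ?thesis by force
qed

text \<open>The Poincare map of the ray \<theta> = 0 is written in the values v of V on that ray
  instead of the radii. There it maps {v1..v2} to itself and contracts by exp (- 2 pi rate), so
  Banach's theorem applies.\<close>

lemma periodic_sol:
  obtains r where "sol r" "\<And>\<theta>. r (\<theta> + 2 * pi) = r \<theta>" "\<And>\<theta>. trapped (r \<theta>) \<theta>"
proof -
  define R where "R = (\<lambda>v. SOME r. sol r \<and> \<rho>a < r 0 \<and> r 0 < \<rho>b \<and> V (r 0) 0 = v)"
  have R: "sol (R v)" "V (R v 0) 0 = v" "trapped (R v 0) 0" if v: "v \<in> {v1..v2}" for v
  proof -
    obtain \<rho> where \<rho>: "\<rho>a < \<rho>" "\<rho> < \<rho>b" "V \<rho> 0 = v" using V_section[OF v] by blast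
    obtain r where "sol r" "r 0 = \<rho>" by (rule sol_exists)
    then have "\<exists>r. sol r \<and> \<rho>a < r 0 \<and> r 0 < \<rho>b \<and> V (r 0) 0 = v" using \<rho> by blast
    from someI_ex[OF this] show "sol (R v)" "V (R v 0) 0 = v" "trapped (R v 0) 0"
      using v unfolding R_def trapped_def by auto
  qed
  define P where "P = (\<lambda>v. V (R v (2 * pi)) (2 * pi))"
  have "\<exists>!v. v \<in> {v1..v2} \<and> P v = v"
  proof (rule Banach_fix[where c="exp (- rate * (2 * pi))"])
    show "P ` {v1..v2} \<subseteq> {v1..v2}"
      using sol_trapped[OF R(1,3), of _ "2 * pi"] by (auto simp: P_def trapped_def)
    show "dist (P x) (P y) \<le> exp (- rate * (2 * pi)) * dist x y" if "x \<in> {v1..v2}" "y \<in> {v1..v2}" for x y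
      using contraction[OF R(1,3)[OF that(2)] R(1,3)[OF that(1)], of "2 * pi"] R(2) that
      by (simp add: P_def dist_real_def mult_ac)
  qed (use v12 rate_pos in \<open>auto simp: complete_eq_closed\<close>)
  then obtain v where v: "v \<in> {v1..v2}" "P v = v" by blast
  define r where "r = R v"
  have r: "sol r" "trapped (r 0) 0" using R[OF v(1)] by (simp_all add: r_def)
  have tr2: "trapped (r (2 * pi)) (2 * pi)" using sol_trapped[OF r] by simp
  have Veq: "V (r (2 * pi)) 0 = V (r 0) 0" using v(2) R(2)[OF v(1)] V_per[of "r (2 * pi)" 0] by (simp add: P_def r_def)
  \<comment> \<open>V is strictly increasing in the radius, so equal values of V on the same ray
    mean equal radii.\<close>
  have eq: "r (0 + 2 * pi) = r 0"
  proof (rule ccontr)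
    assume "r (0 + 2 * pi) \<noteq> r 0"
    then consider "r (2 * pi) < r 0" | "r 0 < r (2 * pi)" by fastforce
    then show False
      using V_less[of "r (2 * pi)" "r 0" 0] V_less[of "r 0" "r (2 * pi)" 0] Veq r(2) tr2
      by cases (auto simp: trapped_def)
  qed
  have "sol (\<lambda>\<theta>. r (\<theta> + 2 * pi))"
    unfolding sol_def
  proof
    fix \<theta>
    have "(r has_real_derivative S (clamp (r (\<theta> + 2 * pi))) \<theta>) (at (\<theta> + 2 * pi))"
      using r(1) S_per unfolding sol_def by metis
    then show "((\<lambda>\<theta>. r (\<theta> + 2 * pi)) has_real_derivative S (clamp (r (\<theta> + 2 * pi))) \<theta>) (at \<theta>)"
      by (simp add: DERIV_shift)
  qed
  from sol_unique[OF this r(1) eq] have per: "r (\<theta> + 2 * pi) = r \<theta>" for \<theta> .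
  \<comment> \<open>Trapping is known for angles from 0 onwards; periodicity carries it to negative
    angles.\<close>
  have "trapped (r \<theta>) \<theta>" for \<theta>
  proof -
    obtain n :: nat where n: "- \<theta> / (2 * pi) \<le> real n" using real_arch_simple by blast
    have e: "r (\<theta> + real n * (2 * pi)) = r \<theta>" by (rule periodic_nat) (rule per)
    have "V \<rho> (\<theta> + real n * (2 * pi)) = V \<rho> \<theta>" for \<rho>
      by (rule periodic_nat) (rule V_per)
    moreover have "\<theta> + real n * (2 * pi) \<ge> 0" using n by (simp add: field_simps)
    ultimately show ?thesis using sol_trapped[OF r, of "\<theta> + real n * (2 * pi)"] e by (simp add: trapped_def)
  qed
  then show ?thesis using that r(1) per by blast
qed

text \<open>If V touched v1, it would be increasing there and hence below v1 slightly earlier, where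
  the solution is trapped as well; likewise at v2. The strict inequalities place the cycle inside
  the open basin U.\<close>

lemma trapped_strict:
  assumes r: "sol r" and tr: "\<And>\<theta>. trapped (r \<theta>) \<theta>"
  shows "v1 < V (r \<theta>) \<theta>" "V (r \<theta>) \<theta> < v2"
proof -
  have in': "r \<theta> \<in> {\<rho>a..\<rho>b}" using tr[of \<theta>] by (auto simp: trapped_def)
  note d = sol_V_deriv[OF r in']
  show "v1 < V (r \<theta>) \<theta>"
  proof (rule ccontr)
    assume "\<not> ?thesis"
    then have e: "V (r \<theta>) \<theta> = v1" using tr[of \<theta>] by (simp add: trapped_def)
    then have "T (r \<theta>) \<theta> > 0" using T_v1[OF in'] by (simp add: V_def)
    from DERIV_pos_inc_left[OF d this] obtain h where "h > 0" "\<And>k. k > 0 \<Longrightarrow> k < h \<Longrightarrow> V (r (\<theta> - k)) (\<theta> - k) < v1"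
      unfolding e by blast
    from this(2)[of "h/2"] \<open>h > 0\<close> tr[of "\<theta> - h/2"] show False by (simp add: trapped_def)
  qed
  show "V (r \<theta>) \<theta> < v2"
  proof (rule ccontr)
    assume "\<not> ?thesis"
    then have e: "V (r \<theta>) \<theta> = v2" using tr[of \<theta>] by (simp add: trapped_def)
    then have "T (r \<theta>) \<theta> < 0" using T_v2[OF in'] by (simp add: V_def)
    from DERIV_neg_dec_left[OF d this] obtain h where "h > 0" "\<And>k. k > 0 \<Longrightarrow> k < h \<Longrightarrow> V (r (\<theta> - k)) (\<theta> - k) > v2"
      unfolding e by blast
    from this(2)[of "h/2"] \<open>h > 0\<close> tr[of "\<theta> - h/2"] show False by (simp add: trapped_def)
  qed
qed

section \<open>From the radial equation back to the vector field\<close>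

definition curve :: "real \<Rightarrow> real \<Rightarrow> real \<times> real" where
  "curve \<rho> \<theta> = p0 + L (\<rho> * cos \<theta>, \<rho> * sin \<theta>)"

text \<open>The angle h runs through r with speed \<Theta>, supplied by \<open>time_change\<close>.
  The curve solves the field at the times when it is trapped, since the polar form of the field is
  assumed in the annulus only.\<close>

lemma lift_solution:
  assumes r: "sol r"
  obtains h where "h 0 = \<theta>0" "surj h" "\<forall>t\<ge>0. h t \<ge> \<theta>0 + \<Theta>m * t"
    "\<forall>I. (\<forall>t\<in>I. trapped (r (h t)) (h t)) \<longrightarrow> solves f (\<lambda>t. curve (r (h t)) (h t)) I"
    "(\<forall>\<theta>. r (\<theta> + 2 * pi) = r \<theta>) \<longrightarrow> (\<exists>T>0. \<forall>t. h (t + T) = h t + 2 * pi)"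
proof -
  define l where "l = (\<lambda>\<theta>. \<Theta> (clamp (r \<theta>)) \<theta>)"
  have "continuous_on UNIV (\<lambda>\<theta>. (\<lambda>(\<rho>, \<theta>). \<Theta> \<rho> \<theta>) (clamp (r \<theta>), \<theta>))"
    by (rule continuous_on_compose2[OF \<Theta>_cont])
      (use clamp_in in \<open>auto intro!: continuous_intros sol_continuous[OF r]\<close>)
  then have cl: "continuous_on UNIV l" by (simp add: l_def)
  have bd: "\<Theta>m \<le> l \<theta>" "l \<theta> \<le> \<Theta>M" for \<theta> using \<Theta>_bounds(2)[OF clamp_in] by (auto simp: l_def)
  obtain h where h: "h 0 = \<theta>0" "\<And>t. (h has_real_derivative l (h t)) (at t)" "surj h"
    "\<And>t. t \<ge> 0 \<Longrightarrow> h t \<ge> \<theta>0 + \<Theta>m * t"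
    "\<And>p. p > 0 \<Longrightarrow> (\<And>x. l (x + p) = l x) \<Longrightarrow> \<exists>T>0. \<forall>t. h (t + T) = h t + p"
    using time_change[OF cl \<Theta>_bounds(1) bd, of \<theta>0] by metis
  show ?thesis
  proof (rule that[OF h(1,3)])
    show "\<forall>t\<ge>0. h t \<ge> \<theta>0 + \<Theta>m * t" using h(4) by blast
    show "(\<forall>\<theta>. r (\<theta> + 2 * pi) = r \<theta>) \<longrightarrow> (\<exists>T>0. \<forall>t. h (t + T) = h t + 2 * pi)"
      using h(5)[of "2 * pi"] by (auto simp: l_def \<Theta>_per)
    show "\<forall>I. (\<forall>t\<in>I. trapped (r (h t)) (h t)) \<longrightarrow> solves f (\<lambda>t. curve (r (h t)) (h t)) I"
      unfolding solves_def
    proof (intro allI impI ballI)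
      fix I t assume tr: "\<forall>t\<in>I. trapped (r (h t)) (h t)" and "t \<in> I"
      define \<rho> \<theta> where "\<rho> = r (h t)" and "\<theta> = h t"
      have in': "\<rho> \<in> {\<rho>a..\<rho>b}" using bspec[OF tr \<open>t \<in> I\<close>] by (auto simp: trapped_def \<rho>_def)
      have dh: "(h has_real_derivative \<Theta> \<rho> \<theta>) (at t)"
        using h(2)[of t] clamp_id[OF in'] by (simp add: l_def \<rho>_def \<theta>_def)
      have "(r has_real_derivative S \<rho> \<theta>) (at (h t))"
        using r clamp_id[OF in'] unfolding sol_def \<rho>_def \<theta>_def by metis
      from DERIV_chain2[OF this dh] have dr: "((\<lambda>t. r (h t)) has_real_derivative S \<rho> \<theta> * \<Theta> \<rho> \<theta>) (at t)" .
      have 1: "((\<lambda>t. r (h t) * cos (h t)) has_real_derivative \<Theta> \<rho> \<theta> * (S \<rho> \<theta> * cos \<theta> - \<rho> * sin \<theta>)) (at t)"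
        by (rule derivative_eq_intros dr dh refl)+ (simp add: \<rho>_def \<theta>_def algebra_simps)
      have 2: "((\<lambda>t. r (h t) * sin (h t)) has_real_derivative \<Theta> \<rho> \<theta> * (S \<rho> \<theta> * sin \<theta> + \<rho> * cos \<theta>)) (at t)"
        by (rule derivative_eq_intros dr dh refl)+ (simp add: \<rho>_def \<theta>_def algebra_simps)
      have "((\<lambda>t. (r (h t) * cos (h t), r (h t) * sin (h t))) has_vector_derivative
          (\<Theta> \<rho> \<theta> * (S \<rho> \<theta> * cos \<theta> - \<rho> * sin \<theta>), \<Theta> \<rho> \<theta> * (S \<rho> \<theta> * sin \<theta> + \<rho> * cos \<theta>))) (at t)"
        using 1 2 by (intro has_vector_derivative_Pair) (simp_all add: has_real_derivative_iff_has_vector_derivative)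
      from bounded_linear.has_vector_derivative[OF L(1) this]
      have "((\<lambda>t. p0 + L (r (h t) * cos (h t), r (h t) * sin (h t))) has_vector_derivative
          L (\<Theta> \<rho> \<theta> * (S \<rho> \<theta> * cos \<theta> - \<rho> * sin \<theta>), \<Theta> \<rho> \<theta> * (S \<rho> \<theta> * sin \<theta> + \<rho> * cos \<theta>))) (at t)"
        by (auto intro!: derivative_eq_intros)
      moreover have "L (\<Theta> \<rho> \<theta> * (S \<rho> \<theta> * cos \<theta> - \<rho> * sin \<theta>), \<Theta> \<rho> \<theta> * (S \<rho> \<theta> * sin \<theta> + \<rho> * cos \<theta>)) = f (curve \<rho> \<theta>)"
        unfolding curve_def field[OF in'] linear_scale[OF bounded_linear.linear[OF L(1)], symmetric] by simp
      ultimately show "((\<lambda>t. curve (r (h t)) (h t)) has_vector_derivative f (curve (r (h t)) (h t))) (at t within I)"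
        unfolding curve_def \<rho>_def \<theta>_def by (simp add: has_vector_derivative_at_within)
    qed
  qed
qed

text \<open>An orbit and the cycle are compared at equal angles and not at equal times: the distance
  to \<Gamma> is at most that to the point of \<Gamma> on the same ray, and it decays exponentially
  in the angle, which grows at least linearly in time.\<close>

theorem stable_limit_cycle_exists: "\<exists>\<Gamma>. stable_limit_cycle f \<Gamma> \<and> surrounds \<Gamma> p0"
proof -
  obtain rs where rs: "sol rs" "\<And>\<theta>. rs (\<theta> + 2 * pi) = rs \<theta>" "\<And>\<theta>. trapped (rs \<theta>) \<theta>"
    using periodic_sol by metis
  have rs_pos: "rs \<theta> > 0" for \<theta> using rs(3)[of \<theta>] \<rho>ab by (simp add: trapped_def)
  define \<Gamma> where "\<Gamma> = range (\<lambda>\<theta>. curve (rs \<theta>) \<theta>)"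
  note Lc = linear_continuous_on[OF L(1)] note Lic = linear_continuous_on[OF L(2)]
  have p0: "p0 + L 0 = p0" using L(1) by (simp add: bounded_linear.linear linear_0)
  have *: "p0 + L 0 \<in> inside \<Gamma> \<and> compact \<Gamma>"
    unfolding \<Gamma>_def curve_def
    by (intro conjI starlike_curve_inside[where C="\<lambda>z. p0 + L z" and Ci="\<lambda>z. Linv (z - p0)"])
      (auto intro!: sol_continuous rs continuous_intros continuous_on_compose2[OF Lc[of UNIV]]
        continuous_on_compose2[OF Lic[of UNIV]] simp: L(3,4) rs_pos rs(2))
  have surr: "surrounds \<Gamma> p0" using * p0 by (simp add: surrounds_def)
  have closed: "closed \<Gamma>" using * compact_imp_closed by blast
  have orbit: "closed_orbit f \<Gamma>"
  proof -
    obtain h where h: "h 0 = 0" "surj h"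
      "\<forall>I. (\<forall>t\<in>I. trapped (rs (h t)) (h t)) \<longrightarrow> solves f (\<lambda>t. curve (rs (h t)) (h t)) I"
      "(\<forall>\<theta>. rs (\<theta> + 2 * pi) = rs \<theta>) \<longrightarrow> (\<exists>T>0. \<forall>t. h (t + T) = h t + 2 * pi)"
      by (rule lift_solution[OF rs(1), of 0])
    have hs: "solves f (\<lambda>t. curve (rs (h t)) (h t)) UNIV" using h(3) rs(3) by blast
    obtain T where T: "T > 0" "\<And>t. h (t + T) = h t + 2 * pi" using h(4) rs(2) by blast
    \<comment> \<open>The points at the angles 0 and pi lie on opposite sides of \<open>p0\<close>,
      so the orbit is not constant.\<close>
    obtain t where t: "h t = pi" using h(2) by (metis surjD)
    have "curve (rs pi) pi \<noteq> curve (rs 0) 0"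
    proof
      assume "curve (rs pi) pi = curve (rs 0) 0"
      then have "Linv (L (rs pi * cos pi, rs pi * sin pi)) = Linv (L (rs 0 * cos 0, rs 0 * sin 0))"
        unfolding curve_def by simp
      then show False using rs_pos[of 0] rs_pos[of pi] by (simp add: L(4))
    qed
    then have "\<exists>t. curve (rs (h t)) (h t) \<noteq> curve (rs (h 0)) (h 0)" using t h(1) by metis
    moreover have "curve (rs (h (t + T))) (h (t + T)) = curve (rs (h t)) (h t)" for t
      by (simp add: T(2) rs(2) curve_def)
    moreover have "\<Gamma> = range (\<lambda>t. curve (rs (h t)) (h t))"
      unfolding \<Gamma>_def using h(2) image_image[of "\<lambda>\<theta>. curve (rs \<theta>) \<theta>" h UNIV] by simp
    ultimately show ?thesis unfolding closed_orbit_def using T(1) hs by blast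
  qed
  define U where "U = {z. \<rho>a < norm (Linv (z - p0)) \<and> norm (Linv (z - p0)) < \<rho>b \<and>
    v1 < W (Linv (z - p0)) \<and> W (Linv (z - p0)) < v2}"
  have cLi: "continuous_on UNIV (\<lambda>z. Linv (z - p0))"
    by (intro continuous_on_compose2[OF Lic[of UNIV]] continuous_intros) auto
  have "open U" unfolding U_def
    by (intro open_Collect_conj open_Collect_less continuous_intros cLi continuous_on_compose2[OF W_cont cLi]) auto
  have Linv_curve: "Linv (curve \<rho> \<theta> - p0) = (\<rho> * cos \<theta>, \<rho> * sin \<theta>)" for \<rho> \<theta>
    by (simp add: curve_def L(4))
  have "\<Gamma> \<subseteq> U"
  proof
    fix z assume "z \<in> \<Gamma>"
    then obtain \<theta> where "z = curve (rs \<theta>) \<theta>" unfolding \<Gamma>_def by blast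
    then show "z \<in> U" using rs(3)[of \<theta>] trapped_strict[OF rs(1,3), of \<theta>] rs_pos[of \<theta>]
      unfolding U_def by (simp add: Linv_curve norm_polar trapped_def V_def)
  qed
  obtain B where B: "\<And>z. norm (L z) \<le> norm z * B" "B > 0" using bounded_linear.pos_bounded[OF L(1)] by blast
  have "\<exists>\<phi>. solves f \<phi> {0..} \<and> \<phi> 0 = x0 \<and> ((\<lambda>t. infdist (\<phi> t) \<Gamma>) \<longlongrightarrow> 0) at_top" if "x0 \<in> U" for x0
  proof -
    define \<rho> where "\<rho> = norm (Linv (x0 - p0))"
    obtain \<theta>0 where \<theta>0: "Linv (x0 - p0) = (\<rho> * cos \<theta>0, \<rho> * sin \<theta>0)" unfolding \<rho>_def by (rule polar_exists)
    have x0: "x0 = curve \<rho> \<theta>0" unfolding curve_def \<theta>0[symmetric] by (simp add: L(3))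
    have tr0: "trapped \<rho> \<theta>0" using that \<theta>0 unfolding U_def trapped_def V_def \<rho>_def by auto
    obtain r where r: "sol r" "r \<theta>0 = \<rho>" by (rule sol_exists)
    obtain h where h: "h 0 = \<theta>0" "\<forall>t\<ge>0. h t \<ge> \<theta>0 + \<Theta>m * t"
      "\<forall>I. (\<forall>t\<in>I. trapped (r (h t)) (h t)) \<longrightarrow> solves f (\<lambda>t. curve (r (h t)) (h t)) I"
      by (rule lift_solution[OF r(1), of \<theta>0])
    have ge: "h t \<ge> \<theta>0" if "t \<ge> 0" for t using h(2) \<Theta>_bounds(1) that by (smt (verit) mult_nonneg_nonneg)
    have tr: "trapped (r (h t)) (h t)" if "t \<ge> 0" for t
      using sol_trapped[OF r(1), of \<theta>0] tr0 r(2) ge[OF that] by simp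
    define D where "D = \<bar>V (r \<theta>0) \<theta>0 - V (rs \<theta>0) \<theta>0\<bar>"
    have bound: "infdist (curve (r (h t)) (h t)) \<Gamma> \<le> B / c * D * exp (- rate * (\<Theta>m * t))" if t: "t \<ge> 0" for t
    proof -
      define \<theta> where "\<theta> = h t"
      have trt: "trapped (r \<theta>) \<theta>" "trapped (rs \<theta>) \<theta>" using tr[OF t] rs(3) by (auto simp: \<theta>_def)
      have "infdist (curve (r \<theta>) \<theta>) \<Gamma> \<le> dist (curve (r \<theta>) \<theta>) (curve (rs \<theta>) \<theta>)"
        by (intro infdist_le) (auto simp: \<Gamma>_def)
      also have "\<dots> = norm (L ((r \<theta> - rs \<theta>) * cos \<theta>, (r \<theta> - rs \<theta>) * sin \<theta>))"
      proof -
        have "L (r \<theta> * cos \<theta>, r \<theta> * sin \<theta>) - L (rs \<theta> * cos \<theta>, rs \<theta> * sin \<theta>) =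
          L ((r \<theta> - rs \<theta>) * cos \<theta>, (r \<theta> - rs \<theta>) * sin \<theta>)"
          by (simp add: linear_diff[OF bounded_linear.linear[OF L(1)], symmetric] left_diff_distrib)
        then show ?thesis by (simp add: dist_norm curve_def)
      qed
      also have "\<dots> \<le> \<bar>r \<theta> - rs \<theta>\<bar> * B" using B(1) norm_polar by metis
      finally have 1: "infdist (curve (r \<theta>) \<theta>) \<Gamma> \<le> \<bar>r \<theta> - rs \<theta>\<bar> * B" .
      have 2: "c * \<bar>r \<theta> - rs \<theta>\<bar> \<le> \<bar>V (r \<theta>) \<theta> - V (rs \<theta>) \<theta>\<bar>"
        using W_lower[of "r \<theta>" "rs \<theta>" \<theta>] W_lower[of "rs \<theta>" "r \<theta>" \<theta>] trt
        by (cases "r \<theta> \<le> rs \<theta>") (auto simp: V_def trapped_def)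
      have "\<bar>V (r \<theta>) \<theta> - V (rs \<theta>) \<theta>\<bar> \<le> D * exp (- rate * (\<theta> - \<theta>0))"
        unfolding D_def by (rule contraction) (use rs r tr0 ge[OF t] in \<open>auto simp: \<theta>_def\<close>)
      also have "\<dots> \<le> D * exp (- rate * (\<Theta>m * t))"
        using h(2) t rate_pos by (intro mult_left_mono) (auto simp: \<theta>_def D_def)
      finally have "c * \<bar>r \<theta> - rs \<theta>\<bar> \<le> D * exp (- rate * (\<Theta>m * t))" using 2 by linarith
      then have "\<bar>r \<theta> - rs \<theta>\<bar> \<le> D * exp (- rate * (\<Theta>m * t)) / c"
        using c by (simp add: pos_le_divide_eq mult.commute)
      from mult_right_mono[OF this, of B] 1 B(2) show ?thesis by (simp add: \<theta>_def mult_ac)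
    qed
    have "((\<lambda>t. infdist (curve (r (h t)) (h t)) \<Gamma>) \<longlongrightarrow> 0) at_top"
    proof (rule tendsto_sandwich[OF _ _ tendsto_const])
      show "\<forall>\<^sub>F t in at_top. 0 \<le> infdist (curve (r (h t)) (h t)) \<Gamma>" by (simp add: infdist_nonneg)
      show "\<forall>\<^sub>F t in at_top. infdist (curve (r (h t)) (h t)) \<Gamma> \<le> B / c * D * exp (- rate * (\<Theta>m * t))"
        using bound by (rule eventually_at_top_linorderI)
      have "filterlim (\<lambda>t. rate * \<Theta>m * t) at_top at_top"
        by (rule filterlim_tendsto_pos_mult_at_top[OF tendsto_const _ filterlim_ident])
          (use rate_pos \<Theta>_bounds(1) in simp)
      then have "((\<lambda>t. exp (- (rate * \<Theta>m * t))) \<longlongrightarrow> 0) at_top"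
        by (intro filterlim_compose[OF exp_at_bot]) (simp add: filterlim_uminus_at_bot)
      then have "((\<lambda>t. B / c * D * exp (- (rate * \<Theta>m * t))) \<longlongrightarrow> B / c * D * 0) at_top"
        by (intro tendsto_intros)
      then show "((\<lambda>t. B / c * D * exp (- rate * (\<Theta>m * t))) \<longlongrightarrow> 0) at_top" by (simp add: mult_ac)
    qed
    moreover have "solves f (\<lambda>t. curve (r (h t)) (h t)) {0..}" using tr h(3) by simp
    moreover have "curve (r (h 0)) (h 0) = x0" using h(1) r(2) x0 by simp
    ultimately show ?thesis by blast
  qed
  then have "stable_limit_cycle f \<Gamma>"
    using lip orbit closed \<open>open U\<close> \<open>\<Gamma> \<subseteq> U\<close> by (intro stable_limit_cycleI[of f \<Gamma> U]) auto
  then show ?thesis using surr by blast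
qed

end

section \<open>Uniform bounds\<close>

text \<open>Bounded and Lipschitz, but compared only on the pairs in \<open>R\<close>: if these differ in one
  coordinate only, the function is Lipschitz in that coordinate, uniformly in the others.\<close>
definition bl :: "('z::metric_space \<times> 'z) set \<Rightarrow> ('z \<Rightarrow> real) \<Rightarrow> bool" where
  "bl R f \<longleftrightarrow> (\<exists>M\<ge>0. \<forall>(z, z')\<in>R. \<bar>f z\<bar> \<le> M \<and> \<bar>f z'\<bar> \<le> M \<and> \<bar>f z - f z'\<bar> \<le> M * dist z z')"

lemma blI:
  assumes "\<And>z z'. (z, z') \<in> R \<Longrightarrow> \<bar>f z\<bar> \<le> M" "\<And>z z'. (z, z') \<in> R \<Longrightarrow> \<bar>f z'\<bar> \<le> M"
    "\<And>z z'. (z, z') \<in> R \<Longrightarrow> \<bar>f z - f z'\<bar> \<le> N * dist z z'"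
  shows "bl R f"
proof -
  define K where "K = max 0 (max M N)"
  have "\<bar>f z - f z'\<bar> \<le> K * dist z z'" if "(z, z') \<in> R" for z z'
    by (rule order_trans[OF assms(3)[OF that]]) (auto simp: K_def intro!: mult_right_mono)
  moreover have "\<bar>f z\<bar> \<le> K" "\<bar>f z'\<bar> \<le> K" if "(z, z') \<in> R" for z z'
    using assms(1,2)[OF that] by (auto simp: K_def)
  ultimately show ?thesis unfolding bl_def by (intro exI[of _ K]) (auto simp: K_def)
qed

lemma blE:
  assumes "bl R f"
  obtains M where "M \<ge> 0"
    "\<forall>z z'. (z, z') \<in> R \<longrightarrow> \<bar>f z\<bar> \<le> M \<and> \<bar>f z'\<bar> \<le> M \<and> \<bar>f z - f z'\<bar> \<le> M * dist z z'"
  using assms unfolding bl_def by auto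

lemma bl_const: "bl R (\<lambda>_. c)"
  by (rule blI[of _ _ "\<bar>c\<bar>" 0]) auto

lemma bl_add:
  assumes "bl R f" "bl R g" shows "bl R (\<lambda>z. f z + g z)"
proof -
  obtain M where M0: "M \<ge> 0" and MM: "\<forall>z z'. (z, z') \<in> R \<longrightarrow> \<bar>f z\<bar> \<le> M \<and> \<bar>f z'\<bar> \<le> M \<and> \<bar>f z - f z'\<bar> \<le> M * dist z z'"
    using assms(1) by (rule blE)
  obtain N where N0: "N \<ge> 0" and NN: "\<forall>z z'. (z, z') \<in> R \<longrightarrow> \<bar>g z\<bar> \<le> N \<and> \<bar>g z'\<bar> \<le> N \<and> \<bar>g z - g z'\<bar> \<le> N * dist z z'"
    using assms(2) by (rule blE)
  show ?thesis
  proof (rule blI[of _ _ "M + N" "M + N"])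
    fix z z' assume z: "(z, z') \<in> R"
    have M: "\<bar>f z\<bar> \<le> M" "\<bar>f z'\<bar> \<le> M" "\<bar>f z - f z'\<bar> \<le> M * dist z z'" using MM z by blast+
    have N: "\<bar>g z\<bar> \<le> N" "\<bar>g z'\<bar> \<le> N" "\<bar>g z - g z'\<bar> \<le> N * dist z z'" using NN z by blast+
    show "\<bar>f z + g z\<bar> \<le> M + N" "\<bar>f z' + g z'\<bar> \<le> M + N"
      using M N by linarith+
    show "\<bar>f z + g z - (f z' + g z')\<bar> \<le> (M + N) * dist z z'"
      using M(3) N(3) unfolding distrib_right by linarith
  qed
qed

lemma bl_mult:
  assumes "bl R f" "bl R g" shows "bl R (\<lambda>z. f z * g z)"
proof -
  obtain M where M0: "M \<ge> 0" and MM: "\<forall>z z'. (z, z') \<in> R \<longrightarrow> \<bar>f z\<bar> \<le> M \<and> \<bar>f z'\<bar> \<le> M \<and> \<bar>f z - f z'\<bar> \<le> M * dist z z'"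
    using assms(1) by (rule blE)
  obtain N where N0: "N \<ge> 0" and NN: "\<forall>z z'. (z, z') \<in> R \<longrightarrow> \<bar>g z\<bar> \<le> N \<and> \<bar>g z'\<bar> \<le> N \<and> \<bar>g z - g z'\<bar> \<le> N * dist z z'"
    using assms(2) by (rule blE)
  show ?thesis
  proof (rule blI[of _ _ "M * N" "2 * (M * N)"])
    fix z z' assume z: "(z, z') \<in> R"
    have M: "\<bar>f z\<bar> \<le> M" "\<bar>f z'\<bar> \<le> M" "\<bar>f z - f z'\<bar> \<le> M * dist z z'" using MM z by blast+
    have N: "\<bar>g z\<bar> \<le> N" "\<bar>g z'\<bar> \<le> N" "\<bar>g z - g z'\<bar> \<le> N * dist z z'" using NN z by blast+
    show "\<bar>f z * g z\<bar> \<le> M * N" "\<bar>f z' * g z'\<bar> \<le> M * N"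
      unfolding abs_mult using M0 N0 M N by (auto intro!: mult_mono)
    have "\<bar>f z * g z - f z' * g z'\<bar> = \<bar>f z * (g z - g z') + (f z - f z') * g z'\<bar>" by (simp add: algebra_simps)
    also have "\<dots> \<le> \<bar>f z\<bar> * \<bar>g z - g z'\<bar> + \<bar>f z - f z'\<bar> * \<bar>g z'\<bar>"
      by (rule order_trans[OF abs_triangle_ineq]) (simp add: abs_mult)
    also have "\<dots> \<le> M * (N * dist z z') + (M * dist z z') * N"
      using M0 N0 M N by (intro add_mono mult_mono) auto
    finally show "\<bar>f z * g z - f z' * g z'\<bar> \<le> 2 * (M * N) * dist z z'" by (simp add: algebra_simps)
  qed
qed

lemma bl_minus: "bl R f \<Longrightarrow> bl R (\<lambda>z. - f z)"
  using bl_mult[OF bl_const[of R "-1"]] by simp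

lemma bl_diff: "bl R f \<Longrightarrow> bl R g \<Longrightarrow> bl R (\<lambda>z. f z - g z)"
  using bl_add[of R f "\<lambda>z. - g z"] bl_minus[of R g] by simp

lemma bl_power: "bl R f \<Longrightarrow> bl R (\<lambda>z. f z ^ n)"
  by (induction n) (auto intro: bl_mult bl_const)

lemma bl_inverse:
  assumes "bl R f" "m > 0" "\<And>z z'. (z, z') \<in> R \<Longrightarrow> m \<le> f z" "\<And>z z'. (z, z') \<in> R \<Longrightarrow> m \<le> f z'"
  shows "bl R (\<lambda>z. inverse (f z))"
proof -
  obtain M where M: "M \<ge> 0" "\<forall>z z'. (z, z') \<in> R \<longrightarrow> \<bar>f z\<bar> \<le> M \<and> \<bar>f z'\<bar> \<le> M \<and> \<bar>f z - f z'\<bar> \<le> M * dist z z'"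
    using assms(1) by (rule blE)
  show ?thesis
  proof (rule blI[of _ _ "inverse m" "M * (inverse m * inverse m)"])
    fix z z' assume z: "(z, z') \<in> R"
    note m = assms(3,4)[OF z]
    have p: "f z > 0" "f z' > 0" using m assms(2) by linarith+
    have i: "inverse (f z) \<le> inverse m" "inverse (f z') \<le> inverse m"
      using m assms(2) by (auto intro: le_imp_inverse_le)
    then show "\<bar>inverse (f z)\<bar> \<le> inverse m" "\<bar>inverse (f z')\<bar> \<le> inverse m" using p by auto
    have "\<bar>inverse (f z) - inverse (f z')\<bar> = \<bar>f z - f z'\<bar> * (inverse (f z) * inverse (f z'))"
      using p by (simp add: inverse_diff_inverse abs_mult mult_ac)
    also have "\<dots> \<le> (M * dist z z') * (inverse m * inverse m)"
      using M z i p assms(2) by (intro mult_mono) auto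
    finally show "\<bar>inverse (f z) - inverse (f z')\<bar> \<le> M * (inverse m * inverse m) * dist z z'"
      by (simp add: mult_ac)
  qed
qed

lemma bl_divide_const: "bl R f \<Longrightarrow> bl R (\<lambda>z. f z / c)"
  unfolding divide_inverse by (intro bl_mult bl_const)

lemmas bl_intros = bl_const bl_divide_const bl_add bl_diff bl_minus bl_mult bl_power

lemma lipschitz_on_balls_bl:
  fixes f :: "real \<times> real \<Rightarrow> real \<times> real"
  assumes "\<And>R. bl (cball 0 R \<times> cball 0 R) (\<lambda>z. fst (f z))" "\<And>R. bl (cball 0 R \<times> cball 0 R) (\<lambda>z. snd (f z))"
  shows "lipschitz_on_balls f"
  unfolding lipschitz_on_balls_def
proof
  fix R :: real
  let ?R = "(cball 0 R \<times> cball 0 R) :: ((real \<times> real) \<times> real \<times> real) set"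
  obtain M where M: "M \<ge> 0" "\<forall>z z'. (z, z') \<in> ?R \<longrightarrow> \<bar>fst (f z)\<bar> \<le> M \<and> \<bar>fst (f z')\<bar> \<le> M \<and>
      \<bar>fst (f z) - fst (f z')\<bar> \<le> M * dist z z'"
    using assms(1)[of R] by (rule blE)
  obtain N where N: "N \<ge> 0" "\<forall>z z'. (z, z') \<in> ?R \<longrightarrow> \<bar>snd (f z)\<bar> \<le> N \<and> \<bar>snd (f z')\<bar> \<le> N \<and>
      \<bar>snd (f z) - snd (f z')\<bar> \<le> N * dist z z'"
    using assms(2)[of R] by (rule blE)
  have "(M + N)-lipschitz_on (cball 0 R) f"
  proof (rule lipschitz_onI)
    fix z z' :: "real \<times> real" assume "z \<in> cball 0 R" "z' \<in> cball 0 R"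
    then have z: "(z, z') \<in> ?R" by simp
    have "dist (f z) (f z') \<le> \<bar>fst (f z) - fst (f z')\<bar> + \<bar>snd (f z) - snd (f z')\<bar>"
      unfolding dist_prod_def dist_real_def by (rule sqrt_sum_squares_le_sum_abs[THEN order_trans]) simp
    also have "\<dots> \<le> (M + N) * dist z z'" using M(2) N(2) z unfolding distrib_right by fastforce
    finally show "dist (f z) (f z') \<le> (M + N) * dist z z'" .
  qed (use M N in simp)
  then show "\<exists>L. L-lipschitz_on (cball 0 R) f" ..
qed

lemma bl_fst: "bl (cball 0 R \<times> cball 0 R) (fst :: real \<times> real \<Rightarrow> real)"
proof (rule blI[of _ _ R 1])
  show "\<bar>fst z\<bar> \<le> R" if "(z, z') \<in> cball 0 R \<times> cball 0 R" for z z' :: "real \<times> real"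
    using that norm_fst_le[of "fst z" "snd z"] by auto
  show "\<bar>fst z'\<bar> \<le> R" if "(z, z') \<in> cball 0 R \<times> cball 0 R" for z z' :: "real \<times> real"
    using that norm_fst_le[of "fst z'" "snd z'"] by auto
  show "\<bar>fst z - fst z'\<bar> \<le> 1 * dist z z'" for z z' :: "real \<times> real"
    using dist_fst_le[of z z'] by (simp add: dist_real_def)
qed

lemma bl_snd: "bl (cball 0 R \<times> cball 0 R) (snd :: real \<times> real \<Rightarrow> real)"
proof (rule blI[of _ _ R 1])
  show "\<bar>snd z\<bar> \<le> R" if "(z, z') \<in> cball 0 R \<times> cball 0 R" for z z' :: "real \<times> real"
    using that norm_snd_le[of "snd z" "fst z"] by auto
  show "\<bar>snd z'\<bar> \<le> R" if "(z, z') \<in> cball 0 R \<times> cball 0 R" for z z' :: "real \<times> real"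
    using that norm_snd_le[of "snd z'" "fst z'"] by auto
  show "\<bar>snd z - snd z'\<bar> \<le> 1 * dist z z'" for z z' :: "real \<times> real"
    using dist_snd_le[of z z'] by (simp add: dist_real_def)
qed

section \<open>The Hopf normal form\<close>

text \<open>A positive multiple of minus the first Lyapunov coefficient.\<close>
definition lyap1 :: "real \<Rightarrow> real \<Rightarrow> real \<Rightarrow> real" where
  "lyap1 m B D = 3 / 4 * D - B * (1 + 4 * m)"

text \<open>The parameter \<open>e\<close> is the scale of the blow-up \<open>(p, q) \<mapsto> (e p, e q)\<close> of the field with \<open>e = 1\<close>.\<close>
definition hopf_field :: "real \<Rightarrow> real \<Rightarrow> real \<Rightarrow> real \<Rightarrow> real \<Rightarrow> real \<times> real \<Rightarrow> real \<times> real" where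
  "hopf_field m B D \<mu> e = (\<lambda>(p, q). (- q * (1 + 4 * e * p) + \<mu> * p - B * e * p ^ 2 - D * e ^ 2 * p ^ 3,
     p * (1 + 8 * m * e * p + 16 * m * e ^ 2 * p ^ 2)))"

text \<open>\<open>V3\<close> to \<open>V6\<close> are the homogeneous terms of the Lyapunov function; the suffixes \<open>p\<close> and \<open>q\<close>
  mark partial derivatives. They solve the homological equations below.\<close>
definition V3 :: "real \<Rightarrow> real \<Rightarrow> real \<Rightarrow> real \<Rightarrow> real \<Rightarrow> real" where
  "V3 m B D p q = (16 * m - 8) / 3 * p ^ 3 + 2 * B * p ^ 2 * q + 4 / 3 * B * q ^ 3"

definition V3p :: "real \<Rightarrow> real \<Rightarrow> real \<Rightarrow> real \<Rightarrow> real \<Rightarrow> real" where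
  "V3p m B D p q = (16 * m - 8) * p ^ 2 + 4 * B * p * q"

definition V3q :: "real \<Rightarrow> real \<Rightarrow> real \<Rightarrow> real \<Rightarrow> real \<Rightarrow> real" where
  "V3q m B D p q = 2 * B * p ^ 2 + 4 * B * q ^ 2"

definition V4 :: "real \<Rightarrow> real \<Rightarrow> real \<Rightarrow> real \<Rightarrow> real \<Rightarrow> real" where
  "V4 m B D p q = (8 - 8 * m - B ^ 2) * p ^ 4 + (5 / 4 * D - 7 * B + 4 * B * m) * p ^ 3 * q
     + lyap1 m B D * p * q ^ 3"

definition V4p :: "real \<Rightarrow> real \<Rightarrow> real \<Rightarrow> real \<Rightarrow> real \<Rightarrow> real" where
  "V4p m B D p q = 4 * (8 - 8 * m - B ^ 2) * p ^ 3 + 3 * (5 / 4 * D - 7 * B + 4 * B * m) * p ^ 2 * q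
     + lyap1 m B D * q ^ 3"

definition V4q :: "real \<Rightarrow> real \<Rightarrow> real \<Rightarrow> real \<Rightarrow> real \<Rightarrow> real" where
  "V4q m B D p q = (5 / 4 * D - 7 * B + 4 * B * m) * p ^ 3 + 3 * lyap1 m B D * p * q ^ 2"

text \<open>Along the rotation p q has derivative p^2 - q^2. Subtracting k e^2 p q therefore turns
  the contribution 2 k e^2 p^2 of the damping mu = k e^2 into k e^2 (p^2 + q^2).\<close>

definition hopf_W :: "real \<Rightarrow> real \<Rightarrow> real \<Rightarrow> real \<Rightarrow> real \<Rightarrow> real \<Rightarrow> real" where
  "hopf_W m B D e p q = p ^ 2 + q ^ 2 + e * V3 m B D p q + e ^ 2 * (V4 m B D p q - lyap1 m B D * p * q)"

definition hopf_Wp :: "real \<Rightarrow> real \<Rightarrow> real \<Rightarrow> real \<Rightarrow> real \<Rightarrow> real \<Rightarrow> real" where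
  "hopf_Wp m B D e p q = 2 * p + e * V3p m B D p q + e ^ 2 * (V4p m B D p q - lyap1 m B D * q)"

definition hopf_Wq :: "real \<Rightarrow> real \<Rightarrow> real \<Rightarrow> real \<Rightarrow> real \<Rightarrow> real \<Rightarrow> real" where
  "hopf_Wq m B D e p q = 2 * q + e * V3q m B D p q + e ^ 2 * (V4q m B D p q - lyap1 m B D * p)"

text \<open>The remainder of order e^3 in \<open>hopf_W_dot\<close>. It is polynomial in e and in
  the parameters, so it is bounded uniformly on boxes.\<close>

definition hopf_N :: "real \<Rightarrow> real \<Rightarrow> real \<Rightarrow> real \<Rightarrow> real \<Rightarrow> real \<Rightarrow> real" where
  "hopf_N m B D e p q =
     (V4p m B D p q - lyap1 m B D * q) * (- 4 * p * q - B * p ^ 2) + (V4q m B D p q - lyap1 m B D * p) * (8 * m * p ^ 2)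
     + V3p m B D p q * (lyap1 m B D * p - D * p ^ 3) + V3q m B D p q * (16 * m * p ^ 3)
     + e * ((V4p m B D p q - lyap1 m B D * q) * (lyap1 m B D * p - D * p ^ 3)
        + (V4q m B D p q - lyap1 m B D * p) * (16 * m * p ^ 3))"

lemmas V_defs = V3_def V3p_def V3q_def V4_def V4p_def V4q_def
lemmas hopf_W_defs = hopf_W_def hopf_Wp_def hopf_Wq_def

lemma hopf_W_derivative:
  "((\<lambda>z. hopf_W m B D e (fst z) (snd z)) has_derivative
     (\<lambda>d. hopf_Wp m B D e p q * fst d + hopf_Wq m B D e p q * snd d)) (at (p, q))"
  unfolding hopf_W_defs V_defs
  by (rule derivative_eq_intros refl | simp)+ (auto simp: fun_eq_iff field_simps power2_eq_square power3_eq_cube)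

text \<open>Order 0 in e cancels because p^2 + q^2 is invariant under rotation, order 1 by the
  choice of \<open>V3\<close>. At order 2 the term \<open>V4\<close> makes the quartic part, and the
  p q correction the quadratic part, constant on circles.\<close>

lemma hopf_W_dot:
  assumes "k = lyap1 m B D"
  shows "hopf_Wp m B D e p q * fst (hopf_field m B D (k * e ^ 2) e (p, q))
     + hopf_Wq m B D e p q * snd (hopf_field m B D (k * e ^ 2) e (p, q))
   = e ^ 2 * (k * (p ^ 2 + q ^ 2) - k * (p ^ 2 + q ^ 2) ^ 2) + e ^ 3 * hopf_N m B D e p q"
  unfolding hopf_N_def hopf_W_defs V_defs hopf_field_def assms lyap1_def
  by (simp add: power2_eq_square power3_eq_cube) algebra


section \<open>Transfer along an affine conjugacy\<close>

text \<open>The factor \<omega> is a constant change of time. Keeping chart and model field as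
  parameters lets rescaling and time reversal act on the same notion while \<open>p0\<close> stays
  fixed.\<close>

locale affine_conj =
  fixes f :: "real \<times> real \<Rightarrow> real \<times> real" and p0 :: "real \<times> real"
    and L Linv :: "real \<times> real \<Rightarrow> real \<times> real" and h :: "real \<times> real \<Rightarrow> real \<times> real" and \<omega> :: real
  assumes lip: "lipschitz_on_balls f"
    and L: "bounded_linear L" "bounded_linear Linv" "\<And>z. L (Linv z) = z" "\<And>z. Linv (L z) = z"
    and \<omega>: "\<omega> > 0"
    and conj: "\<And>z. f (p0 + L z) = \<omega> *\<^sub>R L (h z)"
begin

lemma lyapunov_function_conj:
  fixes W :: "real \<times> real \<Rightarrow> real"
  assumes dW: "\<And>p q. (W has_derivative (\<lambda>d. Wp p q * fst d + Wq p q * snd d)) (at (p, q))"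
    and Wd: "\<And>p q. Wd (p, q) = Wp p q * fst (h (p, q)) + Wq p q * snd (h (p, q))"
    and contWd: "continuous_on UNIV Wd" and W0: "W 0 = 0" and h0: "h 0 = 0"
    and r: "r > 0" and pos: "\<And>z. norm z \<le> r \<Longrightarrow> z \<noteq> 0 \<Longrightarrow> W z > 0"
  obtains r' where "lyapunov_function f p0 (\<lambda>z. W (Linv (z - p0))) (\<lambda>z. \<omega> * Wd (Linv (z - p0))) r'"
    "\<forall>z\<in>cball p0 r'. z \<noteq> p0 \<longrightarrow> norm (Linv (z - p0)) \<le> r \<and> Linv (z - p0) \<noteq> 0"
proof -
  obtain K where K: "K > 0" "\<And>z. norm (Linv z) \<le> norm z * K" using bounded_linear.pos_bounded[OF L(2)] by blast
  define r' where "r' = r / K"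
  have cLi: "continuous_on UNIV (\<lambda>z. Linv (z - p0))"
    by (intro continuous_on_compose2[OF linear_continuous_on[OF L(2), of UNIV]] continuous_intros) auto
  have contW: "continuous_on UNIV W"
    using dW has_derivative_continuous continuous_at_imp_continuous_on by (metis surj_pair)
  have near: "norm (Linv (z - p0)) \<le> r" "Linv (z - p0) \<noteq> 0" if "z \<in> cball p0 r'" "z \<noteq> p0" for z
  proof -
    have "norm (Linv (z - p0)) \<le> norm (z - p0) * K" by (rule K)
    also have "\<dots> \<le> r' * K" using that K by (intro mult_right_mono) (auto simp: dist_norm norm_minus_commute)
    also have "\<dots> = r" using K by (simp add: r'_def)
    finally show "norm (Linv (z - p0)) \<le> r" .
    show "Linv (z - p0) \<noteq> 0"
    proof
      assume "Linv (z - p0) = 0"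
      then have "z - p0 = L 0" using L(3) by metis
      then show False using that(2) by (simp add: linear_0 bounded_linear.linear[OF L(1)])
    qed
  qed
  have "lyapunov_function f p0 (\<lambda>z. W (Linv (z - p0))) (\<lambda>z. \<omega> * Wd (Linv (z - p0))) r'"
  proof
    show "f p0 = 0" using conj[of 0] h0 linear_0[OF bounded_linear.linear[OF L(1)]] by simp
    show "lipschitz_on_balls f" by (rule lip)
    show "r' > 0" using r K by (simp add: r'_def)
    show "continuous_on UNIV (\<lambda>z. W (Linv (z - p0)))" by (rule continuous_on_compose2[OF contW cLi]) auto
    show "continuous_on UNIV (\<lambda>z. \<omega> * Wd (Linv (z - p0)))"
      by (intro continuous_intros continuous_on_compose2[OF contWd cLi]) auto
    show "W (Linv (p0 - p0)) = 0" using W0 linear_0[OF bounded_linear.linear[OF L(2)]] by simp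
    show "W (Linv (z - p0)) > 0" if "z \<in> cball p0 r'" "z \<noteq> p0" for z using near[OF that] by (rule pos)
    show "((\<lambda>t. W (Linv (\<phi> t - p0))) has_real_derivative \<omega> * Wd (Linv (\<phi> t - p0))) (at t within I)"
      if "(\<phi> has_vector_derivative f (\<phi> t)) (at t within I)" for \<phi> t I
    proof -
      define z where "z = (\<lambda>t. Linv (\<phi> t - p0))"
      obtain p q where pq: "z t = (p, q)" by force
      have "((\<lambda>t. \<phi> t - p0) has_vector_derivative f (\<phi> t)) (at t within I)"
        using that by (auto intro!: derivative_eq_intros)
      from bounded_linear.has_vector_derivative[OF L(2) this]
      have "(z has_vector_derivative Linv (f (\<phi> t))) (at t within I)" by (simp add: z_def)
      also have "Linv (f (\<phi> t)) = \<omega> *\<^sub>R h (z t)"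
        using conj[of "z t"] by (simp add: z_def L linear_scale bounded_linear.linear[OF L(2)])
      finally have dz: "(z has_vector_derivative \<omega> *\<^sub>R h (z t)) (at t within I)" .
      have "(W has_derivative (\<lambda>d. Wp p q * fst d + Wq p q * snd d)) (at (z t) within z ` I)"
        unfolding pq by (rule has_derivative_at_withinI[OF dW])
      from vector_derivative_diff_chain_within[OF dz this]
      have "((\<lambda>t. W (z t)) has_real_derivative \<omega> * Wd (z t)) (at t within I)"
        unfolding has_real_derivative_iff_has_vector_derivative o_def by (simp add: pq Wd algebra_simps)
      then show ?thesis by (simp add: z_def)
    qed
  qed
  then show ?thesis using that near by blast
qed

lemma asymptotically_stable_conj:
  fixes W :: "real \<times> real \<Rightarrow> real"
  assumes dW: "\<And>p q. (W has_derivative (\<lambda>d. Wp p q * fst d + Wq p q * snd d)) (at (p, q))"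
    and Wd: "\<And>p q. Wd (p, q) = Wp p q * fst (h (p, q)) + Wq p q * snd (h (p, q))"
    and contWd: "continuous_on UNIV Wd" and W0: "W 0 = 0" and h0: "h 0 = 0"
    and r: "r > 0" and pos: "\<And>z. norm z \<le> r \<Longrightarrow> z \<noteq> 0 \<Longrightarrow> W z > 0"
    and neg: "\<And>z. norm z \<le> r \<Longrightarrow> z \<noteq> 0 \<Longrightarrow> Wd z < 0"
  shows "asymptotically_stable f p0"
proof -
  obtain r' where r': "lyapunov_function f p0 (\<lambda>z. W (Linv (z - p0))) (\<lambda>z. \<omega> * Wd (Linv (z - p0))) r'"
    "\<forall>z\<in>cball p0 r'. z \<noteq> p0 \<longrightarrow> norm (Linv (z - p0)) \<le> r \<and> Linv (z - p0) \<noteq> 0"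
    using lyapunov_function_conj[OF dW Wd contWd W0 h0 r pos] by metis
  show ?thesis
  proof (rule lyapunov_function.asymptotically_stable[OF r'(1)])
    fix z assume "z \<in> cball p0 r'" "z \<noteq> p0"
    then show "\<omega> * Wd (Linv (z - p0)) < 0" using r'(2) neg[of "Linv (z - p0)"] \<omega> by (simp add: mult_pos_neg)
  qed
qed

lemma unstable_conj:
  fixes W :: "real \<times> real \<Rightarrow> real"
  assumes dW: "\<And>p q. (W has_derivative (\<lambda>d. Wp p q * fst d + Wq p q * snd d)) (at (p, q))"
    and Wd: "\<And>p q. Wd (p, q) = Wp p q * fst (h (p, q)) + Wq p q * snd (h (p, q))"
    and contWd: "continuous_on UNIV Wd" and W0: "W 0 = 0" and h0: "h 0 = 0"
    and r: "r > 0" and pos: "\<And>z. norm z \<le> r \<Longrightarrow> z \<noteq> 0 \<Longrightarrow> W z > 0"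
    and Wd_pos: "\<And>z. norm z \<le> r \<Longrightarrow> z \<noteq> 0 \<Longrightarrow> Wd z > 0"
  shows "unstable f p0"
proof -
  obtain r' where r': "lyapunov_function f p0 (\<lambda>z. W (Linv (z - p0))) (\<lambda>z. \<omega> * Wd (Linv (z - p0))) r'"
    "\<forall>z\<in>cball p0 r'. z \<noteq> p0 \<longrightarrow> norm (Linv (z - p0)) \<le> r \<and> Linv (z - p0) \<noteq> 0"
    using lyapunov_function_conj[OF dW Wd contWd W0 h0 r pos] by metis
  show ?thesis
  proof (rule lyapunov_function.unstable[OF r'(1)])
    fix z assume "z \<in> cball p0 r'" "z \<noteq> p0"
    then show "\<omega> * Wd (Linv (z - p0)) > 0" using r'(2) Wd_pos[of "Linv (z - p0)"] \<omega> by simp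
  qed
qed

end

section \<open>The bifurcating cycle\<close>

text \<open>For \<open>hopf_field\<close> with \<open>\<mu> = k e\<^sup>2\<close> at \<open>(\<rho> c, \<rho> s)\<close>, where \<open>c\<close>, \<open>s\<close> are the cosine and the sine of \<open>\<theta>\<close>:
  the angular speed is \<open>1 + e H\<close>, the radial speed \<open>R\<close>, \<open>d\<rho>/d\<theta> = S\<close>,
  \<open>W = \<rho>\<^sup>2 + e G\<close> and \<open>dW/d\<theta> = e\<^sup>2 (k (\<rho>\<^sup>2 - \<rho>\<^sup>4) + e Q)\<close>.\<close>
definition pol_H :: "real \<Rightarrow> real \<Rightarrow> real \<Rightarrow> real \<Rightarrow> real \<Rightarrow> real \<Rightarrow> real \<Rightarrow> real" where
  "pol_H m B D e \<rho> c s = 8 * m * \<rho> * c ^ 3 + 4 * \<rho> * s ^ 2 * c + B * \<rho> * c ^ 2 * s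
     + e * (16 * m * \<rho> ^ 2 * c ^ 4 - lyap1 m B D * c * s + D * \<rho> ^ 2 * c ^ 3 * s)"

definition pol_R :: "real \<Rightarrow> real \<Rightarrow> real \<Rightarrow> real \<Rightarrow> real \<Rightarrow> real \<Rightarrow> real \<Rightarrow> real" where
  "pol_R m B D e \<rho> c s = e * \<rho> ^ 2 * (8 * m * c ^ 2 * s - 4 * c ^ 2 * s - B * c ^ 3)
     + e ^ 2 * (lyap1 m B D * \<rho> * c ^ 2 - D * \<rho> ^ 3 * c ^ 4 + 16 * m * \<rho> ^ 3 * c ^ 3 * s)"

definition pol_G :: "real \<Rightarrow> real \<Rightarrow> real \<Rightarrow> real \<Rightarrow> real \<Rightarrow> real \<Rightarrow> real \<Rightarrow> real" where
  "pol_G m B D e \<rho> c s = V3 m B D (\<rho> * c) (\<rho> * s)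
     + e * (V4 m B D (\<rho> * c) (\<rho> * s) - lyap1 m B D * (\<rho> * c) * (\<rho> * s))"

definition pol_Q :: "real \<Rightarrow> real \<Rightarrow> real \<Rightarrow> real \<Rightarrow> real \<Rightarrow> real \<Rightarrow> real \<Rightarrow> real" where
  "pol_Q m B D e \<rho> c s = (hopf_N m B D e (\<rho> * c) (\<rho> * s)
     - lyap1 m B D * (\<rho> ^ 2 - \<rho> ^ 4) * pol_H m B D e \<rho> c s) * inverse (1 + e * pol_H m B D e \<rho> c s)"

definition pol_S :: "real \<Rightarrow> real \<Rightarrow> real \<Rightarrow> real \<Rightarrow> real \<Rightarrow> real \<Rightarrow> real \<Rightarrow> real" where
  "pol_S m B D e \<rho> c s = pol_R m B D e \<rho> c s * inverse (1 + e * pol_H m B D e \<rho> c s)"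

lemma hopf_field_polar:
  fixes m B D e k \<rho> c s :: real
  assumes "c\<^sup>2 + s\<^sup>2 = 1" and k: "k = lyap1 m B D"
  defines "\<Theta> \<equiv> 1 + e * pol_H m B D e \<rho> c s" and "R \<equiv> pol_R m B D e \<rho> c s"
  shows "hopf_field m B D (k * e ^ 2) e (\<rho> * c, \<rho> * s) = (R * c - \<Theta> * \<rho> * s, R * s + \<Theta> * \<rho> * c)"
proof -
  obtain fp fq where fpq: "hopf_field m B D (k * e ^ 2) e (\<rho> * c, \<rho> * s) = (fp, fq)" by force
  have fp: "fp = - (\<rho> * s) * (1 + 4 * e * (\<rho> * c)) + k * e ^ 2 * (\<rho> * c) - B * e * (\<rho> * c) ^ 2 - D * e ^ 2 * (\<rho> * c) ^ 3"
    and fq: "fq = (\<rho> * c) * (1 + 8 * m * e * (\<rho> * c) + 16 * m * e ^ 2 * (\<rho> * c) ^ 2)"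
    using fpq by (auto simp: hopf_field_def)
  have R: "R = c * fp + s * fq"
    unfolding R_def pol_R_def fp fq k by (simp add: power2_eq_square power3_eq_cube power4_eq_xxxx) algebra
  \<comment> \<open>The constant 1 in \<Theta> equals c^2 + s^2 only on the unit circle; the added
    defect makes the equation a polynomial identity in independent c and s.\<close>
  have T: "\<Theta> * \<rho> = (c * fq - s * fp) + \<rho> * (1 - (c\<^sup>2 + s\<^sup>2))"
    unfolding \<Theta>_def pol_H_def fp fq k by (simp add: power2_eq_square power3_eq_cube power4_eq_xxxx) algebra
  then have T: "\<Theta> * \<rho> = c * fq - s * fp" using assms(1) by simp
  have "R * c - \<Theta> * \<rho> * s = fp * (c\<^sup>2 + s\<^sup>2)" "R * s + \<Theta> * \<rho> * c = fq * (c\<^sup>2 + s\<^sup>2)"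
    unfolding R T by (simp_all add: algebra_simps power2_eq_square)
  then show ?thesis using assms(1) fpq by simp
qed

lemma hopf_W_polar:
  assumes "c\<^sup>2 + s\<^sup>2 = 1"
  shows "hopf_W m B D e (\<rho> * c) (\<rho> * s) = \<rho>\<^sup>2 + e * pol_G m B D e \<rho> c s"
proof -
  have "(\<rho> * c) ^ 2 + (\<rho> * s) ^ 2 = \<rho>\<^sup>2" by (simp add: power_mult_distrib assms flip: distrib_left)
  then show ?thesis
    by (simp add: hopf_W_def pol_G_def) (simp add: algebra_simps power2_eq_square)
qed

text \<open>Cosine and sine are relaxed to independent numbers in {-1..1}, which reduces uniform
  bounds to a box. The two points of a pair share everything except the radius.\<close>

definition pol_pairs :: "real \<Rightarrow> real \<Rightarrow>
    ((real \<times> real \<times> real \<times> real \<times> real \<times> real \<times> real) \<times> real \<times> real \<times> real \<times> real \<times> real \<times> real \<times> real) set" where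
  "pol_pairs R E = {((\<rho>, w), (\<rho>', w)) | \<rho> \<rho>' w. \<rho> \<in> {0..2} \<and> \<rho>' \<in> {0..2} \<and>
     w \<in> {-R..R} \<times> {-R..R} \<times> {-R..R} \<times> {0..E} \<times> {-1..1} \<times> {-1..1}}"

lemma bl_pol_pairs:
  shows "bl (pol_pairs R E) fst"
    "bl (pol_pairs R E) (\<lambda>z. fst (snd z))" "bl (pol_pairs R E) (\<lambda>z. fst (snd (snd z)))"
    "bl (pol_pairs R E) (\<lambda>z. fst (snd (snd (snd z))))" "bl (pol_pairs R E) (\<lambda>z. fst (snd (snd (snd (snd z)))))"
    "bl (pol_pairs R E) (\<lambda>z. fst (snd (snd (snd (snd (snd z))))))"
    "bl (pol_pairs R E) (\<lambda>z. snd (snd (snd (snd (snd (snd z))))))"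
  by (rule blI[of _ _ "max 2 (max \<bar>R\<bar> (max \<bar>E\<bar> 1))" 1];
      force simp: pol_pairs_def dist_Pair_Pair dist_real_def)+

text \<open>The arguments of \<^term>\<open>F\<close> are \<open>m B D e \<rho> c s\<close>; the constant is uniform in all of them.\<close>
definition pol_unif :: "real \<Rightarrow> real \<Rightarrow> real \<Rightarrow> (real \<Rightarrow> real \<Rightarrow> real \<Rightarrow> real \<Rightarrow> real \<Rightarrow> real \<Rightarrow> real \<Rightarrow> real) \<Rightarrow> bool" where
  "pol_unif R E M F \<longleftrightarrow> (\<forall>m B D e \<rho> \<rho>' c s. \<bar>m\<bar> \<le> R \<longrightarrow> \<bar>B\<bar> \<le> R \<longrightarrow> \<bar>D\<bar> \<le> R \<longrightarrow> 0 \<le> e \<longrightarrow> e \<le> E \<longrightarrow>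
     \<rho> \<in> {0..2} \<longrightarrow> \<rho>' \<in> {0..2} \<longrightarrow> \<bar>c\<bar> \<le> 1 \<longrightarrow> \<bar>s\<bar> \<le> 1 \<longrightarrow>
     \<bar>F m B D e \<rho> c s\<bar> \<le> M \<and> \<bar>F m B D e \<rho>' c s - F m B D e \<rho> c s\<bar> \<le> M * \<bar>\<rho>' - \<rho>\<bar>)"

abbreviation pol_apply where
  "pol_apply F \<equiv> (\<lambda>z. F (fst (snd z)) (fst (snd (snd z))) (fst (snd (snd (snd z)))) (fst (snd (snd (snd (snd z)))))
     (fst z) (fst (snd (snd (snd (snd (snd z)))))) (snd (snd (snd (snd (snd (snd z)))))))"

lemma bl_pol_unif:
  assumes "bl (pol_pairs R E) (pol_apply F)"
  obtains M where "M \<ge> 0" "pol_unif R E M F"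
proof -
  obtain M where M: "M \<ge> 0" "\<forall>z z'. (z, z') \<in> pol_pairs R E \<longrightarrow> \<bar>pol_apply F z\<bar> \<le> M \<and> \<bar>pol_apply F z'\<bar> \<le> M \<and>
      \<bar>pol_apply F z - pol_apply F z'\<bar> \<le> M * dist z z'"
    using assms by (rule blE)
  have "pol_unif R E M F"
    unfolding pol_unif_def
  proof (intro allI impI)
    fix m B D e \<rho> \<rho>' c s :: real
    assume *: "\<bar>m\<bar> \<le> R" "\<bar>B\<bar> \<le> R" "\<bar>D\<bar> \<le> R" "0 \<le> e" "e \<le> E" "\<rho> \<in> {0..2}" "\<rho>' \<in> {0..2}" "\<bar>c\<bar> \<le> 1" "\<bar>s\<bar> \<le> 1"
    let ?w = "(m, B, D, e, c, s)"
    have in': "((\<rho>', ?w), (\<rho>, ?w)) \<in> pol_pairs R E" using * by (auto simp: pol_pairs_def)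
    show "\<bar>F m B D e \<rho> c s\<bar> \<le> M \<and> \<bar>F m B D e \<rho>' c s - F m B D e \<rho> c s\<bar> \<le> M * \<bar>\<rho>' - \<rho>\<bar>"
      using M(2)[rule_format, OF in'] by (simp add: dist_Pair_Pair dist_real_def)
  qed
  then show ?thesis using that M(1) by blast
qed

lemma bl_pol_H: "bl (pol_pairs R E) (pol_apply pol_H)"
  unfolding pol_H_def lyap1_def by (intro bl_intros bl_pol_pairs)

lemma bl_pol_R: "bl (pol_pairs R E) (pol_apply pol_R)"
  unfolding pol_R_def lyap1_def by (intro bl_intros bl_pol_pairs)

lemma bl_pol_G: "bl (pol_pairs R E) (pol_apply pol_G)"
  unfolding pol_G_def V_defs lyap1_def by (intro bl_intros bl_pol_pairs)

lemma bl_hopf_N: "bl (pol_pairs R E) (pol_apply (\<lambda>m B D e \<rho> c s. hopf_N m B D e (\<rho> * c) (\<rho> * s)))"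
  unfolding hopf_N_def V_defs lyap1_def by (intro bl_intros bl_pol_pairs)


text \<open>The threshold \<open>e0\<close> depends on R and \<open>k0\<close> alone. This
  uniformity is what later turns a cycle for small e into a neighbourhood in the parameter
  plane.\<close>

lemma hopf_cycle:
  fixes R k0 :: real
  assumes k0: "k0 > 0"
  obtains e0 where "e0 > 0"
    "\<And>f p0 L Linv \<omega> m B D k e. affine_conj f p0 L Linv (hopf_field m B D (k * e ^ 2) e) \<omega> \<Longrightarrow>
       k = lyap1 m B D \<Longrightarrow> k0 \<le> k \<Longrightarrow> \<bar>m\<bar> \<le> R \<Longrightarrow> \<bar>B\<bar> \<le> R \<Longrightarrow> \<bar>D\<bar> \<le> R \<Longrightarrow> 0 < e \<Longrightarrow> e \<le> e0 \<Longrightarrow>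
       \<exists>\<Gamma>. stable_limit_cycle f \<Gamma> \<and> surrounds \<Gamma> p0"
proof -
  obtain MH where MH: "MH \<ge> 0" "pol_unif R 1 MH pol_H" using bl_pol_H by (rule bl_pol_unif)
  \<comment> \<open>This bound gives |e H| <= 1/2, so the angular speed lies between 1/2 and 3/2 and
    its inverse stays bounded.\<close>
  define E where "E = 1 / (2 * (MH + 1))"
  have E: "E > 0" "E \<le> 1" using MH(1) by (auto simp: E_def field_simps)
  have eH: "\<bar>e * pol_H m B D e \<rho> c s\<bar> \<le> 1 / 2"
    if "\<bar>m\<bar> \<le> R" "\<bar>B\<bar> \<le> R" "\<bar>D\<bar> \<le> R" "0 \<le> e" "e \<le> E" "\<rho> \<in> {0..2}" "\<bar>c\<bar> \<le> 1" "\<bar>s\<bar> \<le> 1" for m B D e \<rho> c s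
  proof -
    have "\<bar>pol_H m B D e \<rho> c s\<bar> \<le> MH"
      using MH(2)[unfolded pol_unif_def, rule_format, of m B D e \<rho> \<rho> c s] that E(2) by simp
    then have "\<bar>e * pol_H m B D e \<rho> c s\<bar> \<le> E * (MH + 1)"
      unfolding abs_mult using that MH(1) by (intro mult_mono) auto
    also have "\<dots> = 1 / 2" using MH(1) by (simp add: E_def)
    finally show ?thesis .
  qed
  have inv: "bl (pol_pairs R E) (pol_apply (\<lambda>m B D e \<rho> c s. inverse (1 + e * pol_H m B D e \<rho> c s)))"
  proof (rule bl_inverse)
    show "bl (pol_pairs R E) (pol_apply (\<lambda>m B D e \<rho> c s. 1 + e * pol_H m B D e \<rho> c s))"
      by (intro bl_intros bl_pol_pairs bl_pol_H)
    show "1 / 2 \<le> pol_apply (\<lambda>m B D e \<rho> c s. 1 + e * pol_H m B D e \<rho> c s) z"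
      "1 / 2 \<le> pol_apply (\<lambda>m B D e \<rho> c s. 1 + e * pol_H m B D e \<rho> c s) z'"
      if zz: "(z, z') \<in> pol_pairs R E" for z z'
    proof -
      obtain \<rho> \<rho>' m B D e c s where z: "z = (\<rho>, m, B, D, e, c, s)" "z' = (\<rho>', m, B, D, e, c, s)"
        and b: "\<bar>m\<bar> \<le> R" "\<bar>B\<bar> \<le> R" "\<bar>D\<bar> \<le> R" "0 \<le> e" "e \<le> E" "\<rho> \<in> {0..2}" "\<rho>' \<in> {0..2}" "\<bar>c\<bar> \<le> 1" "\<bar>s\<bar> \<le> 1"
        using zz by (auto simp: pol_pairs_def abs_le_iff)
      show "1 / 2 \<le> pol_apply (\<lambda>m B D e \<rho> c s. 1 + e * pol_H m B D e \<rho> c s) z"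
        using eH[OF b(1-6) b(8,9)] by (simp add: z abs_le_iff)
      show "1 / 2 \<le> pol_apply (\<lambda>m B D e \<rho> c s. 1 + e * pol_H m B D e \<rho> c s) z'"
        using eH[OF b(1-5,7-9)] by (simp add: z abs_le_iff)
    qed
  qed simp
  obtain MG where MG: "MG \<ge> 0" "pol_unif R E MG pol_G" using bl_pol_G by (rule bl_pol_unif)
  have "bl (pol_pairs R E) (pol_apply pol_Q)"
    unfolding pol_Q_def lyap1_def by (intro bl_intros bl_pol_pairs bl_hopf_N bl_pol_H inv)
  then obtain MQ where MQ: "MQ \<ge> 0" "pol_unif R E MQ pol_Q" by (rule bl_pol_unif)
  have "bl (pol_pairs R E) (pol_apply pol_S)"
    unfolding pol_S_def by (intro bl_intros bl_pol_pairs bl_pol_R inv)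
  then obtain MS where MS: "MS \<ge> 0" "pol_unif R E MS pol_S" by (rule bl_pol_unif)
  \<comment> \<open>The outcome is |e G| <= 1/100 and |e Q| <= k / 10, and the same bounds hold for
    the Lipschitz constants in the radius. The value 1/10 is below the margins 0.1501 at the inner
    level curve and 1.9701 at the outer one, and it leaves 56/125 - 1/10 >= 1/4 for the
    contraction.\<close>
  define e0 where "e0 = min E (min (1 / (100 * (MG + 1))) (k0 / (10 * (MQ + 1))))"
  have e0: "e0 > 0" "e0 \<le> E" "e0 \<le> 1 / (100 * (MG + 1))" "e0 \<le> k0 / (10 * (MQ + 1))"
    using E k0 MG(1) MQ(1) by (auto simp: e0_def)
  show ?thesis
  proof (rule that[OF e0(1)])
    fix f p0 L Linv \<omega> m B D k e
    assume conj: "affine_conj f p0 L Linv (hopf_field m B D (k * e ^ 2) e) \<omega>" and k: "k = lyap1 m B D"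
      and kk: "k0 \<le> k" and par: "\<bar>m\<bar> \<le> R" "\<bar>B\<bar> \<le> R" "\<bar>D\<bar> \<le> R" and e: "0 < e" "e \<le> e0"
    interpret affine_conj f p0 L Linv "hopf_field m B D (k * e ^ 2) e" \<omega> by (rule conj)
    have eE: "0 \<le> e" "e \<le> E" using e e0 by auto
    have kpos: "k > 0" using k0 kk by simp
    have eG: "e * MG \<le> 1 / 100"
    proof -
      have "e * MG \<le> 1 / (100 * (MG + 1)) * (MG + 1)" using e e0(3) MG(1) by (intro mult_mono) auto
      also have "\<dots> = 1 / 100" using MG(1) by (simp add: divide_simps)
      finally show ?thesis .
    qed
    have eQ: "e * MQ \<le> k / 10"
    proof -
      have "e * MQ \<le> k0 / (10 * (MQ + 1)) * (MQ + 1)" using e e0(4) MQ(1) k0 by (intro mult_mono) auto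
      also have "\<dots> = k0 / 10" using MQ(1) by (simp add: divide_simps)
      finally show ?thesis using kk by simp
    qed
    define H where "H = (\<lambda>\<rho> \<theta>. pol_H m B D e \<rho> (cos \<theta>) (sin \<theta>))"
    define G where "G = (\<lambda>\<rho> \<theta>. pol_G m B D e \<rho> (cos \<theta>) (sin \<theta>))"
    define Q where "Q = (\<lambda>\<rho> \<theta>. pol_Q m B D e \<rho> (cos \<theta>) (sin \<theta>))"
    define S where "S = (\<lambda>\<rho> \<theta>. pol_S m B D e \<rho> (cos \<theta>) (sin \<theta>))"
    define T where "T = (\<lambda>\<rho> \<theta>. e\<^sup>2 * (k * (\<rho>\<^sup>2 - \<rho> ^ 4) + e * Q \<rho> \<theta>))"
    define W where "W = (\<lambda>z. hopf_W m B D e (fst z) (snd z))"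
    have Hb: "1 / 2 \<le> 1 + e * H \<rho> \<theta> \<and> 1 + e * H \<rho> \<theta> \<le> 3 / 2" if "\<rho> \<in> {0..2}" for \<rho> \<theta>
      using eH[OF par eE that, of "cos \<theta>" "sin \<theta>"] unfolding H_def abs_le_iff by simp
    have unif: "\<bar>F m B D e \<rho> (cos \<theta>) (sin \<theta>)\<bar> \<le> M"
      "\<bar>F m B D e \<rho>' (cos \<theta>) (sin \<theta>) - F m B D e \<rho> (cos \<theta>) (sin \<theta>)\<bar> \<le> M * \<bar>\<rho>' - \<rho>\<bar>"
      if "pol_unif R E M F" "\<rho> \<in> {0..2}" "\<rho>' \<in> {0..2}" for F M \<rho> \<rho>' \<theta>
      using that(1)[unfolded pol_unif_def, rule_format, of m B D e \<rho> \<rho>' "cos \<theta>" "sin \<theta>"] par eE that(2,3) by auto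
    have Gb: "\<bar>e * G \<rho> \<theta>\<bar> \<le> 1 / 100" if "\<rho> \<in> {0..2}" for \<rho> \<theta>
    proof -
      have "\<bar>e * G \<rho> \<theta>\<bar> \<le> e * MG"
        unfolding abs_mult using unif(1)[OF MG(2) that that] e(1) by (auto simp: G_def intro!: mult_left_mono)
      then show ?thesis using eG by simp
    qed
    have Gl: "\<bar>e * G \<rho>' \<theta> - e * G \<rho> \<theta>\<bar> \<le> 1 / 100 * \<bar>\<rho>' - \<rho>\<bar>" if "\<rho> \<in> {0..2}" "\<rho>' \<in> {0..2}" for \<rho> \<rho>' \<theta>
    proof -
      have "\<bar>e * G \<rho>' \<theta> - e * G \<rho> \<theta>\<bar> = e * \<bar>G \<rho>' \<theta> - G \<rho> \<theta>\<bar>"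
        using e(1) by (simp add: abs_mult flip: right_diff_distrib)
      also have "\<dots> \<le> e * (MG * \<bar>\<rho>' - \<rho>\<bar>)"
        using unif(2)[OF MG(2) that] e(1) by (intro mult_left_mono) (auto simp: G_def)
      also have "\<dots> \<le> 1 / 100 * \<bar>\<rho>' - \<rho>\<bar>" using mult_right_mono[OF eG, of "\<bar>\<rho>' - \<rho>\<bar>"] by (simp add: mult_ac)
      finally show ?thesis .
    qed
    have Qb: "\<bar>e * Q \<rho> \<theta>\<bar> \<le> k / 10" if "\<rho> \<in> {0..2}" for \<rho> \<theta>
    proof -
      have "\<bar>e * Q \<rho> \<theta>\<bar> \<le> e * MQ"
        unfolding abs_mult using unif(1)[OF MQ(2) that that] e(1) by (auto simp: Q_def intro!: mult_left_mono)
      then show ?thesis using eQ by simp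
    qed
    have Ql: "\<bar>e * Q \<rho>' \<theta> - e * Q \<rho> \<theta>\<bar> \<le> k / 10 * \<bar>\<rho>' - \<rho>\<bar>" if "\<rho> \<in> {0..2}" "\<rho>' \<in> {0..2}" for \<rho> \<rho>' \<theta>
    proof -
      have "\<bar>e * Q \<rho>' \<theta> - e * Q \<rho> \<theta>\<bar> = e * \<bar>Q \<rho>' \<theta> - Q \<rho> \<theta>\<bar>"
        using e(1) by (simp add: abs_mult flip: right_diff_distrib)
      also have "\<dots> \<le> e * (MQ * \<bar>\<rho>' - \<rho>\<bar>)"
        using unif(2)[OF MQ(2) that] e(1) by (intro mult_left_mono) (auto simp: Q_def)
      also have "\<dots> \<le> k / 10 * \<bar>\<rho>' - \<rho>\<bar>" using mult_right_mono[OF eQ, of "\<bar>\<rho>' - \<rho>\<bar>"] by (simp add: mult_ac)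
      finally show ?thesis .
    qed
    have WG: "W (\<rho> * cos \<theta>, \<rho> * sin \<theta>) = \<rho>\<^sup>2 + e * G \<rho> \<theta>" for \<rho> \<theta>
      unfolding W_def G_def by (simp add: hopf_W_polar)
    have sub: "\<rho> \<in> {0..2}" if "\<rho> \<in> {4/5..3/2::real}" for \<rho> using that by auto
    have hf: "hopf_field m B D (k * e\<^sup>2) e (\<rho> * cos \<theta>, \<rho> * sin \<theta>) =
        (1 + e * H \<rho> \<theta>) *\<^sub>R (S \<rho> \<theta> *\<^sub>R (cos \<theta>, sin \<theta>) + \<rho> *\<^sub>R (- sin \<theta>, cos \<theta>))"
      if "\<rho> \<in> {0..2}" for \<rho> \<theta>
    proof -
      have "pol_R m B D e \<rho> (cos \<theta>) (sin \<theta>) = (1 + e * H \<rho> \<theta>) * S \<rho> \<theta>"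
        using Hb[OF that, of \<theta>] unfolding S_def pol_S_def H_def by (simp add: field_simps)
      then show ?thesis
        using hopf_field_polar[of "cos \<theta>" "sin \<theta>" k m B D e \<rho>] k unfolding H_def by (simp add: algebra_simps)
    qed
    have dW: "((\<lambda>\<theta>. W (r \<theta> * cos \<theta>, r \<theta> * sin \<theta>)) has_real_derivative T (r \<theta>) \<theta>) (at \<theta>)"
      if r: "(r has_real_derivative S (r \<theta>) \<theta>) (at \<theta>)" "r \<theta> \<in> {4/5..3/2}" for r \<theta>
    proof -
      define p q where "p = r \<theta> * cos \<theta>" and "q = r \<theta> * sin \<theta>"
      define p' q' where "p' = S (r \<theta>) \<theta> * cos \<theta> - r \<theta> * sin \<theta>" and "q' = S (r \<theta>) \<theta> * sin \<theta> + r \<theta> * cos \<theta>"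
      define \<Theta> where "\<Theta> = 1 + e * H (r \<theta>) \<theta>"
      have \<Theta>: "\<Theta> > 0" using Hb[OF sub[OF r(2)], of \<theta>] by (simp add: \<Theta>_def)
      have "((\<lambda>\<theta>. r \<theta> * cos \<theta>) has_vector_derivative p') (at \<theta>)" "((\<lambda>\<theta>. r \<theta> * sin \<theta>) has_vector_derivative q') (at \<theta>)"
        unfolding has_real_derivative_iff_has_vector_derivative[symmetric] p'_def q'_def
        by (rule derivative_eq_intros r(1) refl | simp)+
      then have d: "((\<lambda>\<theta>. (r \<theta> * cos \<theta>, r \<theta> * sin \<theta>)) has_vector_derivative (p', q')) (at \<theta>)"
        by (rule has_vector_derivative_Pair)
      have "(W has_derivative (\<lambda>d. hopf_Wp m B D e p q * fst d + hopf_Wq m B D e p q * snd d)) (at (r \<theta> * cos \<theta>, r \<theta> * sin \<theta>))"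
        unfolding W_def p_def q_def by (rule hopf_W_derivative)
      from vector_derivative_diff_chain_within[OF d has_derivative_at_withinI[OF this]]
      have "((\<lambda>\<theta>. W (r \<theta> * cos \<theta>, r \<theta> * sin \<theta>)) has_real_derivative
          hopf_Wp m B D e p q * p' + hopf_Wq m B D e p q * q') (at \<theta>)"
        by (simp add: o_def has_real_derivative_iff_has_vector_derivative)
      moreover have "hopf_Wp m B D e p q * p' + hopf_Wq m B D e p q * q' = T (r \<theta>) \<theta>"
      proof -
        have "hopf_field m B D (k * e\<^sup>2) e (p, q) = (\<Theta> * p', \<Theta> * q')"
          unfolding p_def q_def hf[OF sub[OF r(2)]] \<Theta>_def p'_def q'_def by (simp add: algebra_simps)
        then have "\<Theta> * (hopf_Wp m B D e p q * p' + hopf_Wq m B D e p q * q') =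
            e\<^sup>2 * (k * (p\<^sup>2 + q\<^sup>2) - k * (p\<^sup>2 + q\<^sup>2)\<^sup>2) + e ^ 3 * hopf_N m B D e p q"
          using hopf_W_dot[OF k, of e p q] by (simp add: algebra_simps)
        also have "p\<^sup>2 + q\<^sup>2 = (r \<theta>)\<^sup>2"
          unfolding p_def q_def by (simp add: power_mult_distrib flip: distrib_left)
        also have "e\<^sup>2 * (k * (r \<theta>)\<^sup>2 - k * ((r \<theta>)\<^sup>2)\<^sup>2) + e ^ 3 * hopf_N m B D e p q = \<Theta> * T (r \<theta>) \<theta>"
        proof -
          \<comment> \<open>With X = k (\<rho>^2 - \<rho>^4) this is (X + e N) / (1 + e H) = X + e
            (N - X H) / (1 + e H): the correction caused by the angular speed is one order
            smaller.\<close>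
          have "\<Theta> * Q (r \<theta>) \<theta> = hopf_N m B D e p q - k * ((r \<theta>)\<^sup>2 - (r \<theta>) ^ 4) * H (r \<theta>) \<theta>"
            using \<Theta> unfolding Q_def pol_Q_def \<Theta>_def H_def p_def q_def k by (simp add: field_simps)
          then have N: "hopf_N m B D e p q = \<Theta> * Q (r \<theta>) \<theta> + k * ((r \<theta>)\<^sup>2 - (r \<theta>) ^ 4) * H (r \<theta>) \<theta>" by simp
          show ?thesis unfolding N T_def unfolding \<Theta>_def
            by (simp add: algebra_simps power2_eq_square power3_eq_cube power4_eq_xxxx)
        qed
        finally show ?thesis using \<Theta> by simp
      qed
      ultimately show ?thesis by simp
    qed
    have contH: "continuous_on A (\<lambda>x. H (g x) (h x))" if "continuous_on A g" "continuous_on A h" for A :: "(real \<times> real) set" and g h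
      unfolding H_def pol_H_def by (intro continuous_intros that)
    \<comment> \<open>W differs from \<rho>^2 by at most 1/100, and 16/25 < 4/5 < 1 < 2 < 9/4, so
      the levels 4/5 and 2 lie strictly inside the annulus on both sides of \<rho> = 1. The inner
      radius 4/5 exceeds 1 / sqrt 2. The constants 1 and 4 relax 8/5 d <= \<rho>'^2 - \<rho>^2 <= 3
      d by the Lipschitz error of e G.\<close>
    interpret A: polar_annulus f p0 L Linv S "\<lambda>\<rho> \<theta>. \<omega> * (1 + e * H \<rho> \<theta>)" T W "4/5" "3/2" "4/5" 2
      "e\<^sup>2 * k / 4" 1 4 MS MS "\<omega> / 2" "\<omega> * (3 / 2)"
    proof (rule polar_annulus.intro)
      show "lipschitz_on_balls f" by (rule lip)
      show "bounded_linear L" "bounded_linear Linv" "\<And>z. L (Linv z) = z" "\<And>z. Linv (L z) = z" by (rule L)+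
      show "f (p0 + L (\<rho> * cos \<theta>, \<rho> * sin \<theta>)) =
        (\<omega> * (1 + e * H \<rho> \<theta>)) *\<^sub>R L (S \<rho> \<theta> *\<^sub>R (cos \<theta>, sin \<theta>) + \<rho> *\<^sub>R (- sin \<theta>, cos \<theta>))"
        if "\<rho> \<in> {4/5..3/2}" for \<rho> \<theta>
        unfolding conj hf[OF sub[OF that]] linear_scale[OF bounded_linear.linear[OF L(1)]] by simp
      show "0 < \<omega> / 2" using \<omega> by simp
      show "\<omega> / 2 \<le> \<omega> * (1 + e * H \<rho> \<theta>) \<and> \<omega> * (1 + e * H \<rho> \<theta>) \<le> \<omega> * (3 / 2)" if "\<rho> \<in> {4/5..3/2}" for \<rho> \<theta>
        using Hb[OF sub[OF that], of \<theta>] \<omega> mult_left_mono[of "1/2" "1 + e * H \<rho> \<theta>" \<omega>] by simp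
      have C: "continuous_on ({4/5..3/2} \<times> UNIV) (\<lambda>x. H (fst x) (snd x))" by (intro contH continuous_intros)
      then show "continuous_on ({4/5..3/2} \<times> UNIV) (\<lambda>(\<rho>, \<theta>). \<omega> * (1 + e * H \<rho> \<theta>))"
        unfolding case_prod_unfold by (intro continuous_intros)
      have nz: "\<forall>x\<in>{4/5..3/2} \<times> UNIV. 1 + e * H (fst x) (snd x) \<noteq> 0"
        using Hb sub by (metis SigmaE fst_conv less_le_not_le linorder_not_le zero_less_divide_1_iff zero_less_numeral order_refl)
      have "continuous_on ({4/5..3/2} \<times> UNIV) (\<lambda>x. pol_R m B D e (fst x) (cos (snd x)) (sin (snd x)))"
        unfolding pol_R_def by (intro continuous_intros)
      then show "continuous_on ({4/5..3/2} \<times> UNIV) (\<lambda>(\<rho>, \<theta>). S \<rho> \<theta>)"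
        unfolding S_def pol_S_def case_prod_unfold
        by (intro continuous_on_mult continuous_on_inverse continuous_on_add continuous_on_const
            C[unfolded H_def] nz[unfolded H_def])
      show "S \<rho> (\<theta> + 2 * pi) = S \<rho> \<theta>" "\<omega> * (1 + e * H \<rho> (\<theta> + 2 * pi)) = \<omega> * (1 + e * H \<rho> \<theta>)" for \<rho> \<theta>
        unfolding S_def H_def by simp_all
      show "\<bar>S \<rho> \<theta> - S \<rho>' \<theta>\<bar> \<le> MS * \<bar>\<rho> - \<rho>'\<bar>" if "\<rho> \<in> {4/5..3/2}" "\<rho>' \<in> {4/5..3/2}" for \<rho> \<rho>' \<theta>
        using unif(2)[OF MS(2) sub[OF that(2)] sub[OF that(1)]] by (simp add: S_def)
      show "\<bar>S \<rho> \<theta>\<bar> \<le> MS" if "\<rho> \<in> {4/5..3/2}" for \<rho> \<theta>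
        using unif(1)[OF MS(2) sub[OF that] sub[OF that]] by (simp add: S_def)
      show "continuous_on UNIV W" unfolding W_def hopf_W_defs V_defs by (intro continuous_intros)
      show "0 < e\<^sup>2 * k / 4" using kpos e(1) by simp
      show "1 * (\<rho>' - \<rho>) \<le> W (\<rho>' * cos \<theta>, \<rho>' * sin \<theta>) - W (\<rho> * cos \<theta>, \<rho> * sin \<theta>)"
        "W (\<rho>' * cos \<theta>, \<rho>' * sin \<theta>) - W (\<rho> * cos \<theta>, \<rho> * sin \<theta>) \<le> 4 * (\<rho>' - \<rho>)"
        "T \<rho>' \<theta> - T \<rho> \<theta> \<le> - (e\<^sup>2 * k / 4) * (\<rho>' - \<rho>)"
        if \<rho>: "4/5 \<le> \<rho>" "\<rho> \<le> \<rho>'" "\<rho>' \<le> 3/2" for \<rho> \<rho>' \<theta>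
      proof -
        have in': "\<rho> \<in> {0..2}" "\<rho>' \<in> {0..2}" using \<rho> by auto
        define d where "d = \<rho>' - \<rho>"
        have d: "d \<ge> 0" using \<rho> by (simp add: d_def)
        have sq: "\<rho>'\<^sup>2 - \<rho>\<^sup>2 = (\<rho> + \<rho>') * d" by (simp add: d_def power2_eq_square algebra_simps)
        have sq2: "8/5 * d \<le> \<rho>'\<^sup>2 - \<rho>\<^sup>2" "\<rho>'\<^sup>2 - \<rho>\<^sup>2 \<le> 3 * d"
          unfolding sq by (rule mult_right_mono[OF _ d], use \<rho> in simp)+
        have g: "\<bar>e * G \<rho>' \<theta> - e * G \<rho> \<theta>\<bar> \<le> 1 / 100 * d" using Gl[OF in', of \<theta>] d by (simp add: d_def)
        show "1 * (\<rho>' - \<rho>) \<le> W (\<rho>' * cos \<theta>, \<rho>' * sin \<theta>) - W (\<rho> * cos \<theta>, \<rho> * sin \<theta>)"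
          "W (\<rho>' * cos \<theta>, \<rho>' * sin \<theta>) - W (\<rho> * cos \<theta>, \<rho> * sin \<theta>) \<le> 4 * (\<rho>' - \<rho>)"
          unfolding WG d_def[symmetric] using g sq2 d by linarith+
        have q: "e * Q \<rho>' \<theta> - e * Q \<rho> \<theta> \<le> k / 10 * d" using order_trans[OF abs_ge_self Ql[OF in', of \<theta>]] d by (simp add: d_def)
        have "\<rho>\<^sup>2 \<ge> (4/5)\<^sup>2" "\<rho>'\<^sup>2 \<ge> (4/5)\<^sup>2"
          by (rule power_mono, use \<rho> in simp, simp)+
        then have n: "\<rho>\<^sup>2 + \<rho>'\<^sup>2 - 1 \<ge> 7/25" by (simp add: power2_eq_square)
        \<comment> \<open>The factor \<rho>^2 + \<rho>'^2 - 1 is positive because both radii are at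
          least 4/5, beyond the maximum of \<rho>^2 - \<rho>^4.\<close>
        have "(\<rho>'\<^sup>2 - \<rho>' ^ 4) - (\<rho>\<^sup>2 - \<rho> ^ 4) = - ((\<rho>\<^sup>2 + \<rho>'\<^sup>2 - 1) * (\<rho>'\<^sup>2 - \<rho>\<^sup>2))"
          by (simp add: algebra_simps power2_eq_square power4_eq_xxxx)
        also have "\<dots> \<le> - (7/25 * (8/5 * d))"
          using n sq2(1) d by (intro le_imp_neg_le mult_mono) auto
        finally have "k * ((\<rho>'\<^sup>2 - \<rho>' ^ 4) - (\<rho>\<^sup>2 - \<rho> ^ 4)) \<le> k * (- (56/125 * d))"
          using kpos by (intro mult_left_mono) auto
        moreover have "0 \<le> k * d" using kpos d by simp
        ultimately have "k * (\<rho>'\<^sup>2 - \<rho>' ^ 4) + e * Q \<rho>' \<theta> - (k * (\<rho>\<^sup>2 - \<rho> ^ 4) + e * Q \<rho> \<theta>) \<le> - (k / 4 * d)"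
          using q by (simp add: algebra_simps)
        then have "e\<^sup>2 * (k * (\<rho>'\<^sup>2 - \<rho>' ^ 4) + e * Q \<rho>' \<theta> - (k * (\<rho>\<^sup>2 - \<rho> ^ 4) + e * Q \<rho> \<theta>)) \<le> e\<^sup>2 * (- (k / 4 * d))"
          by (intro mult_left_mono) auto
        then show "T \<rho>' \<theta> - T \<rho> \<theta> \<le> - (e\<^sup>2 * k / 4) * (\<rho>' - \<rho>)"
          unfolding T_def d_def[symmetric] by (simp add: algebra_simps)
      qed
      show "((\<lambda>\<theta>. W (r \<theta> * cos \<theta>, r \<theta> * sin \<theta>)) has_real_derivative T (r \<theta>) \<theta>) (at \<theta>)"
        if "(r has_real_derivative S (r \<theta>) \<theta>) (at \<theta>)" "r \<theta> \<in> {4/5..3/2}" for r \<theta>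
        using that by (rule dW)
      show "W (4/5 * cos \<theta>, 4/5 * sin \<theta>) < 4/5" for \<theta>
        unfolding WG using Gb[of "4/5" \<theta>] by (simp add: abs_le_iff power2_eq_square)
      show "2 < W (3/2 * cos \<theta>, 3/2 * sin \<theta>)" for \<theta>
        unfolding WG using Gb[of "3/2" \<theta>] by (simp add: abs_le_iff power2_eq_square)
      show "0 < T \<rho> \<theta>" if "\<rho> \<in> {4/5..3/2}" "W (\<rho> * cos \<theta>, \<rho> * sin \<theta>) = 4/5" for \<rho> \<theta>
      proof -
        have b: "79/100 \<le> \<rho>\<^sup>2" "\<rho>\<^sup>2 \<le> 81/100"
          using that(2) Gb[OF sub[OF that(1)], of \<theta>] unfolding WG abs_le_iff by auto
        have "\<rho>\<^sup>2 - \<rho> ^ 4 = \<rho>\<^sup>2 * (1 - \<rho>\<^sup>2)" by (simp add: algebra_simps power2_eq_square power4_eq_xxxx)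
        also have "\<dots> \<ge> 79/100 * (19/100)" using b by (intro mult_mono) auto
        finally have "k * (\<rho>\<^sup>2 - \<rho> ^ 4) \<ge> k * (1501/10000)" using kpos by (intro mult_left_mono) auto
        then have "k * (\<rho>\<^sup>2 - \<rho> ^ 4) + e * Q \<rho> \<theta> > 0"
          using Qb[OF sub[OF that(1)], of \<theta>] kpos unfolding abs_le_iff by linarith
        then show ?thesis unfolding T_def using e(1) by simp
      qed
      show "T \<rho> \<theta> < 0" if "\<rho> \<in> {4/5..3/2}" "W (\<rho> * cos \<theta>, \<rho> * sin \<theta>) = 2" for \<rho> \<theta>
      proof -
        have b: "199/100 \<le> \<rho>\<^sup>2"
          using that(2) Gb[OF sub[OF that(1)], of \<theta>] unfolding WG abs_le_iff by auto
        have "\<rho> ^ 4 - \<rho>\<^sup>2 = \<rho>\<^sup>2 * (\<rho>\<^sup>2 - 1)" by (simp add: algebra_simps power2_eq_square power4_eq_xxxx)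
        also have "\<dots> \<ge> 199/100 * (99/100)" using b by (intro mult_mono) auto
        finally have "k * (\<rho> ^ 4 - \<rho>\<^sup>2) \<ge> k * (19701/10000)" using kpos by (intro mult_left_mono) auto
        then have "k * (\<rho>\<^sup>2 - \<rho> ^ 4) + e * Q \<rho> \<theta> < 0"
          using Qb[OF sub[OF that(1)], of \<theta>] kpos unfolding abs_le_iff by (simp add: right_diff_distrib)
        then show ?thesis unfolding T_def using e(1) by (simp add: mult_pos_neg)
      qed
    qed simp_all
    show "\<exists>\<Gamma>. stable_limit_cycle f \<Gamma> \<and> surrounds \<Gamma> p0" by (rule A.stable_limit_cycle_exists)
  qed
qed

section \<open>Stability of the equilibrium in the normal form\<close>

text \<open>N is bounded by some M on a box containing the unit circle, so for \<rho> <= a / (2 (M +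
  1)) the remainder consumes at most half of the leading coefficient a.\<close>

lemma near_origin_pos:
  fixes F :: "real \<times> real \<Rightarrow> real" and N :: "real \<Rightarrow> real \<Rightarrow> real \<Rightarrow> real"
  assumes cont: "continuous_on UNIV (\<lambda>x. N (fst x) (fst (snd x)) (snd (snd x)))" and a: "a > 0"
    and F: "\<And>\<rho> c s. \<rho> \<ge> 0 \<Longrightarrow> c\<^sup>2 + s\<^sup>2 = 1 \<Longrightarrow> F (\<rho> * c, \<rho> * s) \<ge> \<rho> ^ n * (a + \<rho> * N \<rho> c s)"
  shows "\<exists>r>0. \<forall>z. norm z \<le> r \<longrightarrow> z \<noteq> 0 \<longrightarrow> F z > 0"
proof -
  have "compact ({0..1} \<times> {-1..1} \<times> {-1..1} :: (real \<times> real \<times> real) set)"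
    by (intro compact_Times compact_Icc)
  from compact_imp_bounded[OF compact_continuous_image[OF continuous_on_subset[OF cont subset_UNIV] this]]
  obtain M where M': "\<forall>y \<in> (\<lambda>x. N (fst x) (fst (snd x)) (snd (snd x))) ` ({0..1} \<times> {-1..1} \<times> {-1..1}). norm y \<le> M"
    unfolding bounded_iff by blast
  have M: "\<bar>N (fst x) (fst (snd x)) (snd (snd x))\<bar> \<le> M" if "x \<in> {0..1} \<times> {-1..1} \<times> {-1..1}" for x
    using bspec[OF M' imageI[OF that]] by simp
  have M0: "M \<ge> 0" using order_trans[OF abs_ge_zero M[of "(0, 0, 0)"]] by simp
  define r where "r = min 1 (a / (2 * (M + 1)))"
  have r: "r > 0" "r \<le> 1" "r \<le> a / (2 * (M + 1))" using a M0 by (auto simp: r_def)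
  have "F z > 0" if z: "norm z \<le> r" "z \<noteq> 0" for z
  proof -
    obtain \<theta> where \<theta>: "z = (norm z * cos \<theta>, norm z * sin \<theta>)" using polar_exists by metis
    define \<rho> where "\<rho> = norm z"
    have \<rho>: "0 < \<rho>" "\<rho> \<le> 1" "\<rho> \<le> a / (2 * (M + 1))" using z r by (auto simp: \<rho>_def)
    have "\<bar>N \<rho> (cos \<theta>) (sin \<theta>)\<bar> \<le> M" using M[of "(\<rho>, cos \<theta>, sin \<theta>)"] \<rho> by simp
    then have "\<bar>\<rho> * N \<rho> (cos \<theta>) (sin \<theta>)\<bar> \<le> a / (2 * (M + 1)) * (M + 1)"
      unfolding abs_mult using \<rho> a M0 by (intro mult_mono) auto
    also have "\<dots> = a / 2" using M0 by (simp add: divide_simps)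
    finally have "a + \<rho> * N \<rho> (cos \<theta>) (sin \<theta>) > 0" using a unfolding abs_le_iff by linarith
    then have "\<rho> ^ n * (a + \<rho> * N \<rho> (cos \<theta>) (sin \<theta>)) > 0" using \<rho> by simp
    also have "\<dots> \<le> F (\<rho> * cos \<theta>, \<rho> * sin \<theta>)" using \<rho> by (intro F) auto
    finally show ?thesis using \<theta> by (simp add: \<rho>_def)
  qed
  then show ?thesis using r(1) by blast
qed

lemma common_radius:
  assumes "\<exists>r>0. \<forall>z::real \<times> real. norm z \<le> r \<longrightarrow> z \<noteq> 0 \<longrightarrow> P z"
    and "\<exists>r>0. \<forall>z::real \<times> real. norm z \<le> r \<longrightarrow> z \<noteq> 0 \<longrightarrow> Q z"
  obtains r where "r > 0" "\<And>z. norm z \<le> r \<Longrightarrow> z \<noteq> 0 \<Longrightarrow> P z" "\<And>z. norm z \<le> r \<Longrightarrow> z \<noteq> 0 \<Longrightarrow> Q z"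
proof -
  obtain r1 r2 where "r1 > 0" "\<forall>z. norm z \<le> r1 \<longrightarrow> z \<noteq> 0 \<longrightarrow> P z" "r2 > 0" "\<forall>z. norm z \<le> r2 \<longrightarrow> z \<noteq> 0 \<longrightarrow> Q z"
    using assms by blast
  then show ?thesis by (intro that[of "min r1 r2"]) auto
qed

lemma hopf_field_zero: "hopf_field m B D \<mu> e 0 = 0"
  by (simp add: hopf_field_def zero_prod_def)

lemma hopf_field_continuous: "continuous_on UNIV (hopf_field m B D \<mu> e)"
  unfolding hopf_field_def case_prod_unfold by (intro continuous_intros)

lemma hopf_field_critical:
  "fst (hopf_field m B D 0 1 (p, q)) = - q - 4 * p * q - B * p ^ 2 - D * p ^ 3"
  "snd (hopf_field m B D 0 1 (p, q)) = p + 8 * m * p ^ 2 + 16 * m * p ^ 3"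
  by (simp_all add: hopf_field_def algebra_simps power2_eq_square power3_eq_cube)

lemma unit_circle_product: "c\<^sup>2 + s\<^sup>2 = 1 \<Longrightarrow> \<bar>c * s\<bar> \<le> (1 / 2 :: real)"
  using sum_squares_bound[of c s] sum_squares_bound[of c "- s"] by (simp add: abs_le_iff)

lemma scaled_unit_circle_product:
  fixes c s \<mu> :: real
  assumes "c\<^sup>2 + s\<^sup>2 = 1" "\<bar>\<mu>\<bar> \<le> 1"
  shows "\<mu> * (c * s) \<le> 1 / 2"
proof -
  have "\<bar>\<mu> * (c * s)\<bar> \<le> 1 * (1 / 2)"
    unfolding abs_mult[of \<mu>] using assms unit_circle_product by (intro mult_mono) auto
  then show ?thesis by (simp add: abs_le_iff)
qed

section \<open>Nonzero trace: a quadratic Lyapunov function\<close>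

text \<open>For p^2 + q^2 the quadratic part of the derivative is 2 mu p^2, which vanishes on p = 0.
  With the extra term it becomes mu (p^2 + q^2) - mu^2 p q, which is definite for 0 < |mu| <=
  1.\<close>

definition lin_W :: "real \<Rightarrow> real \<times> real \<Rightarrow> real" where
  "lin_W \<mu> z = (fst z)\<^sup>2 + (snd z)\<^sup>2 - \<mu> * fst z * snd z"

definition lin_Wd :: "real \<Rightarrow> real \<Rightarrow> real \<Rightarrow> real \<Rightarrow> real \<times> real \<Rightarrow> real" where
  "lin_Wd m B D \<mu> z = (2 * fst z - \<mu> * snd z) * fst (hopf_field m B D \<mu> 1 z)
     + (2 * snd z - \<mu> * fst z) * snd (hopf_field m B D \<mu> 1 z)"

definition lin_N :: "real \<Rightarrow> real \<Rightarrow> real \<Rightarrow> real \<Rightarrow> real \<Rightarrow> real \<Rightarrow> real \<Rightarrow> real" where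
  "lin_N m B D \<mu> \<rho> c s = (2 * c - \<mu> * s) * (- 4 * c * s - B * c ^ 2 - D * \<rho> * c ^ 3)
     + (2 * s - \<mu> * c) * (8 * m * c ^ 2 + 16 * m * \<rho> * c ^ 3)"

lemma lin_W_derivative:
  "(lin_W \<mu> has_derivative (\<lambda>d. (2 * p - \<mu> * q) * fst d + (2 * q - \<mu> * p) * snd d)) (at (p, q))"
  unfolding lin_W_def
  by (rule derivative_eq_intros refl | simp)+ (auto simp: fun_eq_iff algebra_simps power2_eq_square)

lemma lin_Wd_polar:
  assumes "c\<^sup>2 + s\<^sup>2 = 1"
  shows "lin_Wd m B D \<mu> (\<rho> * c, \<rho> * s) = \<rho>\<^sup>2 * (\<mu> - \<mu>\<^sup>2 * (c * s) + \<rho> * lin_N m B D \<mu> \<rho> c s)"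
proof -
  have "lin_Wd m B D \<mu> (\<rho> * c, \<rho> * s) = \<rho>\<^sup>2 * (\<mu> * (c\<^sup>2 + s\<^sup>2) - \<mu>\<^sup>2 * (c * s) + \<rho> * lin_N m B D \<mu> \<rho> c s)"
    unfolding lin_Wd_def lin_N_def hopf_field_def by (simp add: power2_eq_square power3_eq_cube) algebra
  then show ?thesis using assms by simp
qed

lemma lin_W_pos:
  assumes "\<bar>\<mu>\<bar> \<le> 1"
  shows "\<exists>r>0. \<forall>z. norm z \<le> r \<longrightarrow> z \<noteq> 0 \<longrightarrow> lin_W \<mu> z > 0"
proof (rule near_origin_pos[where N="\<lambda>_ _ _. 0" and a="1/2" and n=2])
  fix \<rho> c s :: real assume cs: "c\<^sup>2 + s\<^sup>2 = 1"
  have "1 / 2 \<le> 1 - \<mu> * (c * s)" using scaled_unit_circle_product[OF cs assms] by simp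
  then have "\<rho>\<^sup>2 * (1 / 2) \<le> \<rho>\<^sup>2 * (1 - \<mu> * (c * s))" by (intro mult_left_mono) auto
  also have "\<dots> = lin_W \<mu> (\<rho> * c, \<rho> * s)"
    unfolding cs[symmetric] lin_W_def by (simp add: algebra_simps power2_eq_square)
  finally show "\<rho>\<^sup>2 * (1 / 2 + \<rho> * 0) \<le> lin_W \<mu> (\<rho> * c, \<rho> * s)" by simp
qed auto

lemma lin_N_continuous: "continuous_on UNIV (\<lambda>x. lin_N m B D \<mu> (fst x) (fst (snd x)) (snd (snd x)))"
  unfolding lin_N_def by (intro continuous_intros)

lemma lin_Wd_continuous: "continuous_on UNIV (lin_Wd m B D \<mu>)"
  unfolding lin_Wd_def by (intro continuous_intros hopf_field_continuous)

lemma unstable_of_trace_pos: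
  assumes "affine_conj f p0 L Linv (hopf_field m B D \<mu> 1) \<omega>" "0 < \<mu>" "\<mu> \<le> 1"
  shows "unstable f p0"
proof -
  have "\<exists>r>0. \<forall>z. norm z \<le> r \<longrightarrow> z \<noteq> 0 \<longrightarrow> lin_Wd m B D \<mu> z > 0"
  proof (rule near_origin_pos[OF lin_N_continuous, where a="\<mu>/2" and n=2])
    fix \<rho> c s :: real assume cs: "c\<^sup>2 + s\<^sup>2 = 1"
    have "\<mu> * (c * s) \<le> 1 / 2" by (rule scaled_unit_circle_product[OF cs]) (use assms in auto)
    then have "\<mu>\<^sup>2 * (c * s) \<le> \<mu> * (1 / 2)"
      unfolding power2_eq_square mult.assoc using assms(2) by (intro mult_left_mono) auto
    then show "\<rho>\<^sup>2 * (\<mu> / 2 + \<rho> * lin_N m B D \<mu> \<rho> c s) \<le> lin_Wd m B D \<mu> (\<rho> * c, \<rho> * s)"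
      unfolding lin_Wd_polar[OF cs] by (intro mult_left_mono) auto
  qed (use assms in auto)
  moreover have "\<exists>r>0. \<forall>z. norm z \<le> r \<longrightarrow> z \<noteq> 0 \<longrightarrow> lin_W \<mu> z > 0" by (rule lin_W_pos) (use assms in auto)
  ultimately obtain r where r: "r > 0" "\<And>z. norm z \<le> r \<Longrightarrow> z \<noteq> 0 \<Longrightarrow> lin_Wd m B D \<mu> z > 0"
    "\<And>z. norm z \<le> r \<Longrightarrow> z \<noteq> 0 \<Longrightarrow> lin_W \<mu> z > 0" by (rule common_radius) blast
  show ?thesis
    by (rule affine_conj.unstable_conj[OF assms(1) lin_W_derivative _ lin_Wd_continuous _ hopf_field_zero r(1)])
      (use r in \<open>auto simp: lin_Wd_def lin_W_def\<close>)
qed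

lemma asymptotically_stable_of_trace_neg:
  assumes "affine_conj f p0 L Linv (hopf_field m B D \<mu> 1) \<omega>" "\<mu> < 0" "- 1 \<le> \<mu>"
  shows "asymptotically_stable f p0"
proof -
  have "\<exists>r>0. \<forall>z. norm z \<le> r \<longrightarrow> z \<noteq> 0 \<longrightarrow> - lin_Wd m B D \<mu> z > 0"
  proof (rule near_origin_pos[where N="\<lambda>\<rho> c s. - lin_N m B D \<mu> \<rho> c s" and a="- \<mu>/2" and n=2])
    show "continuous_on UNIV (\<lambda>x. - lin_N m B D \<mu> (fst x) (fst (snd x)) (snd (snd x)))"
      by (intro continuous_intros lin_N_continuous)
    fix \<rho> c s :: real assume cs: "c\<^sup>2 + s\<^sup>2 = 1"
    have "\<mu> * (c * s) \<le> 1 / 2" by (rule scaled_unit_circle_product[OF cs]) (use assms in auto)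
    then have "(- \<mu>) * (\<mu> * (c * s)) \<le> (- \<mu>) * (1 / 2)" using assms(2) by (intro mult_left_mono) auto
    then have "- \<mu> / 2 + \<rho> * - lin_N m B D \<mu> \<rho> c s \<le> - (\<mu> - \<mu>\<^sup>2 * (c * s) + \<rho> * lin_N m B D \<mu> \<rho> c s)"
      by (simp add: power2_eq_square mult_ac)
    then show "\<rho>\<^sup>2 * (- \<mu> / 2 + \<rho> * - lin_N m B D \<mu> \<rho> c s) \<le> - lin_Wd m B D \<mu> (\<rho> * c, \<rho> * s)"
      unfolding lin_Wd_polar[OF cs] mult_minus_right[symmetric] by (intro mult_left_mono) auto
  qed (use assms in auto)
  moreover have "\<exists>r>0. \<forall>z. norm z \<le> r \<longrightarrow> z \<noteq> 0 \<longrightarrow> lin_W \<mu> z > 0" by (rule lin_W_pos) (use assms in auto)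
  ultimately obtain r where r: "r > 0" "\<And>z. norm z \<le> r \<Longrightarrow> z \<noteq> 0 \<Longrightarrow> - lin_Wd m B D \<mu> z > 0"
    "\<And>z. norm z \<le> r \<Longrightarrow> z \<noteq> 0 \<Longrightarrow> lin_W \<mu> z > 0" by (rule common_radius) blast
  have neg: "lin_Wd m B D \<mu> z < 0" if "norm z \<le> r" "z \<noteq> 0" for z using r(2)[OF that] by simp
  show ?thesis
    by (rule affine_conj.asymptotically_stable_conj[OF assms(1) lin_W_derivative _ lin_Wd_continuous _ hopf_field_zero r(1)])
      (use r(3) neg in \<open>auto simp: lin_Wd_def lin_W_def\<close>)
qed

text \<open>\<open>V5\<close> and \<open>V6\<close> are needed, and correct, only where \<open>lyap1\<close> vanishes.\<close>
definition V5 :: "real \<Rightarrow> real \<Rightarrow> real \<Rightarrow> real \<Rightarrow> real" where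
  "V5 m B p q = (- 128 / 5 + 128 / 5 * m + 16 / 3 * B ^ 2 - 32 / 3 * B ^ 2 * m) * p ^ 5
     + (64 / 3 * B - 128 / 3 * B * m - 4 * B ^ 3) * p ^ 4 * q
     + (64 / 9 * B - 320 / 9 * B * m - 16 / 3 * B ^ 3) * p ^ 2 * q ^ 3
     + (128 / 45 * B - 128 / 9 * B * m - 32 / 15 * B ^ 3) * q ^ 5"

definition V5p :: "real \<Rightarrow> real \<Rightarrow> real \<Rightarrow> real \<Rightarrow> real" where
  "V5p m B p q = 5 * (- 128 / 5 + 128 / 5 * m + 16 / 3 * B ^ 2 - 32 / 3 * B ^ 2 * m) * p ^ 4
     + 4 * (64 / 3 * B - 128 / 3 * B * m - 4 * B ^ 3) * p ^ 3 * q
     + 2 * (64 / 9 * B - 320 / 9 * B * m - 16 / 3 * B ^ 3) * p * q ^ 3"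

definition V5q :: "real \<Rightarrow> real \<Rightarrow> real \<Rightarrow> real \<Rightarrow> real" where
  "V5q m B p q = (64 / 3 * B - 128 / 3 * B * m - 4 * B ^ 3) * p ^ 4
     + 3 * (64 / 9 * B - 320 / 9 * B * m - 16 / 3 * B ^ 3) * p ^ 2 * q ^ 2
     + 5 * (128 / 45 * B - 128 / 9 * B * m - 32 / 15 * B ^ 3) * q ^ 4"

definition V6 :: "real \<Rightarrow> real \<Rightarrow> real \<Rightarrow> real \<Rightarrow> real" where
  "V6 m B p q = (256 / 3 - 256 / 3 * m - 800 / 27 * B ^ 2 + 2080 / 27 * B ^ 2 * m - 256 / 9 * B ^ 2 * m ^ 2 + 32 / 9 * B ^ 4) * p ^ 6
     + (- 752 / 9 * B + 1760 / 9 * B * m - 800 / 9 * B * m ^ 2 + 64 / 3 * B ^ 3 - 128 / 3 * B ^ 3 * m) * p ^ 5 * q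
     + (- 32 / 9 * B ^ 2 + 160 / 9 * B ^ 2 * m + 8 / 3 * B ^ 4) * p ^ 4 * q ^ 2
     + (- 640 / 27 * B + 1792 / 27 * B * m + 1280 / 27 * B * m ^ 2 + 128 / 9 * B ^ 3 - 256 / 9 * B ^ 3 * m) * p ^ 3 * q ^ 3
     + (- 16 / 9 * B - 224 / 9 * B * m + 800 / 9 * B * m ^ 2) * p * q ^ 5"

definition V6p :: "real \<Rightarrow> real \<Rightarrow> real \<Rightarrow> real \<Rightarrow> real" where
  "V6p m B p q = 6 * (256 / 3 - 256 / 3 * m - 800 / 27 * B ^ 2 + 2080 / 27 * B ^ 2 * m - 256 / 9 * B ^ 2 * m ^ 2 + 32 / 9 * B ^ 4) * p ^ 5
     + 5 * (- 752 / 9 * B + 1760 / 9 * B * m - 800 / 9 * B * m ^ 2 + 64 / 3 * B ^ 3 - 128 / 3 * B ^ 3 * m) * p ^ 4 * q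
     + 4 * (- 32 / 9 * B ^ 2 + 160 / 9 * B ^ 2 * m + 8 / 3 * B ^ 4) * p ^ 3 * q ^ 2
     + 3 * (- 640 / 27 * B + 1792 / 27 * B * m + 1280 / 27 * B * m ^ 2 + 128 / 9 * B ^ 3 - 256 / 9 * B ^ 3 * m) * p ^ 2 * q ^ 3
     + (- 16 / 9 * B - 224 / 9 * B * m + 800 / 9 * B * m ^ 2) * q ^ 5"

definition V6q :: "real \<Rightarrow> real \<Rightarrow> real \<Rightarrow> real \<Rightarrow> real" where
  "V6q m B p q = (- 752 / 9 * B + 1760 / 9 * B * m - 800 / 9 * B * m ^ 2 + 64 / 3 * B ^ 3 - 128 / 3 * B ^ 3 * m) * p ^ 5
     + 2 * (- 32 / 9 * B ^ 2 + 160 / 9 * B ^ 2 * m + 8 / 3 * B ^ 4) * p ^ 4 * q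
     + 3 * (- 640 / 27 * B + 1792 / 27 * B * m + 1280 / 27 * B * m ^ 2 + 128 / 9 * B ^ 3 - 256 / 9 * B ^ 3 * m) * p ^ 3 * q ^ 2
     + 5 * (- 16 / 9 * B - 224 / 9 * B * m + 800 / 9 * B * m ^ 2) * p * q ^ 4"

lemmas V56_defs = V5_def V5p_def V5q_def V6_def V6p_def V6q_def

lemma V3_derivative:
  "((\<lambda>z. V3 m B D (fst z) (snd z)) has_derivative (\<lambda>d. V3p m B D p q * fst d + V3q m B D p q * snd d)) (at (p, q))"
proof -
  have "((\<lambda>z. a / 3 * fst z ^ 3 + b * fst z ^ 2 * snd z + c / 3 * snd z ^ 3) has_derivative
     (\<lambda>d. (a * p ^ 2 + 2 * b * p * q) * fst d + (b * p ^ 2 + c * q ^ 2) * snd d)) (at (p, q))" for a b c :: real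
    by (rule derivative_eq_intros refl | simp)+ (auto simp: fun_eq_iff field_simps power2_eq_square)
  from this[of "16 * m - 8" "2 * B" "4 * B"] show ?thesis unfolding V3_def V3p_def V3q_def by (simp add: algebra_simps)
qed

lemma V4_derivative:
  "((\<lambda>z. V4 m B D (fst z) (snd z)) has_derivative (\<lambda>d. V4p m B D p q * fst d + V4q m B D p q * snd d)) (at (p, q))"
proof -
  have "((\<lambda>z. a * fst z ^ 4 + b * fst z ^ 3 * snd z + c * fst z * snd z ^ 3) has_derivative
     (\<lambda>d. (4 * a * p ^ 3 + 3 * b * p ^ 2 * q + c * q ^ 3) * fst d + (b * p ^ 3 + 3 * c * p * q ^ 2) * snd d)) (at (p, q))" for a b c :: real
    by (rule derivative_eq_intros refl | simp)+ (auto simp: fun_eq_iff algebra_simps power2_eq_square power3_eq_cube)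
  then show ?thesis unfolding V4_def V4p_def V4q_def .
qed

lemma V5_derivative:
  "((\<lambda>z. V5 m B (fst z) (snd z)) has_derivative (\<lambda>d. V5p m B p q * fst d + V5q m B p q * snd d)) (at (p, q))"
proof -
  have "((\<lambda>z. a * fst z ^ 5 + b * fst z ^ 4 * snd z + c * fst z ^ 2 * snd z ^ 3 + e * snd z ^ 5) has_derivative
     (\<lambda>d. (5 * a * p ^ 4 + 4 * b * p ^ 3 * q + 2 * c * p * q ^ 3) * fst d
        + (b * p ^ 4 + 3 * c * p ^ 2 * q ^ 2 + 5 * e * q ^ 4) * snd d)) (at (p, q))" for a b c e :: real
    by (rule derivative_eq_intros refl | simp)+ (auto simp: fun_eq_iff algebra_simps power2_eq_square power3_eq_cube power4_eq_xxxx)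
  then show ?thesis unfolding V5_def V5p_def V5q_def .
qed

lemma V6_derivative:
  "((\<lambda>z. V6 m B (fst z) (snd z)) has_derivative (\<lambda>d. V6p m B p q * fst d + V6q m B p q * snd d)) (at (p, q))"
proof -
  have "((\<lambda>z. a * fst z ^ 6 + b * fst z ^ 5 * snd z + c * fst z ^ 4 * snd z ^ 2 + e * fst z ^ 3 * snd z ^ 3 + g * fst z * snd z ^ 5) has_derivative
     (\<lambda>d. (6 * a * p ^ 5 + 5 * b * p ^ 4 * q + 4 * c * p ^ 3 * q ^ 2 + 3 * e * p ^ 2 * q ^ 3 + g * q ^ 5) * fst d
        + (b * p ^ 5 + 2 * c * p ^ 4 * q + 3 * e * p ^ 3 * q ^ 2 + 5 * g * p * q ^ 4) * snd d)) (at (p, q))" for a b c e g :: real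
    by (rule derivative_eq_intros refl | simp)+ (auto simp: fun_eq_iff algebra_simps power2_eq_square power3_eq_cube power4_eq_xxxx)
  then show ?thesis unfolding V6_def V6p_def V6q_def .
qed

text \<open>The homological equations: degree by degree, the rotation \<open>(-q, p)\<close> applied to the next
  term of the Lyapunov function cancels everything but a power of \<open>p\<^sup>2 + q\<^sup>2\<close>.\<close>
lemma homological_3: "p * V3q m B D p q - q * V3p m B D p q + 2 * p * (- 4 * p * q - B * p ^ 2) + 2 * q * (8 * m * p ^ 2) = 0"
  unfolding V_defs by (simp add: power2_eq_square power3_eq_cube) algebra

lemma homological_4:
  "p * V4q m B D p q - q * V4p m B D p q + V3p m B D p q * (- 4 * p * q - B * p ^ 2) + V3q m B D p q * (8 * m * p ^ 2)
     + 2 * p * (- D * p ^ 3) + 2 * q * (16 * m * p ^ 3) = - lyap1 m B D * (p ^ 2 + q ^ 2) ^ 2"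
  unfolding V_defs lyap1_def by (simp add: power2_eq_square power3_eq_cube) algebra

text \<open>The assumption is \<open>lyap1 m B D = 0\<close> solved for D. The rotation derivative
  is invertible on homogeneous polynomials of odd degree, so nothing survives here; in even degrees
  a multiple of a power of p^2 + q^2 cannot be removed.\<close>

lemma homological_5:
  assumes "D = 4 / 3 * B * (4 * m + 1)"
  shows "p * V5q m B p q - q * V5p m B p q + V4p m B D p q * (- 4 * p * q - B * p ^ 2) + V4q m B D p q * (8 * m * p ^ 2)
     + V3p m B D p q * (- D * p ^ 3) + V3q m B D p q * (16 * m * p ^ 3) = 0"
  unfolding V_defs V5p_def V5q_def lyap1_def assms by algebra

text \<open>The coefficient on the right is the second Lyapunov quantity, up to a positive factor.
  It decides stability where the first one vanishes.\<close>

lemma homological_6: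
  assumes "D = 4 / 3 * B * (4 * m + 1)"
  shows "p * V6q m B p q - q * V6p m B p q + V5p m B p q * (- 4 * p * q - B * p ^ 2) + V5q m B p q * (8 * m * p ^ 2)
     + V4p m B D p q * (- D * p ^ 3) + V4q m B D p q * (16 * m * p ^ 3)
     = 16 / 9 * B * (1 + 14 * m - 50 * m ^ 2) * (p ^ 2 + q ^ 2) ^ 3"
  unfolding V_defs V56_defs lyap1_def assms by algebra


section \<open>Zero trace, nonzero first Lyapunov coefficient\<close>

definition foc_Wp :: "real \<Rightarrow> real \<Rightarrow> real \<Rightarrow> real \<Rightarrow> real \<Rightarrow> real" where
  "foc_Wp m B D p q = 2 * p + V3p m B D p q + V4p m B D p q"

definition foc_Wq :: "real \<Rightarrow> real \<Rightarrow> real \<Rightarrow> real \<Rightarrow> real \<Rightarrow> real" where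
  "foc_Wq m B D p q = 2 * q + V3q m B D p q + V4q m B D p q"

definition foc_W :: "real \<Rightarrow> real \<Rightarrow> real \<Rightarrow> real \<times> real \<Rightarrow> real" where
  "foc_W m B D z = (fst z)\<^sup>2 + (snd z)\<^sup>2 + V3 m B D (fst z) (snd z) + V4 m B D (fst z) (snd z)"

definition foc_Wd :: "real \<Rightarrow> real \<Rightarrow> real \<Rightarrow> real \<times> real \<Rightarrow> real" where
  "foc_Wd m B D z = foc_Wp m B D (fst z) (snd z) * fst (hopf_field m B D 0 1 z)
     + foc_Wq m B D (fst z) (snd z) * snd (hopf_field m B D 0 1 z)"

definition foc_N :: "real \<Rightarrow> real \<Rightarrow> real \<Rightarrow> real \<Rightarrow> real \<Rightarrow> real \<Rightarrow> real" where
  "foc_N m B D \<rho> c s = V4p m B D c s * (- 4 * c * s - B * c ^ 2) + V4q m B D c s * (8 * m * c ^ 2)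
     + V3p m B D c s * (- D * c ^ 3) + V3q m B D c s * (16 * m * c ^ 3)
     + \<rho> * (V4p m B D c s * (- D * c ^ 3) + V4q m B D c s * (16 * m * c ^ 3))"

lemma V_homogeneous:
  "V3 m B D (\<rho> * c) (\<rho> * s) = \<rho> ^ 3 * V3 m B D c s" "V4 m B D (\<rho> * c) (\<rho> * s) = \<rho> ^ 4 * V4 m B D c s"
  "V3p m B D (\<rho> * c) (\<rho> * s) = \<rho> ^ 2 * V3p m B D c s" "V3q m B D (\<rho> * c) (\<rho> * s) = \<rho> ^ 2 * V3q m B D c s"
  "V4p m B D (\<rho> * c) (\<rho> * s) = \<rho> ^ 3 * V4p m B D c s" "V4q m B D (\<rho> * c) (\<rho> * s) = \<rho> ^ 3 * V4q m B D c s"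
  unfolding V_defs by (simp_all add: power_mult_distrib algebra_simps power2_eq_square power3_eq_cube power4_eq_xxxx)

lemma V56_homogeneous:
  "V5 m B (\<rho> * c) (\<rho> * s) = \<rho> ^ 5 * V5 m B c s" "V6 m B (\<rho> * c) (\<rho> * s) = \<rho> ^ 6 * V6 m B c s"
  "V5p m B (\<rho> * c) (\<rho> * s) = \<rho> ^ 4 * V5p m B c s" "V5q m B (\<rho> * c) (\<rho> * s) = \<rho> ^ 4 * V5q m B c s"
  "V6p m B (\<rho> * c) (\<rho> * s) = \<rho> ^ 5 * V6p m B c s" "V6q m B (\<rho> * c) (\<rho> * s) = \<rho> ^ 5 * V6q m B c s"
  unfolding V56_defs by algebra+

lemma polar_square_sum: "c\<^sup>2 + s\<^sup>2 = 1 \<Longrightarrow> (\<rho> * c)\<^sup>2 + (\<rho> * s)\<^sup>2 = (\<rho> :: real)\<^sup>2"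
  by (simp add: power_mult_distrib flip: distrib_left)

lemma foc_W_derivative:
  "(foc_W m B D has_derivative (\<lambda>d. foc_Wp m B D p q * fst d + foc_Wq m B D p q * snd d)) (at (p, q))"
proof -
  have "((\<lambda>z. (fst z)\<^sup>2 + (snd z)\<^sup>2) has_derivative (\<lambda>d. 2 * p * fst d + 2 * q * snd d)) (at (p, q))"
    by (rule derivative_eq_intros refl | simp)+ (auto simp: fun_eq_iff mult_ac)
  from has_derivative_add[OF has_derivative_add[OF this V3_derivative] V4_derivative]
  show ?thesis unfolding foc_W_def foc_Wp_def foc_Wq_def by (simp add: algebra_simps)
qed

lemma foc_Wd_polar:
  assumes "c\<^sup>2 + s\<^sup>2 = 1"
  shows "foc_Wd m B D (\<rho> * c, \<rho> * s) = \<rho> ^ 4 * (- lyap1 m B D + \<rho> * foc_N m B D \<rho> c s)"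
proof -
  define p q where "p = \<rho> * c" and "q = \<rho> * s"
  have "foc_Wd m B D (p, q) = - lyap1 m B D * (p ^ 2 + q ^ 2) ^ 2
     + (V4p m B D p q * (- 4 * p * q - B * p ^ 2) + V4q m B D p q * (8 * m * p ^ 2)
     + V3p m B D p q * (- D * p ^ 3) + V3q m B D p q * (16 * m * p ^ 3))
     + (V4p m B D p q * (- D * p ^ 3) + V4q m B D p q * (16 * m * p ^ 3))"
  proof -
    \<comment> \<open>The derivative is sorted by degree. The brackets of degree 3 and 4 are the
      left-hand sides of \<open>homological_3\<close> and \<open>homological_4\<close>; degrees 5
      and 6 form the remainder \<open>foc_N\<close>.\<close>
    have "foc_Wd m B D (p, q) = (p * V3q m B D p q - q * V3p m B D p q + 2 * p * (- 4 * p * q - B * p ^ 2) + 2 * q * (8 * m * p ^ 2))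
     + (p * V4q m B D p q - q * V4p m B D p q + V3p m B D p q * (- 4 * p * q - B * p ^ 2) + V3q m B D p q * (8 * m * p ^ 2)
     + 2 * p * (- D * p ^ 3) + 2 * q * (16 * m * p ^ 3))
     + (V4p m B D p q * (- 4 * p * q - B * p ^ 2) + V4q m B D p q * (8 * m * p ^ 2)
     + V3p m B D p q * (- D * p ^ 3) + V3q m B D p q * (16 * m * p ^ 3))
     + (V4p m B D p q * (- D * p ^ 3) + V4q m B D p q * (16 * m * p ^ 3))"
      unfolding foc_Wd_def foc_Wp_def foc_Wq_def hopf_field_critical fst_conv snd_conv by algebra
    then show ?thesis unfolding homological_3 homological_4 by simp
  qed
  also have "p ^ 2 + q ^ 2 = \<rho> ^ 2" unfolding p_def q_def by (rule polar_square_sum[OF assms])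
  finally show ?thesis
    unfolding p_def q_def V_homogeneous foc_N_def
    by (simp add: algebra_simps power_mult_distrib power2_eq_square power3_eq_cube power4_eq_xxxx)
qed

lemma foc_W_pos: "\<exists>r>0. \<forall>z. norm z \<le> r \<longrightarrow> z \<noteq> 0 \<longrightarrow> foc_W m B D z > 0"
proof (rule near_origin_pos[where N="\<lambda>\<rho> c s. V3 m B D c s + \<rho> * V4 m B D c s" and a=1 and n=2])
  show "continuous_on UNIV (\<lambda>x. V3 m B D (fst (snd x)) (snd (snd x)) + fst x * V4 m B D (fst (snd x)) (snd (snd x)))"
    unfolding V_defs by (intro continuous_intros)
  fix \<rho> c s :: real assume cs: "c\<^sup>2 + s\<^sup>2 = 1"
  show "\<rho>\<^sup>2 * (1 + \<rho> * (V3 m B D c s + \<rho> * V4 m B D c s)) \<le> foc_W m B D (\<rho> * c, \<rho> * s)"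
    unfolding foc_W_def fst_conv snd_conv V_homogeneous polar_square_sum[OF cs]
    by (simp add: algebra_simps power2_eq_square power3_eq_cube power4_eq_xxxx)
qed simp

lemma foc_N_continuous: "continuous_on UNIV (\<lambda>x. foc_N m B D (fst x) (fst (snd x)) (snd (snd x)))"
  unfolding foc_N_def V_defs by (intro continuous_intros)

lemma foc_Wd_continuous: "continuous_on UNIV (foc_Wd m B D)"
  unfolding foc_Wd_def foc_Wp_def foc_Wq_def V_defs by (intro continuous_intros hopf_field_continuous)

lemma unstable_of_lyap1_neg:
  assumes "affine_conj f p0 L Linv (hopf_field m B D 0 1) \<omega>" "lyap1 m B D < 0"
  shows "unstable f p0"
proof -
  have "\<exists>r>0. \<forall>z. norm z \<le> r \<longrightarrow> z \<noteq> 0 \<longrightarrow> foc_Wd m B D z > 0"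
    by (rule near_origin_pos[OF foc_N_continuous, where a="- lyap1 m B D" and n=4])
      (use assms in \<open>auto simp: foc_Wd_polar\<close>)
  with foc_W_pos obtain r where r: "r > 0" "\<And>z. norm z \<le> r \<Longrightarrow> z \<noteq> 0 \<Longrightarrow> foc_W m B D z > 0"
    "\<And>z. norm z \<le> r \<Longrightarrow> z \<noteq> 0 \<Longrightarrow> foc_Wd m B D z > 0" by (rule common_radius) blast
  show ?thesis
    by (rule affine_conj.unstable_conj[OF assms(1) foc_W_derivative _ foc_Wd_continuous _ hopf_field_zero r(1)])
      (use r in \<open>auto simp: foc_Wd_def foc_W_def V_defs\<close>)
qed

lemma asymptotically_stable_of_lyap1_pos:
  assumes "affine_conj f p0 L Linv (hopf_field m B D 0 1) \<omega>" "lyap1 m B D > 0"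
  shows "asymptotically_stable f p0"
proof -
  have "\<exists>r>0. \<forall>z. norm z \<le> r \<longrightarrow> z \<noteq> 0 \<longrightarrow> - foc_Wd m B D z > 0"
  proof (rule near_origin_pos[where N="\<lambda>\<rho> c s. - foc_N m B D \<rho> c s" and a="lyap1 m B D" and n=4])
    show "continuous_on UNIV (\<lambda>x. - foc_N m B D (fst x) (fst (snd x)) (snd (snd x)))"
      by (intro continuous_intros foc_N_continuous)
    show "\<rho> ^ 4 * (lyap1 m B D + \<rho> * - foc_N m B D \<rho> c s) \<le> - foc_Wd m B D (\<rho> * c, \<rho> * s)"
      if "c\<^sup>2 + s\<^sup>2 = 1" for \<rho> c s
      unfolding foc_Wd_polar[OF that] by (simp add: algebra_simps)
  qed (use assms in auto)
  with foc_W_pos obtain r where r: "r > 0" "\<And>z. norm z \<le> r \<Longrightarrow> z \<noteq> 0 \<Longrightarrow> foc_W m B D z > 0"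
    "\<And>z. norm z \<le> r \<Longrightarrow> z \<noteq> 0 \<Longrightarrow> - foc_Wd m B D z > 0" by (rule common_radius) blast
  have neg: "foc_Wd m B D z < 0" if "norm z \<le> r" "z \<noteq> 0" for z using r(3)[OF that] by simp
  show ?thesis
    by (rule affine_conj.asymptotically_stable_conj[OF assms(1) foc_W_derivative _ foc_Wd_continuous _ hopf_field_zero r(1)])
      (use r(2) neg in \<open>auto simp: foc_Wd_def foc_W_def V_defs\<close>)
qed

section \<open>The Bautin point\<close>

definition baut_Wp :: "real \<Rightarrow> real \<Rightarrow> real \<Rightarrow> real \<Rightarrow> real \<Rightarrow> real" where
  "baut_Wp m B D p q = foc_Wp m B D p q + V5p m B p q + V6p m B p q"

definition baut_Wq :: "real \<Rightarrow> real \<Rightarrow> real \<Rightarrow> real \<Rightarrow> real \<Rightarrow> real" where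
  "baut_Wq m B D p q = foc_Wq m B D p q + V5q m B p q + V6q m B p q"

definition baut_W :: "real \<Rightarrow> real \<Rightarrow> real \<Rightarrow> real \<times> real \<Rightarrow> real" where
  "baut_W m B D z = foc_W m B D z + V5 m B (fst z) (snd z) + V6 m B (fst z) (snd z)"

definition baut_Wd :: "real \<Rightarrow> real \<Rightarrow> real \<Rightarrow> real \<times> real \<Rightarrow> real" where
  "baut_Wd m B D z = baut_Wp m B D (fst z) (snd z) * fst (hopf_field m B D 0 1 z)
     + baut_Wq m B D (fst z) (snd z) * snd (hopf_field m B D 0 1 z)"

definition baut_N :: "real \<Rightarrow> real \<Rightarrow> real \<Rightarrow> real \<Rightarrow> real \<Rightarrow> real \<Rightarrow> real" where
  "baut_N m B D \<rho> c s = V6p m B c s * (- 4 * c * s - B * c ^ 2) + V6q m B c s * (8 * m * c ^ 2)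
     + V5p m B c s * (- D * c ^ 3) + V5q m B c s * (16 * m * c ^ 3)
     + \<rho> * (V6p m B c s * (- D * c ^ 3) + V6q m B c s * (16 * m * c ^ 3))"

lemma baut_W_derivative:
  "(baut_W m B D has_derivative (\<lambda>d. baut_Wp m B D p q * fst d + baut_Wq m B D p q * snd d)) (at (p, q))"
proof -
  from has_derivative_add[OF has_derivative_add[OF foc_W_derivative V5_derivative] V6_derivative]
  show ?thesis unfolding baut_W_def baut_Wp_def baut_Wq_def by (simp add: algebra_simps)
qed

lemma baut_Wd_polar:
  assumes "c\<^sup>2 + s\<^sup>2 = 1" and D: "D = 4 / 3 * B * (4 * m + 1)"
  shows "baut_Wd m B D (\<rho> * c, \<rho> * s) = \<rho> ^ 6 * (16 / 9 * B * (1 + 14 * m - 50 * m ^ 2) + \<rho> * baut_N m B D \<rho> c s)"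
proof -
  define p q where "p = \<rho> * c" and "q = \<rho> * s"
  have l: "lyap1 m B D = 0" unfolding lyap1_def D by (simp add: algebra_simps)
  have "baut_Wd m B D (p, q) = 16 / 9 * B * (1 + 14 * m - 50 * m ^ 2) * (p ^ 2 + q ^ 2) ^ 3
     + (V6p m B p q * (- 4 * p * q - B * p ^ 2) + V6q m B p q * (8 * m * p ^ 2)
     + V5p m B p q * (- D * p ^ 3) + V5q m B p q * (16 * m * p ^ 3))
     + (V6p m B p q * (- D * p ^ 3) + V6q m B p q * (16 * m * p ^ 3))"
  proof -
    have "baut_Wd m B D (p, q) = (p * V3q m B D p q - q * V3p m B D p q + 2 * p * (- 4 * p * q - B * p ^ 2) + 2 * q * (8 * m * p ^ 2))
     + (p * V4q m B D p q - q * V4p m B D p q + V3p m B D p q * (- 4 * p * q - B * p ^ 2) + V3q m B D p q * (8 * m * p ^ 2)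
     + 2 * p * (- D * p ^ 3) + 2 * q * (16 * m * p ^ 3))
     + (p * V5q m B p q - q * V5p m B p q + V4p m B D p q * (- 4 * p * q - B * p ^ 2) + V4q m B D p q * (8 * m * p ^ 2)
     + V3p m B D p q * (- D * p ^ 3) + V3q m B D p q * (16 * m * p ^ 3))
     + (p * V6q m B p q - q * V6p m B p q + V5p m B p q * (- 4 * p * q - B * p ^ 2) + V5q m B p q * (8 * m * p ^ 2)
     + V4p m B D p q * (- D * p ^ 3) + V4q m B D p q * (16 * m * p ^ 3))
     + (V6p m B p q * (- 4 * p * q - B * p ^ 2) + V6q m B p q * (8 * m * p ^ 2)
     + V5p m B p q * (- D * p ^ 3) + V5q m B p q * (16 * m * p ^ 3))
     + (V6p m B p q * (- D * p ^ 3) + V6q m B p q * (16 * m * p ^ 3))"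
      unfolding baut_Wd_def baut_Wp_def baut_Wq_def foc_Wp_def foc_Wq_def hopf_field_critical fst_conv snd_conv
      by algebra
    then show ?thesis unfolding homological_3 homological_4 homological_5[OF D] homological_6[OF D] l by simp
  qed
  also have "p ^ 2 + q ^ 2 = \<rho> ^ 2" unfolding p_def q_def by (rule polar_square_sum[OF assms(1)])
  finally show ?thesis
    unfolding p_def q_def V56_homogeneous baut_N_def by algebra
qed

lemma baut_W_pos: "\<exists>r>0. \<forall>z. norm z \<le> r \<longrightarrow> z \<noteq> 0 \<longrightarrow> baut_W m B D z > 0"
proof (rule near_origin_pos[where a=1 and n=2 and
      N="\<lambda>\<rho> c s. V3 m B D c s + \<rho> * V4 m B D c s + \<rho> ^ 2 * V5 m B c s + \<rho> ^ 3 * V6 m B c s"])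
  show "continuous_on UNIV (\<lambda>x. V3 m B D (fst (snd x)) (snd (snd x)) + fst x * V4 m B D (fst (snd x)) (snd (snd x))
      + (fst x)\<^sup>2 * V5 m B (fst (snd x)) (snd (snd x)) + fst x ^ 3 * V6 m B (fst (snd x)) (snd (snd x)))"
    unfolding V_defs V56_defs by (intro continuous_intros)
  fix \<rho> c s :: real assume cs: "c\<^sup>2 + s\<^sup>2 = 1"
  have "baut_W m B D (\<rho> * c, \<rho> * s) =
      \<rho>\<^sup>2 + \<rho> ^ 3 * V3 m B D c s + \<rho> ^ 4 * V4 m B D c s + \<rho> ^ 5 * V5 m B c s + \<rho> ^ 6 * V6 m B c s"
    unfolding baut_W_def foc_W_def fst_conv snd_conv V_homogeneous V56_homogeneous polar_square_sum[OF cs] ..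
  also have "\<dots> = \<rho>\<^sup>2 * (1 + \<rho> * (V3 m B D c s + \<rho> * V4 m B D c s + \<rho> ^ 2 * V5 m B c s + \<rho> ^ 3 * V6 m B c s))"
    by algebra
  finally show "\<rho>\<^sup>2 * (1 + \<rho> * (V3 m B D c s + \<rho> * V4 m B D c s + \<rho> ^ 2 * V5 m B c s + \<rho> ^ 3 * V6 m B c s))
      \<le> baut_W m B D (\<rho> * c, \<rho> * s)" by simp
qed simp

lemma baut_Wd_continuous: "continuous_on UNIV (baut_Wd m B D)"
  unfolding baut_Wd_def baut_Wp_def baut_Wq_def foc_Wp_def foc_Wq_def V_defs V56_defs
  by (intro continuous_intros hopf_field_continuous)

lemma asymptotically_stable_of_lyap2_pos:
  assumes "affine_conj f p0 L Linv (hopf_field m B D 0 1) \<omega>" "lyap1 m B D = 0" "B * (50 * m ^ 2 - 14 * m - 1) > 0"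
  shows "asymptotically_stable f p0"
proof -
  have D: "D = 4 / 3 * B * (4 * m + 1)" using assms(2) by (simp add: lyap1_def algebra_simps)
  have "\<exists>r>0. \<forall>z. norm z \<le> r \<longrightarrow> z \<noteq> 0 \<longrightarrow> - baut_Wd m B D z > 0"
  proof (rule near_origin_pos[where N="\<lambda>\<rho> c s. - baut_N m B D \<rho> c s" and a="16 / 9 * (B * (50 * m ^ 2 - 14 * m - 1))" and n=6])
    show "continuous_on UNIV (\<lambda>x. - baut_N m B D (fst x) (fst (snd x)) (snd (snd x)))"
      unfolding baut_N_def V56_defs by (intro continuous_intros)
    show "\<rho> ^ 6 * (16 / 9 * (B * (50 * m ^ 2 - 14 * m - 1)) + \<rho> * - baut_N m B D \<rho> c s) \<le> - baut_Wd m B D (\<rho> * c, \<rho> * s)"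
      if "c\<^sup>2 + s\<^sup>2 = 1" for \<rho> c s
      unfolding baut_Wd_polar[OF that D] by (simp add: algebra_simps)
  qed (use assms in auto)
  with baut_W_pos obtain r where r: "r > 0" "\<And>z. norm z \<le> r \<Longrightarrow> z \<noteq> 0 \<Longrightarrow> baut_W m B D z > 0"
    "\<And>z. norm z \<le> r \<Longrightarrow> z \<noteq> 0 \<Longrightarrow> - baut_Wd m B D z > 0" by (rule common_radius) blast
  have neg: "baut_Wd m B D z < 0" if "norm z \<le> r" "z \<noteq> 0" for z using r(3)[OF that] by simp
  show ?thesis
    by (rule affine_conj.asymptotically_stable_conj[OF assms(1) baut_W_derivative _ baut_Wd_continuous _ hopf_field_zero r(1)])
      (use r(2) neg in \<open>auto simp: baut_Wd_def baut_W_def foc_W_def V_defs V56_defs\<close>)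
qed

section \<open>Removing the scale of the blow-up\<close>

text \<open>The blow-up is absorbed into the chart and leaves f and \<open>p0\<close> unchanged, so
  a cycle found at scale e is a cycle of the original field.\<close>

lemma affine_conj_scale:
  assumes "affine_conj f p0 L Linv (hopf_field m B D \<mu> 1) \<omega>" "e > 0"
  shows "affine_conj f p0 (\<lambda>z. L (e *\<^sub>R z)) (\<lambda>z. (1 / e) *\<^sub>R Linv z) (hopf_field m B D \<mu> e) \<omega>"
proof -
  interpret affine_conj f p0 L Linv "hopf_field m B D \<mu> 1" \<omega> by (rule assms)
  have scale: "hopf_field m B D \<mu> 1 (e *\<^sub>R z) = e *\<^sub>R hopf_field m B D \<mu> e z" for z
    by (cases z) (simp add: hopf_field_def algebra_simps power2_eq_square power3_eq_cube)
  show ?thesis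
  proof (rule affine_conj.intro)
    show "bounded_linear (\<lambda>z. L (e *\<^sub>R z))"
      by (rule bounded_linear_compose[OF L(1) bounded_linear_scaleR_right])
    show "bounded_linear (\<lambda>z. (1 / e) *\<^sub>R Linv z)"
      by (rule bounded_linear_compose[OF bounded_linear_scaleR_right L(2)])
    show "L (e *\<^sub>R ((1 / e) *\<^sub>R Linv z)) = z" for z using assms(2) by (simp add: L(3))
    show "(1 / e) *\<^sub>R Linv (L (e *\<^sub>R z)) = z" for z using assms(2) by (simp add: L(4))
    show "f (p0 + L (e *\<^sub>R z)) = \<omega> *\<^sub>R L (e *\<^sub>R hopf_field m B D \<mu> e z)" for z
      unfolding conj scale ..
  qed (fact lip \<omega>)+
qed

lemma hopf_cycle_unscaled:
  fixes R k0 :: real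
  assumes k0: "k0 > 0"
  obtains \<mu>0 where "\<mu>0 > 0"
    "\<And>f p0 L Linv \<omega> m B D \<mu>. affine_conj f p0 L Linv (hopf_field m B D \<mu> 1) \<omega> \<Longrightarrow>
       k0 \<le> lyap1 m B D \<Longrightarrow> \<bar>m\<bar> \<le> R \<Longrightarrow> \<bar>B\<bar> \<le> R \<Longrightarrow> \<bar>D\<bar> \<le> R \<Longrightarrow> 0 < \<mu> \<Longrightarrow> \<mu> \<le> \<mu>0 \<Longrightarrow>
       \<exists>\<Gamma>. stable_limit_cycle f \<Gamma> \<and> surrounds \<Gamma> p0"
proof (rule hopf_cycle[OF k0, of R])
  fix e0 :: real
  assume e0: "e0 > 0" and cycle: "\<And>f p0 L Linv \<omega> m B D k e. affine_conj f p0 L Linv (hopf_field m B D (k * e ^ 2) e) \<omega> \<Longrightarrow>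
       k = lyap1 m B D \<Longrightarrow> k0 \<le> k \<Longrightarrow> \<bar>m\<bar> \<le> R \<Longrightarrow> \<bar>B\<bar> \<le> R \<Longrightarrow> \<bar>D\<bar> \<le> R \<Longrightarrow> 0 < e \<Longrightarrow> e \<le> e0 \<Longrightarrow>
       \<exists>\<Gamma>. stable_limit_cycle f \<Gamma> \<and> surrounds \<Gamma> p0"
  show thesis
  proof (rule that)
    \<comment> \<open>Since k >= \<open>k0\<close>, the bound mu <= \<open>k0 * e0\<^sup>2\<close>
      gives e = sqrt (mu / k) <= \<open>e0\<close> whatever the actual value of k.\<close>
    show "k0 * e0\<^sup>2 > 0" using k0 e0 by simp
    fix f p0 L Linv \<omega> m B D \<mu>
    assume conj: "affine_conj f p0 L Linv (hopf_field m B D \<mu> 1) \<omega>" and k: "k0 \<le> lyap1 m B D"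
      and par: "\<bar>m\<bar> \<le> R" "\<bar>B\<bar> \<le> R" "\<bar>D\<bar> \<le> R" and \<mu>: "0 < \<mu>" "\<mu> \<le> k0 * e0\<^sup>2"
    define k where "k = lyap1 m B D"
    have kp: "k > 0" using k k0 by (simp add: k_def)
    define e where "e = sqrt (\<mu> / k)"
    have e: "e > 0" "k * e\<^sup>2 = \<mu>" using kp \<mu> by (auto simp: e_def)
    have "\<mu> / k \<le> e0\<^sup>2"
    proof -
      have "\<mu> \<le> k * e0\<^sup>2" using \<mu>(2) mult_right_mono[OF k, of "e0\<^sup>2"] by (simp add: k_def)
      then show ?thesis using kp by (simp add: divide_le_eq mult.commute)
    qed
    then have "e \<le> e0" unfolding e_def using e0 by (simp add: real_le_lsqrt real_sqrt_le_iff real_le_rsqrt)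
    moreover have "affine_conj f p0 (\<lambda>z. L (e *\<^sub>R z)) (\<lambda>z. (1 / e) *\<^sub>R Linv z) (hopf_field m B D (k * e\<^sup>2) e) \<omega>"
      unfolding e(2) by (rule affine_conj_scale[OF conj e(1)])
    ultimately show "\<exists>\<Gamma>. stable_limit_cycle f \<Gamma> \<and> surrounds \<Gamma> p0"
      using cycle[OF _ k_def] k par e(1) by (simp add: k_def)
  qed
qed

section \<open>The planar system\<close>

definition par_\<omega> :: "real \<Rightarrow> real \<Rightarrow> real" where
  "par_\<omega> a b = sqrt (b * a * (1 + (a / 5)\<^sup>2))"

definition par_m :: "real \<Rightarrow> real" where
  "par_m a = (a / 5)\<^sup>2 / (1 + (a / 5)\<^sup>2)"

definition par_B :: "real \<Rightarrow> real \<Rightarrow> real" where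
  "par_B a b = 4 * (a / 5) * (b - 2 * (a / 5)) / par_\<omega> a b"

definition par_D :: "real \<Rightarrow> real \<Rightarrow> real" where
  "par_D a b = 16 * (a / 5)\<^sup>2 / par_\<omega> a b"

text \<open>The numerator is the trace of the linearization at \<open>P_eq a\<close>.\<close>

definition par_\<mu> :: "real \<Rightarrow> real \<Rightarrow> real" where
  "par_\<mu> a b = (3 * (a / 5)\<^sup>2 - 5 - b * (a / 5)) / par_\<omega> a b"

lemma par_\<omega>_pos: "a > 0 \<Longrightarrow> b > 0 \<Longrightarrow> par_\<omega> a b > 0"
  unfolding par_\<omega>_def by (simp add: add_pos_nonneg)

lemma lipschitz_on_balls_vf: "lipschitz_on_balls (vf a b)"
proof (rule lipschitz_on_balls_bl)
  fix R :: real
  show "bl (cball 0 R \<times> cball 0 R) (\<lambda>z. fst (vf a b z))" "bl (cball 0 R \<times> cball 0 R) (\<lambda>z. snd (vf a b z))"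
    unfolding vf_def case_prod_unfold fst_conv snd_conv by (intro bl_intros bl_fst bl_snd)+
qed

lemma lipschitz_on_balls_uminus:
  assumes "lipschitz_on_balls f"
  shows "lipschitz_on_balls (\<lambda>z. - f z)"
  unfolding lipschitz_on_balls_def
proof
  fix R
  obtain L where "L-lipschitz_on (cball 0 R) f" using assms unfolding lipschitz_on_balls_def by blast
  then have "L-lipschitz_on (cball 0 R) (\<lambda>z. - f z)"
    unfolding lipschitz_on_def by (simp add: dist_minus)
  then show "\<exists>L. L-lipschitz_on (cball 0 R) (\<lambda>z. - f z)" ..
qed

text \<open>The terms in x y cancel in the derivative of y - (b / 4) x, which is (b / 4) (1 + x^2)
  (5 x - a). This combination, centred and divided by \<omega>, is the coordinate q; therefore q'
  depends on p alone.\<close>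

definition vf_L :: "real \<Rightarrow> real \<Rightarrow> real \<times> real \<Rightarrow> real \<times> real" where
  "vf_L a b z = (4 * (a / 5) * fst z, b * (a / 5) * fst z + par_\<omega> a b * snd z)"

definition vf_Linv :: "real \<Rightarrow> real \<Rightarrow> real \<times> real \<Rightarrow> real \<times> real" where
  "vf_Linv a b z = (fst z / (4 * (a / 5)), (snd z - b / 4 * fst z) / par_\<omega> a b)"

lemma bounded_linear_coords:
  fixes A B C D :: real
  shows "bounded_linear (\<lambda>z :: real \<times> real. (A * fst z + B * snd z, C * fst z + D * snd z))"
  by (intro bounded_linear_Pair bounded_linear_add bounded_linear_const_mult bounded_linear_fst bounded_linear_snd)

lemma bounded_linear_vf_L: "bounded_linear (vf_L a b)" "bounded_linear (vf_Linv a b)"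
proof -
  have "vf_L a b = (\<lambda>z. (4 * (a / 5) * fst z + 0 * snd z, b * (a / 5) * fst z + par_\<omega> a b * snd z))"
    by (auto simp: vf_L_def)
  then show "bounded_linear (vf_L a b)" by (simp only: bounded_linear_coords)
  have "vf_Linv a b = (\<lambda>z. (1 / (4 * (a / 5)) * fst z + 0 * snd z, - (b / 4 / par_\<omega> a b) * fst z + 1 / par_\<omega> a b * snd z))"
    by (auto simp: vf_Linv_def diff_divide_distrib)
  then show "bounded_linear (vf_Linv a b)" by (simp only: bounded_linear_coords)
qed

lemma vf_conj_eq:
  assumes "a > 0" "b > 0"
  shows "vf a b (P_eq a + vf_L a b z) = par_\<omega> a b *\<^sub>R vf_L a b (hopf_field (par_m a) (par_B a b) (par_D a b) (par_\<mu> a b) 1 z)"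
proof -
  obtain p q where z: "z = (p, q)" by force
  define \<alpha> w m B D \<mu> where "\<alpha> = a / 5" and "w = par_\<omega> a b" and "m = par_m a" and "B = par_B a b"
    and "D = par_D a b" and "\<mu> = par_\<mu> a b"
  have a: "a = 5 * \<alpha>" by (simp add: \<alpha>_def)
  have w0: "w > 0" using par_\<omega>_pos[OF assms] by (simp add: w_def)
  have w2: "w * w = 5 * b * \<alpha> * (1 + \<alpha>\<^sup>2)"
    unfolding w_def par_\<omega>_def using assms by (simp add: \<alpha>_def field_simps)
  have m: "m * (1 + \<alpha>\<^sup>2) = \<alpha>\<^sup>2"
    using add_pos_nonneg[OF zero_less_one zero_le_power2[of \<alpha>]] unfolding m_def par_m_def \<alpha>_def by simp
  have B: "w * B = 4 * \<alpha> * (b - 2 * \<alpha>)" and D: "w * D = 16 * \<alpha>\<^sup>2" and \<mu>: "w * \<mu> = 3 * \<alpha>\<^sup>2 - 5 - b * \<alpha>"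
    using w0 unfolding B_def par_B_def D_def par_D_def \<mu>_def par_\<mu>_def w_def \<alpha>_def by simp_all
  define hp where "hp = - q * (1 + 4 * p) + \<mu> * p - B * p ^ 2 - D * p ^ 3"
  define hq where "hq = p * (1 + 8 * m * p + 16 * m * p ^ 2)"
  have h: "hopf_field m B D \<mu> 1 z = (hp, hq)" by (simp add: z hopf_field_def hp_def hq_def)
  define x y where "x = \<alpha> + 4 * \<alpha> * p" and "y = 1 + \<alpha>\<^sup>2 + b * \<alpha> * p + w * q"
  have xy: "P_eq a + vf_L a b z = (x, y)"
    by (simp add: P_eq_def vf_L_def z x_def y_def \<alpha>_def w_def power_divide)
  \<comment> \<open>Multiplying by w clears the denominators of mu, B and D; the remaining
    denominator 1 + \<alpha>^2 of m is cancelled by w^2. What is left are polynomial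
    identities.\<close>
  have whp: "w * hp = - w * q * (1 + 4 * p) + (3 * \<alpha>\<^sup>2 - 5 - b * \<alpha>) * p - 4 * \<alpha> * (b - 2 * \<alpha>) * p ^ 2 - 16 * \<alpha>\<^sup>2 * p ^ 3"
    unfolding hp_def B[symmetric] D[symmetric] \<mu>[symmetric] by algebra
  have whq: "w * (w * hq) = 5 * b * \<alpha> * p * (1 + \<alpha>\<^sup>2 + 8 * \<alpha>\<^sup>2 * p + 16 * \<alpha>\<^sup>2 * p ^ 2)"
  proof -
    have "w * (w * hq) = (w * w) * hq" by simp
    also have "\<dots> = 5 * b * \<alpha> * p * ((1 + \<alpha>\<^sup>2) + 8 * (m * (1 + \<alpha>\<^sup>2)) * p + 16 * (m * (1 + \<alpha>\<^sup>2)) * p ^ 2)"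
      unfolding w2 hq_def by algebra
    finally show ?thesis unfolding m by simp
  qed
  have 1: "(a - x) * (1 + x\<^sup>2) - 4 * x * y = 4 * \<alpha> * (w * hp)"
    unfolding whp x_def y_def a by algebra
  have "b * \<alpha> * (w * hp) + w * (w * hq) = b * x * (1 + x\<^sup>2 - y)"
    unfolding whp whq x_def y_def by algebra
  with 1 have "vf a b (x, y) = (w * (4 * \<alpha> * hp), w * (b * \<alpha> * hp + w * hq))"
    by (simp add: vf_def algebra_simps)
  then show ?thesis
    unfolding xy h[unfolded m_def B_def D_def \<mu>_def] by (simp add: vf_L_def w_def \<alpha>_def)
qed

lemma vf_L_inverse:
  assumes "a > 0" "b > 0"
  shows "vf_L a b (vf_Linv a b z) = z" "vf_Linv a b (vf_L a b z) = z"
  using assms par_\<omega>_pos[OF assms] by (auto simp: vf_L_def vf_Linv_def prod_eq_iff field_simps)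

lemma vf_affine_conj:
  assumes "a > 0" "b > 0"
  shows "affine_conj (vf a b) (P_eq a) (vf_L a b) (vf_Linv a b)
     (hopf_field (par_m a) (par_B a b) (par_D a b) (par_\<mu> a b) 1) (par_\<omega> a b)"
  by (rule affine_conj.intro)
    (simp_all add: lipschitz_on_balls_vf bounded_linear_vf_L vf_L_inverse[OF assms] par_\<omega>_pos[OF assms] vf_conj_eq[OF assms])

text \<open>Reversing time and reflecting \<open>q\<close> stays within the family: \<open>\<mu>\<close>, \<open>B\<close>, \<open>D\<close> and hence the
  first Lyapunov quantity change sign.\<close>
lemma hopf_field_reverse:
  "- hopf_field m B D \<mu> e (p, - q) = (fst (hopf_field m (- B) (- D) (- \<mu>) e (p, q)), - snd (hopf_field m (- B) (- D) (- \<mu>) e (p, q)))"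
  by (simp add: hopf_field_def algebra_simps)

lemma lyap1_reverse: "lyap1 m (- B) (- D) = - lyap1 m B D"
  by (simp add: lyap1_def algebra_simps)

lemma affine_conj_reverse:
  assumes "affine_conj f p0 L Linv (hopf_field m B D \<mu> e) \<omega>"
  shows "affine_conj (\<lambda>z. - f z) p0 (\<lambda>z. L (fst z, - snd z)) (\<lambda>z. (fst (Linv z), - snd (Linv z)))
    (hopf_field m (- B) (- D) (- \<mu>) e) \<omega>"
proof -
  interpret affine_conj f p0 L Linv "hopf_field m B D \<mu> e" \<omega> by (rule assms)
  have refl: "bounded_linear (\<lambda>z :: real \<times> real. (fst z, - snd z))"
    by (intro bounded_linear_Pair bounded_linear_minus bounded_linear_fst bounded_linear_snd)
  show ?thesis
  proof (rule affine_conj.intro)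
    show "lipschitz_on_balls (\<lambda>z. - f z)" by (rule lipschitz_on_balls_uminus[OF lip])
    show "bounded_linear (\<lambda>z. L (fst z, - snd z))" by (rule bounded_linear_compose[OF L(1) refl])
    show "bounded_linear (\<lambda>z. (fst (Linv z), - snd (Linv z)))" by (rule bounded_linear_compose[OF refl L(2)])
    show "- f (p0 + L (fst z, - snd z)) = \<omega> *\<^sub>R L (fst (hopf_field m (- B) (- D) (- \<mu>) e z), - snd (hopf_field m (- B) (- D) (- \<mu>) e z))" for z
    proof (cases z)
      case (Pair p q)
      have "- f (p0 + L (p, - q)) = \<omega> *\<^sub>R L (- hopf_field m B D \<mu> e (p, - q))"
        unfolding conj by (simp add: linear_neg bounded_linear.linear[OF L(1)])
      then show ?thesis unfolding hopf_field_reverse by (simp add: Pair)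
    qed
  qed (simp_all add: L \<omega>)
qed

lemma vf_equilibrium:
  assumes "a > 0" "b > 0"
  shows "equilibrium (vf a b) p \<longleftrightarrow> p = P_eq a"
proof (cases p)
  case (Pair x y)
  have "(a - x) * (1 + x\<^sup>2) - 4 * x * y = 0 \<and> b * x * (1 + x\<^sup>2 - y) = 0 \<longleftrightarrow> x = a / 5 \<and> y = 1 + x\<^sup>2"
  proof
    assume *: "(a - x) * (1 + x\<^sup>2) - 4 * x * y = 0 \<and> b * x * (1 + x\<^sup>2 - y) = 0"
    have "x \<noteq> 0" using * assms by auto
    then have y: "y = 1 + x\<^sup>2" using * assms by simp
    have "(a - 5 * x) * (1 + x\<^sup>2) = 0" using * unfolding y by (simp add: algebra_simps)
    moreover have "1 + x\<^sup>2 \<noteq> 0" using add_pos_nonneg[OF zero_less_one zero_le_power2[of x]] by linarith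
    ultimately show "x = a / 5 \<and> y = 1 + x\<^sup>2" using y by auto
  next
    assume *: "x = a / 5 \<and> y = 1 + x\<^sup>2"
    then have "(a - x) * (1 + x\<^sup>2) - 4 * x * y = (a - 5 * x) * (1 + x\<^sup>2)" by (simp add: algebra_simps)
    then show "(a - x) * (1 + x\<^sup>2) - 4 * x * y = 0 \<and> b * x * (1 + x\<^sup>2 - y) = 0" using * by simp
  qed
  then show ?thesis
    by (auto simp: Pair equilibrium_def vf_def P_eq_def zero_prod_def power_divide)
qed

section \<open>Signs of trace and Lyapunov quantities on the Hopf curve\<close>

lemma par_\<mu>_eq:
  assumes "a > 0" "b > 0"
  shows "par_\<mu> a b = (a / 5) * (b_H a - b) / par_\<omega> a b"
proof -
  have eq: "(a / 5) * (b_H a - b) = 3 * (a / 5)\<^sup>2 - 5 - b * (a / 5)"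
    using assms by (simp add: b_H_def field_simps power2_eq_square)
  show ?thesis unfolding eq par_\<mu>_def ..
qed

lemma par_\<mu>_sign:
  assumes "a > 0" "b > 0"
  shows "par_\<mu> a b > 0 \<longleftrightarrow> b < b_H a" "par_\<mu> a b < 0 \<longleftrightarrow> b > b_H a" "par_\<mu> a b = 0 \<longleftrightarrow> b = b_H a"
  using assms par_\<omega>_pos[OF assms] unfolding par_\<mu>_eq[OF assms]
  by (auto simp: zero_less_divide_iff divide_less_0_iff zero_less_mult_iff mult_less_0_iff)

lemma b_H_pos:
  assumes "a > 5 * sqrt (5 / 3)"
  shows "a > 0" "b_H a > 0"
proof -
  show a: "a > 0" using assms by (smt (verit) real_sqrt_ge_zero zero_le_divide_iff)
  have "(5 * sqrt (5 / 3))\<^sup>2 < a\<^sup>2" using assms by (intro power_strict_mono) auto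
  then have "125 < 3 * a\<^sup>2" by (simp add: power_mult_distrib)
  then show "b_H a > 0" using a by (simp add: b_H_def)
qed

text \<open>On the Hopf curve b \<alpha> = 3 x - 5 with \<alpha> = a / 5 and x = \<alpha>^2, so
  apart from \<omega> everything depends on x. Clearing the positive factor \<omega> (1 + x) leaves
  a quadratic in x, whose positive root gives \<open>a_B\<close>.\<close>

lemma par_lyap1:
  assumes "a > 0" "b_H a > 0"
  defines "x \<equiv> (a / 5)\<^sup>2"
  shows "lyap1 (par_m a) (par_B a (b_H a)) (par_D a (b_H a)) * (par_\<omega> a (b_H a) * (1 + x)) = 4 * (5 + 27 * x - 2 * x\<^sup>2)"
    and "par_B a (b_H a) = 4 * (x - 5) / par_\<omega> a (b_H a)"
proof -
  define b w where "b = b_H a" and "w = par_\<omega> a b"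
  have w: "w > 0" using par_\<omega>_pos[of a b] assms by (simp add: w_def b_def)
  have b: "(a / 5) * (b - 2 * (a / 5)) = x - 5"
    using assms(1) by (simp add: b_def b_H_def x_def field_simps power2_eq_square)
  have B: "par_B a b = 4 * (x - 5) / w"
    unfolding par_B_def w_def[symmetric] b[symmetric] by simp
  then show "par_B a (b_H a) = 4 * (x - 5) / par_\<omega> a (b_H a)" by (simp add: w_def b_def)
  have D: "par_D a b = 16 * x / w" by (simp add: par_D_def x_def w_def)
  have x1: "1 + x > 0" by (simp add: x_def add_pos_nonneg)
  have m: "par_m a = x / (1 + x)" by (simp add: par_m_def x_def)
  have "lyap1 (par_m a) (par_B a b) (par_D a b) * (w * (1 + x)) =
      12 * x * (1 + x) - 4 * (x - 5) * ((1 + x) + 4 * x)"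
    unfolding lyap1_def B D m using w x1 by (simp add: divide_simps)
  also have "\<dots> = 4 * (5 + 27 * x - 2 * x\<^sup>2)" by (simp add: algebra_simps power2_eq_square)
  finally show "lyap1 (par_m a) (par_B a (b_H a)) (par_D a (b_H a)) * (par_\<omega> a (b_H a) * (1 + x)) = 4 * (5 + 27 * x - 2 * x\<^sup>2)"
    by (simp add: w_def b_def)
qed

lemma bautin_sign:
  assumes "a > 0"
  defines "x \<equiv> (a / 5)\<^sup>2"
  shows "a < a_B \<longleftrightarrow> 5 + 27 * x - 2 * x\<^sup>2 > 0" "a = a_B \<longleftrightarrow> 5 + 27 * x - 2 * x\<^sup>2 = 0" "a > a_B \<longleftrightarrow> 5 + 27 * x - 2 * x\<^sup>2 < 0"
proof -
  define s where "s = sqrt 769"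
  have s: "s\<^sup>2 = 769" "s > 27"
    unfolding s_def by (simp, rule real_less_rsqrt, simp)
  have aB: "(a_B / 5)\<^sup>2 = (27 + s) / 4" "a_B > 0"
    using s(2) by (simp_all add: a_B_def power_divide s_def)
  define xB where "xB = (27 + s) / 4"
  \<comment> \<open>The other root (27 - sqrt 769) / 4 is negative because sqrt 769 > 27, so only
    the factor xB - x changes sign for x >= 0.\<close>
  have f: "5 + 27 * x - 2 * x\<^sup>2 = 2 * (xB - x) * (x + (s - 27) / 4)"
    using s(1) unfolding xB_def by (simp add: field_simps power2_eq_square)
  have p: "x + (s - 27) / 4 > 0" using s(2) by (simp add: x_def add_nonneg_pos)
  have lt: "a < a_B \<longleftrightarrow> x < xB" and gt: "a > a_B \<longleftrightarrow> x > xB"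
  proof -
    have sq: "u < v \<longleftrightarrow> u\<^sup>2 < v\<^sup>2" if "0 \<le> u" "0 \<le> v" for u v :: real
      using power2_less_imp_less[of u v] power_strict_mono[of u v 2] that by auto
    have "a / 5 < a_B / 5 \<longleftrightarrow> (a / 5)\<^sup>2 < (a_B / 5)\<^sup>2" "a_B / 5 < a / 5 \<longleftrightarrow> (a_B / 5)\<^sup>2 < (a / 5)\<^sup>2"
      by (rule sq, use assms(1) aB(2) in simp, use assms(1) aB(2) in simp)+
    then show "a < a_B \<longleftrightarrow> x < xB" "a > a_B \<longleftrightarrow> x > xB" unfolding aB(1) x_def xB_def by simp_all
  qed
  show "a < a_B \<longleftrightarrow> 5 + 27 * x - 2 * x\<^sup>2 > 0" "a > a_B \<longleftrightarrow> 5 + 27 * x - 2 * x\<^sup>2 < 0"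
    unfolding lt gt f using p by (auto simp: zero_less_mult_iff mult_less_0_iff)
  then show "a = a_B \<longleftrightarrow> 5 + 27 * x - 2 * x\<^sup>2 = 0" by linarith
qed

lemma par_lyap1_sign:
  assumes "a > 5 * sqrt (5 / 3)"
  defines "l \<equiv> lyap1 (par_m a) (par_B a (b_H a)) (par_D a (b_H a))"
  shows "a < a_B \<Longrightarrow> l > 0" "a = a_B \<Longrightarrow> l = 0" "a > a_B \<Longrightarrow> l < 0"
proof -
  note pos = b_H_pos[OF assms(1)]
  define K where "K = par_\<omega> a (b_H a) * (1 + (a / 5)\<^sup>2)"
  have K: "K > 0" unfolding K_def using par_\<omega>_pos[OF pos] by (intro mult_pos_pos add_pos_nonneg) auto
  have l: "l * K = 4 * (5 + 27 * (a / 5)\<^sup>2 - 2 * ((a / 5)\<^sup>2)\<^sup>2)"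
    unfolding l_def K_def by (rule par_lyap1(1)[OF pos])
  have "a < a_B \<Longrightarrow> l * K > 0" "a = a_B \<Longrightarrow> l * K = 0" "a > a_B \<Longrightarrow> l * K < 0"
    unfolding l using bautin_sign[OF pos(1)] by simp_all
  then show "a < a_B \<Longrightarrow> l > 0" "a = a_B \<Longrightarrow> l = 0" "a > a_B \<Longrightarrow> l < 0"
    using K by (auto simp: zero_less_mult_iff mult_less_0_iff)
qed

text \<open>The crude bound x > 5 suffices: it gives B > 0 and m > 1/2, and then m (50 m - 14) >=
  11/2 > 1.\<close>

lemma bautin_lyap2:
  assumes "a > 5 * sqrt (5 / 3)" "a = a_B"
  shows "par_B a (b_H a) * (50 * (par_m a)\<^sup>2 - 14 * par_m a - 1) > 0"
proof -
  note pos = b_H_pos[OF assms(1)]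
  define x where "x = (a / 5)\<^sup>2"
  define s where "s = sqrt 769"
  have s: "s \<ge> 0" by (simp add: s_def)
  have "x = (27 + s) / 4" unfolding x_def assms(2) a_B_def using s by (simp add: power_divide s_def)
  then have x: "x > 5" using s by (simp add: field_simps)
  have B: "par_B a (b_H a) > 0"
    using par_lyap1(2)[OF pos] x par_\<omega>_pos[OF pos] by (simp flip: x_def)
  have "1 / 2 < x / (1 + x)" using x by (simp add: divide_simps)
  then have m: "par_m a > 1 / 2" unfolding par_m_def x_def .
  then have "par_m a * (50 * par_m a - 14) \<ge> (1 / 2) * 11" by (intro mult_mono) auto
  then have "50 * (par_m a)\<^sup>2 - 14 * par_m a - 1 > 0" by (simp add: algebra_simps power2_eq_square)
  then show ?thesis using B by simp
qed

section \<open>Parameter neighbourhoods and the claims for the planar system\<close>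

lemma par_tendsto:
  assumes "a0 > 0" "b0 > 0"
  shows "((\<lambda>z. par_m (fst z)) \<longlongrightarrow> par_m a0) (nhds (a0, b0))"
    "((\<lambda>z. par_B (fst z) (snd z)) \<longlongrightarrow> par_B a0 b0) (nhds (a0, b0))"
    "((\<lambda>z. par_D (fst z) (snd z)) \<longlongrightarrow> par_D a0 b0) (nhds (a0, b0))"
    "((\<lambda>z. par_\<mu> (fst z) (snd z)) \<longlongrightarrow> par_\<mu> a0 b0) (nhds (a0, b0))"
proof -
  have fs: "(fst \<longlongrightarrow> a0) (nhds (a0, b0))" "(snd \<longlongrightarrow> b0) (nhds (a0, b0))"
    using tendsto_fst[OF filterlim_ident, of "(a0, b0)"] tendsto_snd[OF filterlim_ident, of "(a0, b0)"] by simp_all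
  have n: "1 + (a0 / 5)\<^sup>2 \<noteq> 0" using add_pos_nonneg[OF zero_less_one zero_le_power2[of "a0 / 5"]] by linarith
  have w: "((\<lambda>z. par_\<omega> (fst z) (snd z)) \<longlongrightarrow> par_\<omega> a0 b0) (nhds (a0, b0))"
    unfolding par_\<omega>_def by (intro tendsto_intros fs) auto
  have wn: "par_\<omega> a0 b0 \<noteq> 0" using par_\<omega>_pos[OF assms] by simp
  show "((\<lambda>z. par_m (fst z)) \<longlongrightarrow> par_m a0) (nhds (a0, b0))"
    unfolding par_m_def by (intro tendsto_intros fs n) auto
  show "((\<lambda>z. par_B (fst z) (snd z)) \<longlongrightarrow> par_B a0 b0) (nhds (a0, b0))"
    "((\<lambda>z. par_D (fst z) (snd z)) \<longlongrightarrow> par_D a0 b0) (nhds (a0, b0))"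
    "((\<lambda>z. par_\<mu> (fst z) (snd z)) \<longlongrightarrow> par_\<mu> a0 b0) (nhds (a0, b0))"
    unfolding par_B_def par_D_def par_\<mu>_def by (intro tendsto_intros fs w wn; simp)+
qed

text \<open>The sign c is 1 for the stable cycle and -1 for the unstable one, where time reversal
  negates the first Lyapunov quantity.\<close>

lemma par_neighbourhood:
  assumes "a0 > 0" "b0 > 0" "par_\<mu> a0 b0 = 0" "\<mu>0 > 0"
    and "c * lyap1 (par_m a0) (par_B a0 b0) (par_D a0 b0) > k0"
    and "\<bar>par_m a0\<bar> < R" "\<bar>par_B a0 b0\<bar> < R" "\<bar>par_D a0 b0\<bar> < R"
  obtains U where "open U" "(a0, b0) \<in> U"
    "\<And>a b. (a, b) \<in> U \<Longrightarrow> \<bar>par_\<mu> a b\<bar> < \<mu>0 \<and> k0 < c * lyap1 (par_m a) (par_B a b) (par_D a b) \<and>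
       \<bar>par_m a\<bar> < R \<and> \<bar>par_B a b\<bar> < R \<and> \<bar>par_D a b\<bar> < R"
proof -
  note t = par_tendsto[OF assms(1,2)]
  have k: "((\<lambda>z. c * lyap1 (par_m (fst z)) (par_B (fst z) (snd z)) (par_D (fst z) (snd z))) \<longlongrightarrow>
      c * lyap1 (par_m a0) (par_B a0 b0) (par_D a0 b0)) (nhds (a0, b0))"
    unfolding lyap1_def by (intro tendsto_intros t)
  have "\<forall>\<^sub>F z in nhds (a0, b0). \<bar>par_\<mu> (fst z) (snd z)\<bar> < \<mu>0 \<and>
      k0 < c * lyap1 (par_m (fst z)) (par_B (fst z) (snd z)) (par_D (fst z) (snd z)) \<and>
      \<bar>par_m (fst z)\<bar> < R \<and> \<bar>par_B (fst z) (snd z)\<bar> < R \<and> \<bar>par_D (fst z) (snd z)\<bar> < R"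
    by (intro eventually_conj order_tendstoD(1)[OF k assms(5)] order_tendstoD(2)[OF tendsto_rabs[OF t(1)] assms(6)]
        order_tendstoD(2)[OF tendsto_rabs[OF t(2)] assms(7)] order_tendstoD(2)[OF tendsto_rabs[OF t(3)] assms(8)]
        order_tendstoD(2)[OF tendsto_rabs[OF t(4)]]) (use assms in simp)
  then obtain U where U: "open U" "(a0, b0) \<in> U" "\<forall>z\<in>U. \<bar>par_\<mu> (fst z) (snd z)\<bar> < \<mu>0 \<and>
      k0 < c * lyap1 (par_m (fst z)) (par_B (fst z) (snd z)) (par_D (fst z) (snd z)) \<and>
      \<bar>par_m (fst z)\<bar> < R \<and> \<bar>par_B (fst z) (snd z)\<bar> < R \<and> \<bar>par_D (fst z) (snd z)\<bar> < R"
    unfolding eventually_nhds by blast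
  show ?thesis by (rule that[OF U(1,2)]) (use U(3) in auto)
qed

lemma H_minus_stable:
  assumes "5 * sqrt (5 / 3) < a" "a \<le> a_B"
  shows "asymptotically_stable (vf a (b_H a)) (P_eq a)"
proof -
  note pos = b_H_pos[OF assms(1)]
  have "par_\<mu> a (b_H a) = 0" using par_\<mu>_sign(3)[OF pos] by simp
  with vf_affine_conj[OF pos] have conj: "affine_conj (vf a (b_H a)) (P_eq a) (vf_L a (b_H a)) (vf_Linv a (b_H a))
     (hopf_field (par_m a) (par_B a (b_H a)) (par_D a (b_H a)) 0 1) (par_\<omega> a (b_H a))" by simp
  show ?thesis
  proof (cases "a = a_B")
    case True
    from asymptotically_stable_of_lyap2_pos[OF conj par_lyap1_sign(2)[OF assms(1) True] bautin_lyap2[OF assms(1) True]]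
    show ?thesis .
  next
    case False
    then have "a < a_B" using assms(2) by simp
    from asymptotically_stable_of_lyap1_pos[OF conj par_lyap1_sign(1)[OF assms(1) this]] show ?thesis .
  qed
qed

lemma a_B_gt: "5 * sqrt (5 / 3) < a_B"
proof -
  have "sqrt (5 / 3) < sqrt (27 + sqrt 769) / 2"
  proof -
    have "0 \<le> sqrt (769 :: real)" by simp
    then have "4 * (5 / 3) < 27 + sqrt 769" by linarith
    then have "sqrt (4 * (5 / 3)) < sqrt (27 + sqrt 769)" by (rule real_sqrt_less_mono)
    then show ?thesis unfolding real_sqrt_mult by simp
  qed
  then show ?thesis by (simp add: a_B_def)
qed

lemma H_plus_unstable:
  assumes "a > a_B"
  shows "unstable (vf a (b_H a)) (P_eq a)"
proof -
  have a: "5 * sqrt (5 / 3) < a" using a_B_gt assms by linarith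
  note pos = b_H_pos[OF a]
  have "par_\<mu> a (b_H a) = 0" using par_\<mu>_sign(3)[OF pos] by simp
  with vf_affine_conj[OF pos] have conj: "affine_conj (vf a (b_H a)) (P_eq a) (vf_L a (b_H a)) (vf_Linv a (b_H a))
     (hopf_field (par_m a) (par_B a (b_H a)) (par_D a (b_H a)) 0 1) (par_\<omega> a (b_H a))" by simp
  from unstable_of_lyap1_neg[OF conj par_lyap1_sign(3)[OF a assms]] show ?thesis .
qed

lemma H_minus_cycle:
  assumes "5 * sqrt (5 / 3) < a0" "a0 < a_B"
  obtains U where "open U" "(a0, b_H a0) \<in> U"
    "\<And>a b. (a, b) \<in> U \<Longrightarrow> a > 0 \<Longrightarrow> b > 0 \<Longrightarrow> b < b_H a \<Longrightarrow> unstable (vf a b) (P_eq a) \<and>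
       (\<exists>\<Gamma>. stable_limit_cycle (vf a b) \<Gamma> \<and> surrounds \<Gamma> (P_eq a))"
proof -
  note pos = b_H_pos[OF assms(1)]
  define k0 where "k0 = lyap1 (par_m a0) (par_B a0 (b_H a0)) (par_D a0 (b_H a0)) / 2"
  have k0: "k0 > 0" using par_lyap1_sign(1)[OF assms] by (simp add: k0_def)
  define R where "R = \<bar>par_m a0\<bar> + \<bar>par_B a0 (b_H a0)\<bar> + \<bar>par_D a0 (b_H a0)\<bar> + 1"
  obtain \<mu>0 where \<mu>0: "\<mu>0 > 0" and cycle:
    "\<And>f p0 L Linv \<omega> m B D \<mu>. affine_conj f p0 L Linv (hopf_field m B D \<mu> 1) \<omega> \<Longrightarrow>
       k0 \<le> lyap1 m B D \<Longrightarrow> \<bar>m\<bar> \<le> R \<Longrightarrow> \<bar>B\<bar> \<le> R \<Longrightarrow> \<bar>D\<bar> \<le> R \<Longrightarrow> 0 < \<mu> \<Longrightarrow> \<mu> \<le> \<mu>0 \<Longrightarrow>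
       \<exists>\<Gamma>. stable_limit_cycle f \<Gamma> \<and> surrounds \<Gamma> p0"
    using hopf_cycle_unscaled[OF k0, of R] by blast
  have "par_\<mu> a0 (b_H a0) = 0" using par_\<mu>_sign(3)[OF pos] by simp
  \<comment> \<open>The cycle requires mu <= \<open>\<mu>0\<close>, the quadratic Lyapunov function
    behind the instability of the equilibrium requires mu <= 1.\<close>
  moreover have "min \<mu>0 1 > 0" using \<mu>0 by simp
  moreover have "1 * lyap1 (par_m a0) (par_B a0 (b_H a0)) (par_D a0 (b_H a0)) > k0" using k0 by (simp add: k0_def)
  moreover have "\<bar>par_m a0\<bar> < R" "\<bar>par_B a0 (b_H a0)\<bar> < R" "\<bar>par_D a0 (b_H a0)\<bar> < R" by (auto simp: R_def)
  ultimately obtain U where U: "open U" "(a0, b_H a0) \<in> U"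
    "\<And>a b. (a, b) \<in> U \<Longrightarrow> \<bar>par_\<mu> a b\<bar> < min \<mu>0 1 \<and> k0 < 1 * lyap1 (par_m a) (par_B a b) (par_D a b) \<and>
       \<bar>par_m a\<bar> < R \<and> \<bar>par_B a b\<bar> < R \<and> \<bar>par_D a b\<bar> < R"
    using par_neighbourhood[OF pos] by blast
  show ?thesis
  proof (rule that[OF U(1,2)])
    fix a b assume ab: "(a, b) \<in> U" "a > 0" "b > 0" "b < b_H a"
    note u = U(3)[OF ab(1)]
    have \<mu>: "0 < par_\<mu> a b" "par_\<mu> a b \<le> 1" "par_\<mu> a b \<le> \<mu>0"
      using par_\<mu>_sign(1)[OF ab(2,3)] ab(4) u by auto
    note conj = vf_affine_conj[OF ab(2,3)]
    have "\<exists>\<Gamma>. stable_limit_cycle (vf a b) \<Gamma> \<and> surrounds \<Gamma> (P_eq a)"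
      by (rule cycle[OF conj]) (use u \<mu> in auto)
    then show "unstable (vf a b) (P_eq a) \<and> (\<exists>\<Gamma>. stable_limit_cycle (vf a b) \<Gamma> \<and> surrounds \<Gamma> (P_eq a))"
      using unstable_of_trace_pos[OF conj \<mu>(1,2)] by blast
  qed
qed

lemma H_plus_cycle:
  assumes "a0 > a_B"
  obtains U where "open U" "(a0, b_H a0) \<in> U"
    "\<And>a b. (a, b) \<in> U \<Longrightarrow> a > 0 \<Longrightarrow> b > 0 \<Longrightarrow> b > b_H a \<Longrightarrow> asymptotically_stable (vf a b) (P_eq a) \<and>
       (\<exists>\<Gamma>. unstable_limit_cycle (vf a b) \<Gamma> \<and> surrounds \<Gamma> (P_eq a))"
proof -
  have a0: "5 * sqrt (5 / 3) < a0" using a_B_gt assms by linarith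
  note pos = b_H_pos[OF a0]
  define k0 where "k0 = - lyap1 (par_m a0) (par_B a0 (b_H a0)) (par_D a0 (b_H a0)) / 2"
  have k0: "k0 > 0" using par_lyap1_sign(3)[OF a0 assms] by (simp add: k0_def)
  define R where "R = \<bar>par_m a0\<bar> + \<bar>par_B a0 (b_H a0)\<bar> + \<bar>par_D a0 (b_H a0)\<bar> + 1"
  obtain \<mu>0 where \<mu>0: "\<mu>0 > 0" and cycle:
    "\<And>f p0 L Linv \<omega> m B D \<mu>. affine_conj f p0 L Linv (hopf_field m B D \<mu> 1) \<omega> \<Longrightarrow>
       k0 \<le> lyap1 m B D \<Longrightarrow> \<bar>m\<bar> \<le> R \<Longrightarrow> \<bar>B\<bar> \<le> R \<Longrightarrow> \<bar>D\<bar> \<le> R \<Longrightarrow> 0 < \<mu> \<Longrightarrow> \<mu> \<le> \<mu>0 \<Longrightarrow>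
       \<exists>\<Gamma>. stable_limit_cycle f \<Gamma> \<and> surrounds \<Gamma> p0"
    using hopf_cycle_unscaled[OF k0, of R] by blast
  have "par_\<mu> a0 (b_H a0) = 0" using par_\<mu>_sign(3)[OF pos] by simp
  moreover have "min \<mu>0 1 > 0" using \<mu>0 by simp
  moreover have "(-1) * lyap1 (par_m a0) (par_B a0 (b_H a0)) (par_D a0 (b_H a0)) > k0" using k0 by (simp add: k0_def)
  moreover have "\<bar>par_m a0\<bar> < R" "\<bar>par_B a0 (b_H a0)\<bar> < R" "\<bar>par_D a0 (b_H a0)\<bar> < R" by (auto simp: R_def)
  ultimately obtain U where U: "open U" "(a0, b_H a0) \<in> U"
    "\<And>a b. (a, b) \<in> U \<Longrightarrow> \<bar>par_\<mu> a b\<bar> < min \<mu>0 1 \<and> k0 < (-1) * lyap1 (par_m a) (par_B a b) (par_D a b) \<and>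
       \<bar>par_m a\<bar> < R \<and> \<bar>par_B a b\<bar> < R \<and> \<bar>par_D a b\<bar> < R"
    using par_neighbourhood[OF pos] by blast
  show ?thesis
  proof (rule that[OF U(1,2)])
    fix a b assume ab: "(a, b) \<in> U" "a > 0" "b > 0" "b > b_H a"
    note u = U(3)[OF ab(1)]
    have \<mu>: "par_\<mu> a b < 0" "- 1 \<le> par_\<mu> a b" "- par_\<mu> a b \<le> \<mu>0"
      using par_\<mu>_sign(2)[OF ab(2,3)] ab(4) u by auto
    note conj = vf_affine_conj[OF ab(2,3)]
    \<comment> \<open>Time is reversed for the cycle only; stability of the equilibrium follows from
      the negative trace of the original field.\<close>
    have "\<exists>\<Gamma>. stable_limit_cycle (\<lambda>z. - vf a b z) \<Gamma> \<and> surrounds \<Gamma> (P_eq a)"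
      by (rule cycle[OF affine_conj_reverse[OF conj]]) (use u \<mu> in \<open>auto simp: lyap1_reverse\<close>)
    then have "\<exists>\<Gamma>. unstable_limit_cycle (vf a b) \<Gamma> \<and> surrounds \<Gamma> (P_eq a)"
      using unstable_limit_cycle_reverse by blast
    then show "asymptotically_stable (vf a b) (P_eq a) \<and> (\<exists>\<Gamma>. unstable_limit_cycle (vf a b) \<Gamma> \<and> surrounds \<Gamma> (P_eq a))"
      using asymptotically_stable_of_trace_neg[OF conj \<mu>(1,2)] by blast
  qed
qed

theorem mainTheorem6:
  "(\<forall>a>0. \<forall>b>0. \<forall>p. equilibrium (vf a b) p \<longleftrightarrow> p = P_eq a) \<and>
   (\<forall>(a, b)\<in>H_minus. asymptotically_stable (vf a b) (P_eq a)) \<and>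
   (\<forall>(a, b)\<in>H_plus. unstable (vf a b) (P_eq a)) \<and>
   (\<forall>(a0, b0)\<in>H_minus - {B_point}. \<exists>U. open U \<and> (a0, b0) \<in> U \<and>
      (\<forall>(a, b)\<in>U. a > 0 \<longrightarrow> b > 0 \<longrightarrow> b < b_H a \<longrightarrow>
         unstable (vf a b) (P_eq a) \<and>
         (\<exists>\<Gamma>. stable_limit_cycle (vf a b) \<Gamma> \<and> surrounds \<Gamma> (P_eq a)))) \<and>
   (\<forall>(a0, b0)\<in>H_plus. \<exists>U. open U \<and> (a0, b0) \<in> U \<and>
      (\<forall>(a, b)\<in>U. a > 0 \<longrightarrow> b > 0 \<longrightarrow> b > b_H a \<longrightarrow>
         asymptotically_stable (vf a b) (P_eq a) \<and>
         (\<exists>\<Gamma>. unstable_limit_cycle (vf a b) \<Gamma> \<and> surrounds \<Gamma> (P_eq a))))"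
proof (intro conjI)
  show "\<forall>a>0. \<forall>b>0. \<forall>p. equilibrium (vf a b) p \<longleftrightarrow> p = P_eq a" using vf_equilibrium by blast
  show "\<forall>(a, b)\<in>H_minus. asymptotically_stable (vf a b) (P_eq a)"
    using H_minus_stable by (auto simp: H_minus_def)
  show "\<forall>(a, b)\<in>H_plus. unstable (vf a b) (P_eq a)"
    using H_plus_unstable by (auto simp: H_plus_def)
  show "\<forall>(a0, b0)\<in>H_minus - {B_point}. \<exists>U. open U \<and> (a0, b0) \<in> U \<and>
      (\<forall>(a, b)\<in>U. a > 0 \<longrightarrow> b > 0 \<longrightarrow> b < b_H a \<longrightarrow>
         unstable (vf a b) (P_eq a) \<and>
         (\<exists>\<Gamma>. stable_limit_cycle (vf a b) \<Gamma> \<and> surrounds \<Gamma> (P_eq a)))"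
  proof (rule ballI)
    fix z assume "z \<in> H_minus - {B_point}"
    then obtain a0 where a0: "5 * sqrt (5 / 3) < a0" "a0 < a_B" and z: "z = (a0, b_H a0)"
      by (auto simp: H_minus_def B_point_def less_le)
    obtain U where "open U" "(a0, b_H a0) \<in> U"
      "\<And>a b. (a, b) \<in> U \<Longrightarrow> a > 0 \<Longrightarrow> b > 0 \<Longrightarrow> b < b_H a \<Longrightarrow> unstable (vf a b) (P_eq a) \<and>
       (\<exists>\<Gamma>. stable_limit_cycle (vf a b) \<Gamma> \<and> surrounds \<Gamma> (P_eq a))"
      using H_minus_cycle[OF a0] by blast
    then show "case z of (a0, b0) \<Rightarrow> \<exists>U. open U \<and> (a0, b0) \<in> U \<and> (\<forall>(a, b)\<in>U. a > 0 \<longrightarrow> b > 0 \<longrightarrow> b < b_H a \<longrightarrow>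
         unstable (vf a b) (P_eq a) \<and> (\<exists>\<Gamma>. stable_limit_cycle (vf a b) \<Gamma> \<and> surrounds \<Gamma> (P_eq a)))"
      unfolding z prod.case by (intro exI[of _ U]) auto
  qed
  show "\<forall>(a0, b0)\<in>H_plus. \<exists>U. open U \<and> (a0, b0) \<in> U \<and>
      (\<forall>(a, b)\<in>U. a > 0 \<longrightarrow> b > 0 \<longrightarrow> b > b_H a \<longrightarrow>
         asymptotically_stable (vf a b) (P_eq a) \<and>
         (\<exists>\<Gamma>. unstable_limit_cycle (vf a b) \<Gamma> \<and> surrounds \<Gamma> (P_eq a)))"
  proof (rule ballI)
    fix z assume "z \<in> H_plus"
    then obtain a0 where a0: "a_B < a0" and z: "z = (a0, b_H a0)" by (auto simp: H_plus_def)
    obtain U where "open U" "(a0, b_H a0) \<in> U"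
      "\<And>a b. (a, b) \<in> U \<Longrightarrow> a > 0 \<Longrightarrow> b > 0 \<Longrightarrow> b > b_H a \<Longrightarrow> asymptotically_stable (vf a b) (P_eq a) \<and>
       (\<exists>\<Gamma>. unstable_limit_cycle (vf a b) \<Gamma> \<and> surrounds \<Gamma> (P_eq a))"
      using H_plus_cycle[OF a0] by blast
    then show "case z of (a0, b0) \<Rightarrow> \<exists>U. open U \<and> (a0, b0) \<in> U \<and> (\<forall>(a, b)\<in>U. a > 0 \<longrightarrow> b > 0 \<longrightarrow> b > b_H a \<longrightarrow>
         asymptotically_stable (vf a b) (P_eq a) \<and> (\<exists>\<Gamma>. unstable_limit_cycle (vf a b) \<Gamma> \<and> surrounds \<Gamma> (P_eq a)))"
      unfolding z prod.case by (intro exI[of _ U]) auto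
  qed
qed

end
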